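(* Let $d\in\mathbb{N}$, $\alpha_1,\dots,\alpha_d\in(0,1]$, let $a_{ij}\in\mathbb{C}$ ($1\le i\le j\le d$) with $a_{ii}\ne0$ for all $i$, and let $g_i:[0,\infty)\to\mathbb{C}$ ($i=1,\dots,d$) be continuous functions with $\lim_{t\to\infty}g_i(t)=0$. Consider the inhomogeneous system $$D_*^{\alpha_i}x_i(t)=\sum_{j=i}^d a_{ij}x_j(t)+g_i(t),\qquad 1\le i\le d,\ t>0.$$ Every solution of this inhomogeneous system converges to zero as $t\to\infty$ if and only if all solutions of the associated homogeneous system $$D_*^{\alpha_i}x_i(t)=\sum_{j=i}^d a_{ij}x_j(t),\qquad 1\le i\le d,\ t>0,$$ tend to zero as $t\to\infty$, i.e. if and only if $$|\arg(a_{kk})|>\frac{\alpha_k\pi}{2}\qquad\text{for all } k\in\{1,\dots,d\}.$$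
   Context: $D_*^{\alpha}$ denotes the Caputo derivative of order $\alpha$. By definition, a solution of the inhomogeneous system with initial condition $x(0)=x_0=(x_1^0,\dots,x_d^0)^\top\in\mathbb{C}^d$ is a continuous function $x=(x_1,\dots,x_d)^\top:[0,\infty)\to\mathbb{C}^d$ satisfying $$x_i(t)=x_i^0+\frac{1}{\Gamma(\alpha_i)}\int_0^t(t-s)^{\alpha_i-1}\Big(\sum_{j=i}^d a_{ij}x_j(s)+g_i(s)\Big)ds\qquad\text{for all } t\ge0,\ 1\le i\le d;$$ for the homogeneous system take $g_i=0$. For every $x_0\in\mathbb{C}^d$ there is exactly one such solution; "every solution" means the solutions for all $x_0\in\mathbb{C}^d$. The argument $\arg$ takes values in $(-\pi,\pi]$. *)

theory Defs
  imports "HOL-Analysis.Analysis"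
begin

text \<open>
  The Riemann--Liouville integral of order \<open>\<alpha> > 0\<close> with lower limit \<open>0\<close>. The convention
  \<open>0 powr (\<alpha> - 1) = 0\<close> affects the integrand only at the single point \<open>s = t\<close>. For continuous
  \<open>f\<close> the integrand is absolutely integrable, so the gauge integral used here is the Lebesgue
  integral.
\<close>

definition RL_integral :: "real \<Rightarrow> (real \<Rightarrow> complex) \<Rightarrow> real \<Rightarrow> complex" where
  "RL_integral \<alpha> f t =
     1 / complex_of_real (Gamma \<alpha>) *
     integral {0..t} (\<lambda>s. complex_of_real ((t - s) powr (\<alpha> - 1)) * f s)"

text \<open>
  Solutions of the triangular Caputo system
  \<open>D\<^sub>*\<^bsup>\<alpha>\<^sub>i\<^esup> x\<^sub>i(t) = (\<Sum>j\<ge>i. a\<^sub>i\<^sub>j x\<^sub>j(t)) + g\<^sub>i(t)\<close>, \<open>x(0) = x\<^sub>0\<close>, understood as continuous solutions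
  of the equivalent Volterra equation. The components are indexed by a finite linearly ordered
  type \<open>'n\<close>, which plays the role of \<open>{1, \<dots>, d}\<close> with \<open>d = CARD('n)\<close>. Entries of \<open>a\<close> below the
  diagonal and values of \<open>x\<close> and \<open>g\<close> at negative times are irrelevant.
\<close>

definition caputo_solution ::
  "real ^ ('n::{finite,linorder}) \<Rightarrow>
   complex ^ ('n::{finite,linorder}) ^ ('n::{finite,linorder}) \<Rightarrow> (real \<Rightarrow> complex ^ ('n::{finite,linorder})) \<Rightarrow>
   complex ^ ('n::{finite,linorder}) \<Rightarrow> (real \<Rightarrow> complex ^ ('n::{finite,linorder})) \<Rightarrow> bool" where
  "caputo_solution \<alpha> a g x0 x \<longleftrightarrow>
     continuous_on {0..} x \<and>
     (\<forall>t\<ge>0. \<forall>i. x t $ i =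
        x0 $ i + RL_integral (\<alpha> $ i) (\<lambda>s. (\<Sum>j\<in>{i..}. a $ i $ j * x s $ j) + g s $ i) t)"

end

(*
  The scalar equation x = x0 + k * (mu x + f), with k(t) = t^(alpha-1) / Gamma(alpha), has the unique
  solution x = x0 e + r * f, where e(t) = E_alpha(mu t^alpha) and r = e'/mu.

  Stability: if |arg mu| > alpha pi/2, then r is integrable and e tends to 0. The operator
  y |-> k * y on L^2(0,T) is sectorial with angle alpha pi/2, so y = F + mu k * y implies
  |y| <= K |F| in L^2(0,T) with K independent of T. Applied to e plus an explicit function that
  decays like t^(-alpha), and then to e + (t/alpha) e', this bounds the squared L^2(0,T) norms of e
  and of t e' by a multiple of T^(1-alpha), and summing over dyadic intervals shows that r is integrable.

  Instability: if |arg mu| <= alpha pi/2 and x = 1 + mu k * x tends to 0, then its Laplace transform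
  satisfies X(s) (s^alpha - mu) = s^(alpha-1) for Re s > 0. Letting s tend to mu^(1/alpha) from the
  right, the left-hand side tends to 0 because X(s) = o(1 / Re s), but the right-hand side does not.
*)

theory Submission
  imports Defs "HOL-Real_Asymp.Real_Asymp"
begin

section \<open>Convolution on the half-line\<close>

text \<open>The L^2 route avoids contour integrals and asymptotic expansions of E_alpha: for alpha <
  1 the sector condition enters the stability half only through \<open>rotation_exists\<close>. The
  forcing 1 has squared norm T on [0,T], which is too large. Adding h/mu with k * h = 1 from t = 1
  on leaves a right-hand side bounded by a multiple of min(1, t^(-alpha)), whose square integrates
  to at most a multiple of T^(1-alpha). The function e + (t/alpha) e' is chosen because it solves
  the same Volterra equation with e as forcing, so the estimate can be iterated. On [T, 2T] an
  inequality of Cauchy-Schwarz type then bounds the integral of |r| by a multiple of T^(-1) T^(1/2)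
  T^((1-alpha)/2) = T^(-alpha/2), which is summable over T = 2^m. For alpha = 1 everything is
  explicit, E_1 being exp. In the system, component i sees the later components as forcing, so decay
  passes from the last index downwards. For necessity the initial vector with a single 1 at k makes
  the later components vanish and isolates the scalar equation at k. Stability of the inhomogeneous
  system passes to the homogeneous one because a homogeneous solution is a difference of two
  inhomogeneous ones.\<close>

definition conv :: "(real \<Rightarrow> complex) \<Rightarrow> (real \<Rightarrow> complex) \<Rightarrow> real \<Rightarrow> complex" where
  "conv p f t = (LBINT u:{0..t}. p u * f (t - u))"

text \<open>The class for the possibly singular kernel in the first slot of \<open>conv\<close>; in
  the main rules the second slot holds a function continuous on the whole line. Integrability
  concerns only [0, T], since \<open>conv\<close> ignores p at negative arguments, while
  measurability is global so that Fubini applies directly.\<close>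

definition locally_integrable :: "(real \<Rightarrow> complex) \<Rightarrow> bool" where
  "locally_integrable p \<longleftrightarrow> p \<in> borel_measurable borel \<and> (\<forall>T. set_integrable lborel {0..T} p)"

lemma integrable_indicator_Icc_complex: "integrable lborel (indicator {a..b::real} :: real \<Rightarrow> complex)"
proof -
  have "integrable lborel (\<lambda>x. complex_of_real (indicator {a..b} x))"
    by (intro integrable_of_real) (auto simp: integrable_indicator_iff emeasure_lborel_Icc_eq)
  then show ?thesis by (simp add: of_real_indicator)
qed

lemma locally_integrable_continuous:
  assumes "continuous_on UNIV p" shows "locally_integrable p"
  unfolding locally_integrable_def
  using assms borel_integrable_compact[of "{0..T}" p for T] borel_measurable_continuous_onI[OF assms]
  by (auto simp: set_integrable_def intro: continuous_on_subset)

lemma conv_nonpos: "t \<le> 0 \<Longrightarrow> conv p f t = 0"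
proof -
  assume t: "t \<le> 0"
  have "AE u in lborel. indicator {0..t} u *\<^sub>R (p u * f (t - u)) = 0"
    using AE_lborel_singleton[of 0] by eventually_elim (use t in \<open>auto simp: indicator_def\<close>)
  then show ?thesis
    unfolding conv_def set_lebesgue_integral_def by (rule integral_eq_zero_AE)
qed

lemma continuous_bounded_Icc:
  fixes f :: "real \<Rightarrow> complex"
  assumes "continuous_on UNIV f"
  obtains M where "M \<ge> 0" "\<And>u. u \<in> {a..b} \<Longrightarrow> norm (f u) \<le> M"
proof -
  have "bounded (f ` {a..b})"
    using assms by (intro compact_imp_bounded compact_continuous_image) (auto intro: continuous_on_subset)
  then obtain M where "\<forall>x\<in>f ` {a..b}. norm x \<le> M" unfolding bounded_iff by blast
  then show ?thesis by (intro that[of "max M 0"]) force+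
qed

lemma set_integrable_conv:
  assumes p: "locally_integrable p" and f: "continuous_on UNIV f"
  shows "set_integrable lborel {0..t} (\<lambda>u. p u * f (t - u))"
proof -
  obtain M where M: "M \<ge> 0" "\<And>u. u \<in> {0..t} \<Longrightarrow> norm (f u) \<le> M"
    using continuous_bounded_Icc[OF f] by blast
  have [measurable]: "p \<in> borel_measurable borel" "f \<in> borel_measurable borel"
    using p f by (auto simp: locally_integrable_def intro: borel_measurable_continuous_onI)
  have "integrable lborel (\<lambda>u. M *\<^sub>R (indicator {0..t} u *\<^sub>R p u))"
    using p unfolding locally_integrable_def set_integrable_def by (intro integrable_scaleR_right) auto
  then show ?thesis
    unfolding set_integrable_def
    by (rule Bochner_Integration.integrable_bound)
       (use M in \<open>auto intro!: AE_I2 simp: indicator_def norm_mult mult.commute[of M] intro!: mult_left_mono\<close>)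
qed

lemma conv_commute: "conv p f t = conv f p t"
proof -
  have "conv p f t = (\<integral>u. indicator {0..t} u *\<^sub>R (p u * f (t - u)) \<partial>lborel)"
    by (simp add: conv_def set_lebesgue_integral_def)
  also have "\<dots> = (\<integral>u. indicator {0..t} (t + (-1) * u) *\<^sub>R (p (t + (-1) * u) * f (t - (t + (-1) * u))) \<partial>lborel)"
    by (subst lborel_integral_real_affine[of "-1" _ t]) auto
  also have "\<dots> = conv f p t"
    unfolding conv_def set_lebesgue_integral_def
    by (intro Bochner_Integration.integral_cong) (auto simp: indicator_def)
  finally show ?thesis .
qed

text \<open>Dominated convergence along a sequence tending to t: the indicator jumps only at the
  null point u = t, and with B a bound of the sequence, M |p| on [0, B] is a majorant.\<close>

lemma continuous_conv:
  assumes p: "locally_integrable p" and f: "continuous_on UNIV f"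
  shows "continuous_on UNIV (conv p f)"
proof -
  have [measurable]: "p \<in> borel_measurable borel" "f \<in> borel_measurable borel"
    using p f by (auto simp: locally_integrable_def intro: borel_measurable_continuous_onI)
  have "(\<lambda>n. conv p f (X n)) \<longlonglongrightarrow> conv p f t" if X: "X \<longlonglongrightarrow> t" for X t
  proof -
    obtain B where B: "\<And>n. norm (X n) \<le> B" using convergent_imp_Bseq[OF convergentI[OF X]]
      unfolding Bseq_def by auto
    then have B': "X n \<le> B" for n by (metis abs_le_D1 real_norm_def)
    obtain M where M: "M \<ge> 0" "\<And>u. u \<in> {0..B} \<Longrightarrow> norm (f u) \<le> M"
      using continuous_bounded_Icc[OF f] by blast
    have lim: "(\<lambda>n. indicator {0..X n} u *\<^sub>R (p u * f (X n - u))) \<longlonglongrightarrow> indicator {0..t} u *\<^sub>R (p u * f (t - u))"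
      if "u \<noteq> t" for u
    proof -
      have "(\<lambda>n. indicator {0..X n} u :: real) \<longlonglongrightarrow> indicator {0..t} u"
      proof (rule tendsto_eventually)
        show "eventually (\<lambda>n. indicator {0..X n} u = (indicator {0..t} u :: real)) sequentially"
        proof (cases "u < t")
          case True
          then have "eventually (\<lambda>n. u < X n) sequentially" using X by (simp add: order_tendstoD)
          then show ?thesis by eventually_elim (use True in \<open>auto simp: indicator_def\<close>)
        next
          case False
          then have "eventually (\<lambda>n. X n < u) sequentially" using X that by (simp add: order_tendstoD)
          then show ?thesis by eventually_elim (use False that in \<open>auto simp: indicator_def\<close>)
        qed
      qed
      moreover have "(\<lambda>n. f (X n - u)) \<longlonglongrightarrow> f (t - u)"
        using f X by (intro isCont_tendsto_compose[of _ f] tendsto_intros) (auto simp: continuous_on_eq_continuous_at)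
      ultimately show ?thesis by (intro tendsto_intros)
    qed
    show ?thesis
      unfolding conv_def set_lebesgue_integral_def
    proof (rule integral_dominated_convergence[where w = "\<lambda>u. M * norm (indicator {0..B} u *\<^sub>R p u)"])
      show "integrable lborel (\<lambda>u. M * norm (indicator {0..B} u *\<^sub>R p u))"
        using p unfolding locally_integrable_def set_integrable_def by (intro integrable_mult_right integrable_norm) auto
      show "AE u in lborel. (\<lambda>n. indicator {0..X n} u *\<^sub>R (p u * f (X n - u))) \<longlonglongrightarrow> indicator {0..t} u *\<^sub>R (p u * f (t - u))"
        using AE_lborel_singleton[of t] by eventually_elim (rule lim)
      show "AE u in lborel. norm (indicator {0..X n} u *\<^sub>R (p u * f (X n - u))) \<le> M * norm (indicator {0..B} u *\<^sub>R p u)" for n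
      proof (rule AE_I2)
        fix u
        have "norm (f (X n - u)) \<le> M" if "0 \<le> u" "u \<le> X n" using that B'[of n] by (intro M) auto
        then show "norm (indicator {0..X n} u *\<^sub>R (p u * f (X n - u))) \<le> M * norm (indicator {0..B} u *\<^sub>R p u)"
          using B'[of n] M(1) by (auto simp: indicator_def norm_mult mult.commute[of M] intro!: mult_left_mono)
      qed
    qed auto
  qed
  then show ?thesis by (auto simp: continuous_on_sequentially o_def)
qed

text \<open>Fubini on the triangle 0 \<le> u \<le> s \<le> t. As q and f are bounded on [0, t], the
  integrand is dominated by |p(u)| M N on the square.\<close>

lemma conv_assoc:
  assumes p: "locally_integrable p" and q: "continuous_on UNIV q" and f: "continuous_on UNIV f"
  shows "conv p (conv q f) t = conv (conv p q) f t"
proof -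
  have [measurable]: "p \<in> borel_measurable borel" "q \<in> borel_measurable borel" "f \<in> borel_measurable borel"
    using p q f by (auto simp: locally_integrable_def intro: borel_measurable_continuous_onI)
  define h where "h u s = (if 0 \<le> u \<and> u \<le> s \<and> s \<le> t then p u * q (s - u) * f (t - s) else 0)" for u s
  obtain M where M: "M \<ge> 0" "\<And>u. u \<in> {0..t} \<Longrightarrow> norm (q u) \<le> M"
    using continuous_bounded_Icc[OF q] by blast
  obtain N where N: "N \<ge> 0" "\<And>u. u \<in> {0..t} \<Longrightarrow> norm (f u) \<le> N"
    using continuous_bounded_Icc[OF f] by blast
  have [measurable]: "(\<lambda>(u, s). h u s) \<in> borel_measurable (lborel \<Otimes>\<^sub>M lborel)"
    unfolding h_def by measurable
  have int: "integrable (lborel \<Otimes>\<^sub>M lborel) (\<lambda>(u, s). h u s)"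
  proof (rule Bochner_Integration.integrable_bound)
    show "integrable (lborel \<Otimes>\<^sub>M lborel) (\<lambda>(u, s). (indicator {0..t} u *\<^sub>R p u) * (complex_of_real (M * N) * indicator {0..t} s))"
    proof (rule lborel_pair.Fubini_integrable)
      have 1: "integrable lborel (\<lambda>s. complex_of_real (M * N) * indicator {0..t} s)"
        by (intro integrable_mult_right) (rule integrable_indicator_Icc_complex)
      show "AE u in lborel. integrable lborel (\<lambda>s. case (u, s) of (u, s) \<Rightarrow> (indicator {0..t} u *\<^sub>R p u) * (complex_of_real (M * N) * indicator {0..t} s))"
        using 1 by (auto simp: indicator_def)
      have "integrable lborel (\<lambda>u. norm (indicator {0..t} u *\<^sub>R p u) * (\<integral>s. norm (complex_of_real (M * N) * indicator {0..t} s) \<partial>lborel))"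
        using p unfolding locally_integrable_def set_integrable_def by (intro integrable_mult_left integrable_norm) auto
      then show "integrable lborel (\<lambda>u. \<integral>s. norm (case (u, s) of (u, s) \<Rightarrow> (indicator {0..t} u *\<^sub>R p u) * (complex_of_real (M * N) * indicator {0..t} s)) \<partial>lborel)"
        by (simp only: prod.case norm_mult[of "indicator _ _ *\<^sub>R _"] integral_mult_right_zero)
    qed measurable
    show "AE z in lborel \<Otimes>\<^sub>M lborel. norm (case z of (u, s) \<Rightarrow> h u s) \<le>
       norm (case z of (u, s) \<Rightarrow> (indicator {0..t} u *\<^sub>R p u) * (complex_of_real (M * N) * indicator {0..t} s))"
    proof (rule AE_I2, clarify)
      fix u s
      show "norm (h u s) \<le> norm ((indicator {0..t} u *\<^sub>R p u) * (complex_of_real (M * N) * indicator {0..t} s))"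
      proof (cases "0 \<le> u \<and> u \<le> s \<and> s \<le> t")
        case True
        then have "norm (q (s - u)) * norm (f (t - s)) \<le> M * N"
          using M N by (intro mult_mono) auto
        then have "norm (p u) * (norm (q (s - u)) * norm (f (t - s))) \<le> norm (p u) * (M * N)"
          by (intro mult_left_mono) auto
        then show ?thesis using True M(1) N(1) by (auto simp: h_def norm_mult mult.assoc)
      qed (auto simp: h_def)
    qed
  qed measurable
  have "conv p (conv q f) t = (\<integral>u. \<integral>s. h u s \<partial>lborel \<partial>lborel)"
    unfolding conv_def set_lebesgue_integral_def
  proof (rule Bochner_Integration.integral_cong[OF refl])
    fix u
    have "indicator {0..t} u *\<^sub>R (p u * (\<integral>w. indicator {0..t - u} w *\<^sub>R (q w * f (t - u - w)) \<partial>lborel)) =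
          (\<integral>w. (indicator {0..t} u *\<^sub>R p u) * (indicator {0..t - u} w *\<^sub>R (q w * f (t - u - w))) \<partial>lborel)"
      by (subst integral_mult_right_zero) simp
    also have "\<dots> = (\<integral>s. (indicator {0..t} u *\<^sub>R p u) * (indicator {0..t - u} (-u + 1 * s) *\<^sub>R (q (-u + 1 * s) * f (t - u - (-u + 1 * s)))) \<partial>lborel)"
      by (subst lborel_integral_real_affine[of 1 _ "-u"]) auto
    also have "\<dots> = (\<integral>s. h u s \<partial>lborel)"
      by (intro Bochner_Integration.integral_cong refl) (auto simp: h_def indicator_def)
    finally show "indicator {0..t} u *\<^sub>R (p u * (\<integral>w. indicator {0..t - u} w *\<^sub>R (q w * f (t - u - w)) \<partial>lborel)) = (\<integral>s. h u s \<partial>lborel)" .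
  qed
  also have "\<dots> = (\<integral>s. \<integral>u. h u s \<partial>lborel \<partial>lborel)"
    using lborel_pair.Fubini_integral[OF int] by simp
  also have "\<dots> = conv (conv p q) f t"
    unfolding conv_def set_lebesgue_integral_def
  proof (rule Bochner_Integration.integral_cong[OF refl])
    fix s
    have "(\<integral>u. h u s \<partial>lborel) = (\<integral>u. (indicator {0..s} u *\<^sub>R (p u * q (s - u))) * (indicator {0..t} s *\<^sub>R f (t - s)) \<partial>lborel)"
      by (intro Bochner_Integration.integral_cong refl) (auto simp: h_def indicator_def)
    also have "\<dots> = indicator {0..t} s *\<^sub>R ((\<integral>u. indicator {0..s} u *\<^sub>R (p u * q (s - u)) \<partial>lborel) * f (t - s))"
      by (subst integral_mult_left_zero) simp
    finally show "(\<integral>u. h u s \<partial>lborel) = indicator {0..t} s *\<^sub>R ((\<integral>u. indicator {0..s} u *\<^sub>R (p u * q (s - u)) \<partial>lborel) * f (t - s))" .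
  qed
  finally show ?thesis .
qed

lemma conv_add_right:
  assumes "locally_integrable p" "continuous_on UNIV f" "continuous_on UNIV g"
  shows "conv p (\<lambda>s. f s + g s) t = conv p f t + conv p g t"
  using set_integrable_conv[OF assms(1,2), of t] set_integrable_conv[OF assms(1,3), of t]
  unfolding conv_def by (simp add: ring_distribs set_integral_add)

lemma conv_mult_right: "conv p (\<lambda>s. c * f s) t = c * conv p f t"
  unfolding conv_def by (simp add: mult.left_commute flip: set_integral_mult_right)

lemma conv_cong:
  assumes "\<And>s. 0 \<le> s \<Longrightarrow> s \<le> t \<Longrightarrow> p s = q s" "\<And>s. 0 \<le> s \<Longrightarrow> s \<le> t \<Longrightarrow> f s = g s"
  shows "conv p f t = conv q g t"
  unfolding conv_def using assms by (intro set_lebesgue_integral_cong) auto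

section \<open>Integration as convolution with 1\<close>

lemma conv_const_1_eq_integral:
  assumes "continuous_on UNIV f"
  shows "conv (\<lambda>_. 1) f t = integral {0..t} f"
proof -
  have "conv (\<lambda>_. 1) f t = (LBINT u:{0..t}. f u)"
    by (subst conv_commute) (simp add: conv_def)
  also have "\<dots> = integral {0..t} f"
    using locally_integrable_continuous[OF assms]
    by (intro set_borel_integral_eq_integral) (auto simp: locally_integrable_def)
  finally show ?thesis .
qed

text \<open>Differentiates both primitives. Identities for the resolvent r are first available in
  integrated form, and this lemma removes the integration.\<close>

lemma conv_const_1_inject:
  assumes f: "continuous_on UNIV f" and g: "continuous_on UNIV g"
    and eq: "\<And>t. t \<ge> 0 \<Longrightarrow> conv (\<lambda>_. 1) f t = conv (\<lambda>_. 1) g t" and t: "t \<ge> 0"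
  shows "f t = g t"
proof -
  \<comment> \<open>The interval reaches to t + 1 so that even at t = 0 the one-sided derivative is
    unique.\<close>
  have df: "((\<lambda>t. integral {0..t} f) has_vector_derivative f t) (at t within {0..t+1})"
    and dg: "((\<lambda>t. integral {0..t} g) has_vector_derivative g t) (at t within {0..t+1})"
    using f g t by (auto intro!: integral_has_vector_derivative intro: continuous_on_subset)
  have "((\<lambda>t. integral {0..t} f) has_vector_derivative g t) (at t within {0..t+1})"
    by (rule has_vector_derivative_transform[OF _ _ dg])
       (use t eq in \<open>auto simp: conv_const_1_eq_integral f g\<close>)
  then show ?thesis
    using t df by (intro vector_derivative_unique_within[OF _ df]) (auto simp: trivial_limit_within islimpt_Icc)
qed

section \<open>The Mittag-Leffler function\<close>

definition RL_kernel :: "real \<Rightarrow> real \<Rightarrow> complex" where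
  "RL_kernel \<alpha> u = complex_of_real (u powr (\<alpha> - 1) / Gamma \<alpha>)"

text \<open>For nonnegative functions gauge integrability is absolute. This turns the
  \<open>has_integral\<close> forms of the Beta and Gamma integrals into Lebesgue integrals.\<close>

lemma set_integrable_lborel_nonneg:
  fixes f :: "real \<Rightarrow> real"
  assumes [measurable]: "f \<in> borel_measurable borel" "S \<in> sets borel"
    and "\<And>x. x \<in> S \<Longrightarrow> 0 \<le> f x" "f integrable_on S"
  shows "set_integrable lborel S f"
proof -
  have "set_integrable lebesgue S f"
    using assms by (intro nonnegative_absolutely_integrable_1) auto
  then show ?thesis
    unfolding set_integrable_def by (subst (asm) integrable_completion) auto
qed

lemma set_integrable_powr:
  fixes \<alpha> T :: real
  assumes "\<alpha> > 0" shows "set_integrable lborel {0..T} (\<lambda>u. u powr (\<alpha> - 1))"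
proof (cases "T \<ge> 0")
  case True
  then show ?thesis
    using assms set_integrable_lborel_nonneg[of "\<lambda>u::real. u powr (\<alpha> - 1)" "{0..T}"] integrable_on_powr_from_0[of "\<alpha> - 1" T]
    by auto
qed (simp add: set_integrable_def)

lemma locally_integrable_powr_mult:
  assumes \<alpha>: "\<alpha> > 0" and f: "continuous_on UNIV f"
  shows "locally_integrable (\<lambda>u. complex_of_real (u powr (\<alpha> - 1)) * f u)"
proof -
  have [measurable]: "f \<in> borel_measurable borel"
    using f by (rule borel_measurable_continuous_onI)
  have "set_integrable lborel {0..T} (\<lambda>u. complex_of_real (u powr (\<alpha> - 1)) * f u)" for T
  proof -
    obtain M where M: "M \<ge> 0" "\<And>u. u \<in> {0..T} \<Longrightarrow> norm (f u) \<le> M"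
      using continuous_bounded_Icc[OF f] by blast
    have "integrable lborel (\<lambda>u. M *\<^sub>R (indicator {0..T} u *\<^sub>R u powr (\<alpha> - 1)))"
      using set_integrable_powr[OF \<alpha>] unfolding set_integrable_def by (intro integrable_scaleR_right) auto
    then show ?thesis
      unfolding set_integrable_def
      by (rule Bochner_Integration.integrable_bound)
         (use M in \<open>auto intro!: AE_I2 simp: indicator_def norm_mult mult.commute[of M] intro!: mult_left_mono\<close>)
  qed
  then show ?thesis by (auto simp: locally_integrable_def)
qed

lemma locally_integrable_RL_kernel: "\<alpha> > 0 \<Longrightarrow> locally_integrable (RL_kernel \<alpha>)"
  using locally_integrable_powr_mult[of \<alpha> "\<lambda>_. 1 / complex_of_real (Gamma \<alpha>)"]
  by (simp add: RL_kernel_def[abs_def])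

text \<open>The substitution u = t v reduces the integral to Beta(alpha, c + 1).\<close>

lemma conv_RL_kernel_powr:
  assumes \<alpha>: "\<alpha> > 0" and c: "c > -1" and t: "t > 0"
  shows "conv (RL_kernel \<alpha>) (\<lambda>s. complex_of_real (s powr c)) t =
    complex_of_real (Gamma (c + 1) / Gamma (c + 1 + \<alpha>) * t powr (c + \<alpha>))"
proof -
  have I: "set_integrable lborel {0..1} (\<lambda>t::real. t powr (\<alpha> - 1) * (1 - t) powr (c + 1 - 1))"
    using has_integral_Beta_real[of \<alpha> "c + 1"] \<alpha> c
    by (intro set_integrable_lborel_nonneg) (auto simp: integrable_on_def)
  have B: "(LBINT u:{0..1}. u powr (\<alpha> - 1) * (1 - u) powr (c + 1 - 1)) = Beta \<alpha> (c + 1)"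
    using has_integral_Beta_real[of \<alpha> "c + 1"] \<alpha> c set_borel_integral_eq_integral(2)[OF I]
    by (auto simp: integral_unique)
  have G: "Gamma \<alpha> > 0" using \<alpha> by (rule Gamma_real_pos)
  have "conv (RL_kernel \<alpha>) (\<lambda>s. complex_of_real (s powr c)) t =
    (LBINT u. complex_of_real (indicator {0..t} u * (u powr (\<alpha> - 1) / Gamma \<alpha> * (t - u) powr c)))"
    unfolding conv_def set_lebesgue_integral_def RL_kernel_def
    by (intro Bochner_Integration.integral_cong refl) (auto simp: indicator_def)
  also have "\<dots> = complex_of_real (LBINT u. indicator {0..t} u * (u powr (\<alpha> - 1) / Gamma \<alpha> * (t - u) powr c))"
    by (rule integral_complex_of_real)
  also have "(LBINT u. indicator {0..t} u * (u powr (\<alpha> - 1) / Gamma \<alpha> * (t - u) powr c)) =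
     t * (LBINT u. indicator {0..t} (0 + t * u) * ((0 + t * u) powr (\<alpha> - 1) / Gamma \<alpha> * (t - (0 + t * u)) powr c))"
    using t by (subst lborel_integral_real_affine[of t _ 0]) auto
  also have "(LBINT u. indicator {0..t} (0 + t * u) * ((0 + t * u) powr (\<alpha> - 1) / Gamma \<alpha> * (t - (0 + t * u)) powr c)) =
     (LBINT u. (t powr (\<alpha> - 1 + c) / Gamma \<alpha>) * (indicator {0..1} u *\<^sub>R (u powr (\<alpha> - 1) * (1 - u) powr (c + 1 - 1))))"
  proof (intro Bochner_Integration.integral_cong refl)
    fix u :: real
    have "t - t * u = t * (1 - u)" by (simp add: algebra_simps)
    moreover have "t * u \<le> t \<longleftrightarrow> u \<le> 1" using t by simp
    ultimately show "indicator {0..t} (0 + t * u) * ((0 + t * u) powr (\<alpha> - 1) / Gamma \<alpha> * (t - (0 + t * u)) powr c) =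
      (t powr (\<alpha> - 1 + c) / Gamma \<alpha>) * (indicator {0..1} u *\<^sub>R (u powr (\<alpha> - 1) * (1 - u) powr (c + 1 - 1)))"
      using t by (auto simp: indicator_def powr_mult powr_add zero_le_mult_iff)
  qed
  also have "\<dots> = (t powr (\<alpha> - 1 + c) / Gamma \<alpha>) * Beta \<alpha> (c + 1)"
    by (subst integral_mult_right_zero) (use B in \<open>simp add: set_lebesgue_integral_def\<close>)
  also have "t * ((t powr (\<alpha> - 1 + c) / Gamma \<alpha>) * Beta \<alpha> (c + 1)) =
     Gamma (c + 1) / Gamma (c + 1 + \<alpha>) * t powr (c + \<alpha>)"
    using G t by (simp add: Beta_def add_ac powr_add powr_diff)
  finally show ?thesis .
qed

text \<open>Keeps only the part of the Gamma integral over [M, \<infinity>), where t^x \<ge> M^x.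
  Since M is arbitrary, Gamma outgrows every exponential.\<close>

lemma Gamma_plus1_lower_bound:
  fixes x M :: real
  assumes "x \<ge> 0" "M > 0"
  shows "M powr x * exp (- M) \<le> Gamma (x + 1)"
proof -
  have 1: "((\<lambda>t. M powr x * exp (- 1 * t)) has_integral M powr x * (exp (- 1 * M) / 1)) {M..}"
    by (intro has_integral_mult_right has_integral_exp_minus_to_infinity) auto
  have 2: "((\<lambda>t. t powr (x + 1 - 1) / exp t) has_integral Gamma (x + 1)) {0..}"
    using assms by (intro Gamma_integral_real) auto
  have 3: "((\<lambda>t. if t \<in> {M..} then M powr x * exp (- 1 * t) else 0) has_integral M powr x * (exp (- 1 * M) / 1)) {0..}"
    using 1 assms by (subst has_integral_restrict) auto
  have "(if t \<in> {M..} then M powr x * exp (- 1 * t) else 0) \<le> t powr (x + 1 - 1) / exp t" for t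
    using assms by (auto simp: exp_minus field_simps intro!: powr_mono2)
  from has_integral_le[OF 3 2 this] show ?thesis by simp
qed

definition mittag_leffler_coeff :: "real \<Rightarrow> nat \<Rightarrow> complex" where
  "mittag_leffler_coeff \<alpha> n = complex_of_real (1 / Gamma (\<alpha> * real n + 1))"

lemma summable_mittag_leffler_coeff:
  assumes \<alpha>: "\<alpha> > 0"
  shows "summable (\<lambda>n. mittag_leffler_coeff \<alpha> n * z ^ n)"
proof -
  \<comment> \<open>With M^alpha = 2 (|z| + 1) the lower bound for Gamma(alpha n + 1) contains (2
    (|z| + 1))^n, which yields the geometric ratio 1/2. The summand 1 keeps M positive for z =
    0.\<close>
  define M where "M = (2 * (norm z + 1)) powr (1 / \<alpha>)"
  have M: "M > 0" "M powr \<alpha> = 2 * (norm z + 1)"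
    using \<alpha> by (auto simp: M_def powr_powr add_nonneg_eq_0_iff)
  show ?thesis
  proof (rule summable_comparison_test')
    show "summable (\<lambda>n. exp M * (1 / 2) ^ n :: real)"
      by (intro summable_mult summable_geometric) auto
    show "norm (mittag_leffler_coeff \<alpha> n * z ^ n) \<le> exp M * (1 / 2) ^ n" for n
    proof -
      have "(2 * (norm z + 1)) ^ n * exp (- M) \<le> Gamma (\<alpha> * real n + 1)"
        using Gamma_plus1_lower_bound[of "\<alpha> * real n" M] M \<alpha> powr_realpow[of "2 * (norm z + 1)" n]
        by (simp add: powr_powr[symmetric] add_nonneg_pos)
      moreover have G: "Gamma (\<alpha> * real n + 1) > 0" using \<alpha> by (intro Gamma_real_pos) (auto intro: add_nonneg_pos)
      moreover have "(2 * norm z) ^ n \<le> (2 * (norm z + 1)) ^ n" by (intro power_mono) auto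
      then have "(2 * norm z) ^ n * exp (- M) \<le> (2 * (norm z + 1)) ^ n * exp (- M)" by simp
      ultimately have L: "(2 * norm z) ^ n * exp (- M) \<le> Gamma (\<alpha> * real n + 1)"
        by linarith
      have "norm (mittag_leffler_coeff \<alpha> n * z ^ n) = norm z ^ n / Gamma (\<alpha> * real n + 1)"
        using G by (simp add: mittag_leffler_coeff_def norm_mult norm_power norm_divide)
      also have "\<dots> \<le> exp M * (1 / 2) ^ n"
        using L G by (simp add: power_mult_distrib power_divide exp_minus field_simps)
      finally show ?thesis .
    qed
  qed
qed

definition mittag_leffler :: "real \<Rightarrow> complex \<Rightarrow> complex" where
  "mittag_leffler \<alpha> z = (\<Sum>n. mittag_leffler_coeff \<alpha> n * z ^ n)"

definition mittag_leffler_deriv :: "real \<Rightarrow> complex \<Rightarrow> complex" where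
  "mittag_leffler_deriv \<alpha> z = (\<Sum>n. diffs (mittag_leffler_coeff \<alpha>) n * z ^ n)"

lemma continuous_max_powr:
  assumes "\<alpha> > 0" shows "continuous_on UNIV (\<lambda>t::real. max 0 t powr \<alpha>)"
  using assms by (auto intro!: continuous_intros continuous_on_powr')

text \<open>Termwise fractional integration, by dominated summation. The coefficients are arbitrary
  because the rule serves both E_alpha and the series of \<open>ml_solution\<close> +
  \<open>ml_euler\<close>.\<close>

lemma conv_RL_kernel_power_series:
  fixes \<mu> :: complex and t \<alpha> :: real
  assumes \<alpha>: "\<alpha> > 0" and b: "\<And>z. summable (\<lambda>n. b n * z ^ n)" and t: "t \<ge> 0"
  defines "z \<equiv> \<lambda>t. \<mu> * complex_of_real (max 0 t powr \<alpha>)"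
  shows "(\<lambda>n. b n * complex_of_real (Gamma (\<alpha> * real n + 1) / Gamma (\<alpha> * real (Suc n) + 1)) * z t ^ Suc n)
     sums (\<mu> * conv (RL_kernel \<alpha>) (\<lambda>t. \<Sum>n. b n * z t ^ n) t)"
proof (cases "t = 0")
  case True
  then show ?thesis using \<alpha> by (simp add: conv_nonpos z_def)
next
  case False
  with t have t: "t > 0" by simp
  define f where "f n u = indicator {0..t} u *\<^sub>R (RL_kernel \<alpha> u * (b n * z (t - u) ^ n))" for n u
  define R where "R = norm \<mu> * t powr \<alpha>"
  have R: "R \<ge> 0" by (simp add: R_def)
  define K where "K = (LBINT u. norm (indicator {0..t} u *\<^sub>R RL_kernel \<alpha> u))"
  have z_cont: "continuous_on UNIV z"
    unfolding z_def using \<alpha> by (intro continuous_intros continuous_max_powr)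
  have k: "locally_integrable (RL_kernel \<alpha>)" using \<alpha> by (rule locally_integrable_RL_kernel)
  have kint: "integrable lborel (\<lambda>u. norm (indicator {0..t} u *\<^sub>R RL_kernel \<alpha> u))"
    using k unfolding locally_integrable_def set_integrable_def by (intro integrable_norm) auto
  have bn: "summable (\<lambda>n. norm (b n) * R ^ n)"
  proof -
    \<comment> \<open>Convergence at the larger radius R + 1 gives absolute convergence at
      R.\<close>
    have "summable (\<lambda>n. norm (b n * (of_real R) ^ n))"
      using b by (rule powser_insidea[of _ "of_real (R + 1)"]) (use R in \<open>simp del: of_real_add\<close>)
    then show ?thesis by (simp add: norm_mult norm_power R_def)
  qed
  have zb: "norm (b n * z (t - u) ^ n) \<le> norm (b n) * R ^ n" if "0 \<le> u" "u \<le> t" for n u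
    unfolding norm_mult norm_power using that \<alpha>
    by (intro mult_left_mono power_mono) (auto simp: z_def norm_mult R_def intro!: mult_left_mono powr_mono2)
  have fint: "integrable lborel (f n)" for n
    using set_integrable_conv[OF k, of "\<lambda>u. b n * z u ^ n" t] z_cont
    unfolding set_integrable_def f_def by (simp add: continuous_intros)
  have "(\<lambda>n. integral\<^sup>L lborel (f n)) sums (\<integral>u. (\<Sum>n. f n u) \<partial>lborel)"
  proof (rule sums_integral[OF fint])
    show "AE u in lborel. summable (\<lambda>n. norm (f n u))"
    proof (rule AE_I2)
      fix u
      have "summable (\<lambda>n. norm (RL_kernel \<alpha> u) * (norm (b n) * R ^ n))"
        using bn by (rule summable_mult)
      then show "summable (\<lambda>n. norm (f n u))"
        by (rule summable_comparison_test'[where N=0])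
           (use zb in \<open>auto simp: f_def norm_mult[of "RL_kernel _ _"] indicator_def R_def intro!: mult_left_mono\<close>)
    qed
    have "norm (integral\<^sup>L lborel (\<lambda>u. norm (f n u))) \<le> norm (b n) * R ^ n * K" for n
    proof -
      have "integral\<^sup>L lborel (\<lambda>u. norm (f n u)) \<le>
        (\<integral>u. (norm (b n) * R ^ n) * norm (indicator {0..t} u *\<^sub>R RL_kernel \<alpha> u) \<partial>lborel)"
        using zb by (intro integral_mono integrable_norm fint integrable_mult_right kint)
          (auto simp: f_def indicator_def norm_mult[of "RL_kernel _ _"] mult.commute[of "norm (RL_kernel _ _)"] intro!: mult_right_mono)
      then show ?thesis by (simp add: K_def)
    qed
    then show "summable (\<lambda>n. \<integral>u. norm (f n u) \<partial>lborel)"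
      by (intro summable_comparison_test'[OF summable_mult2[OF bn]])
  qed
  also have "(\<integral>u. (\<Sum>n. f n u) \<partial>lborel) = conv (RL_kernel \<alpha>) (\<lambda>t. \<Sum>n. b n * z t ^ n) t"
    unfolding conv_def set_lebesgue_integral_def
    by (intro Bochner_Integration.integral_cong refl) (auto simp: f_def indicator_def suminf_mult b)
  also have "(\<lambda>n. integral\<^sup>L lborel (f n)) = (\<lambda>n. b n * \<mu> ^ n * complex_of_real (Gamma (\<alpha> * real n + 1) / Gamma (\<alpha> * real (Suc n) + 1) * t powr (\<alpha> * Suc n)))"
  proof
    fix n
    have "integral\<^sup>L lborel (f n) = conv (RL_kernel \<alpha>) (\<lambda>u. (b n * \<mu> ^ n) * complex_of_real (max 0 u powr \<alpha>) ^ n) t"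
      unfolding conv_def set_lebesgue_integral_def
      by (intro Bochner_Integration.integral_cong refl) (auto simp: f_def z_def power_mult_distrib)
    also have "\<dots> = (b n * \<mu> ^ n) * conv (RL_kernel \<alpha>) (\<lambda>u. complex_of_real (max 0 u powr \<alpha>) ^ n) t"
      by (rule conv_mult_right)
    \<comment> \<open>For n = 0 the integrands differ at u = t, since \<open>0 powr 0 = 0\<close>
      but \<open>0 ^ 0 = 1\<close>; equality holds almost everywhere.\<close>
    also have "conv (RL_kernel \<alpha>) (\<lambda>u. complex_of_real (max 0 u powr \<alpha>) ^ n) t = conv (RL_kernel \<alpha>) (\<lambda>u. complex_of_real (u powr (\<alpha> * n))) t"
      unfolding conv_def set_lebesgue_integral_def
    proof (rule integral_cong_AE)
      show "AE u in lborel. indicator {0..t} u *\<^sub>R (RL_kernel \<alpha> u * complex_of_real (max 0 (t - u) powr \<alpha>) ^ n) =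
          indicator {0..t} u *\<^sub>R (RL_kernel \<alpha> u * complex_of_real ((t - u) powr (\<alpha> * n)))"
        using AE_lborel_singleton[of t]
        by eventually_elim (auto simp: indicator_def powr_powr[symmetric] powr_realpow)
    qed (auto simp: RL_kernel_def[abs_def])
    also have "\<dots> = complex_of_real (Gamma (\<alpha> * n + 1) / Gamma (\<alpha> * n + 1 + \<alpha>) * t powr (\<alpha> * n + \<alpha>))"
      using \<alpha> t by (intro conv_RL_kernel_powr) (auto intro: less_le_trans[of _ 0])
    finally show "integral\<^sup>L lborel (f n) = b n * \<mu> ^ n * complex_of_real (Gamma (\<alpha> * real n + 1) / Gamma (\<alpha> * real (Suc n) + 1) * t powr (\<alpha> * Suc n))"
      by (simp add: algebra_simps)
  qed
  finally have "(\<lambda>n. \<mu> * (b n * \<mu> ^ n * complex_of_real (Gamma (\<alpha> * real n + 1) / Gamma (\<alpha> * real (Suc n) + 1) * t powr (\<alpha> * Suc n)))) sums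
     (\<mu> * conv (RL_kernel \<alpha>) (\<lambda>t. \<Sum>n. b n * z t ^ n) t)"
    by (rule sums_mult)
  moreover have "complex_of_real (t powr (\<alpha> * Suc n)) = complex_of_real (t powr \<alpha>) ^ Suc n" for n
    using t by (simp add: powr_powr[symmetric] powr_realpow del: of_nat_Suc power_Suc)
  ultimately show ?thesis
    using t by (simp add: z_def power_mult_distrib mult_ac del: of_nat_Suc)
qed

section \<open>The scalar solution e and the resolvent r\<close>

definition ml_solution :: "real \<Rightarrow> complex \<Rightarrow> real \<Rightarrow> complex" where
  "ml_solution \<alpha> \<mu> t = mittag_leffler \<alpha> (\<mu> * complex_of_real (max 0 t powr \<alpha>))"

text \<open>This is t^(alpha-1) E_{alpha,alpha}(mu t^alpha), because alpha E_alpha' is the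
  two-parameter function E_{alpha,alpha}. The factor t^(alpha-1) carries the whole singularity at 0.
  As in \<open>ml_solution\<close>, \<open>max 0 t\<close> makes the Mittag-Leffler factor
  continuous on the whole line.\<close>

definition ml_resolvent :: "real \<Rightarrow> complex \<Rightarrow> real \<Rightarrow> complex" where
  "ml_resolvent \<alpha> \<mu> t = complex_of_real (t powr (\<alpha> - 1)) *
     (complex_of_real \<alpha> * mittag_leffler_deriv \<alpha> (\<mu> * complex_of_real (max 0 t powr \<alpha>)))"

lemma DERIV_mittag_leffler:
  "\<alpha> > 0 \<Longrightarrow> (mittag_leffler \<alpha> has_field_derivative mittag_leffler_deriv \<alpha> z) (at z)"
  unfolding mittag_leffler_def[abs_def] mittag_leffler_deriv_def
  by (intro termdiffs_strong_converges_everywhere summable_mittag_leffler_coeff)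

lemma continuous_mittag_leffler: "\<alpha> > 0 \<Longrightarrow> continuous_on UNIV (mittag_leffler \<alpha>)"
  using DERIV_mittag_leffler by (metis DERIV_isCont continuous_at_imp_continuous_on)

lemma continuous_mittag_leffler_deriv: "\<alpha> > 0 \<Longrightarrow> continuous_on UNIV (mittag_leffler_deriv \<alpha>)"
  unfolding mittag_leffler_deriv_def[abs_def]
  by (intro continuous_at_imp_continuous_on ballI isCont_powser_converges_everywhere
      termdiff_converges_all summable_mittag_leffler_coeff)

lemma continuous_ml_solution: "\<alpha> > 0 \<Longrightarrow> continuous_on UNIV (ml_solution \<alpha> \<mu>)"
  unfolding ml_solution_def[abs_def]
  by (intro continuous_on_compose2[OF continuous_mittag_leffler] continuous_intros continuous_max_powr) auto

lemma continuous_mittag_leffler_deriv_powr: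
  "\<alpha> > 0 \<Longrightarrow> continuous_on UNIV (\<lambda>t. mittag_leffler_deriv \<alpha> (\<mu> * complex_of_real (max 0 t powr \<alpha>)))"
  by (intro continuous_on_compose2[OF continuous_mittag_leffler_deriv] continuous_intros continuous_max_powr) auto

lemma locally_integrable_ml_resolvent: "\<alpha> > 0 \<Longrightarrow> locally_integrable (ml_resolvent \<alpha> \<mu>)"
  unfolding ml_resolvent_def[abs_def]
  by (intro locally_integrable_powr_mult continuous_intros continuous_mittag_leffler_deriv_powr)

lemma mittag_leffler_coeff_0: "mittag_leffler_coeff \<alpha> 0 = 1"
  by (simp add: mittag_leffler_coeff_def Gamma_1)

lemma ml_solution_0: "\<alpha> > 0 \<Longrightarrow> ml_solution \<alpha> \<mu> 0 = 1"
  by (simp add: ml_solution_def mittag_leffler_def mittag_leffler_coeff_0)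

lemma mittag_leffler_coeff_step:
  assumes "\<alpha> > 0"
  shows "mittag_leffler_coeff \<alpha> n * complex_of_real (Gamma (\<alpha> * real n + 1) / Gamma (\<alpha> * real (Suc n) + 1))
    = mittag_leffler_coeff \<alpha> (Suc n)"
proof -
  have "Gamma (\<alpha> * real n + 1) > 0" using assms by (intro Gamma_real_pos) (auto intro: add_nonneg_pos)
  then show ?thesis by (simp add: mittag_leffler_coeff_def del: of_nat_Suc)
qed

text \<open>Fractional integration shifts the Mittag-Leffler coefficients by one index, so mu k * e
  is the series of e without its constant term.\<close>

lemma ml_solution_eq:
  assumes \<alpha>: "\<alpha> > 0" and t: "t \<ge> 0"
  shows "ml_solution \<alpha> \<mu> t = 1 + \<mu> * conv (RL_kernel \<alpha>) (ml_solution \<alpha> \<mu>) t"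
proof -
  define z where "z t = \<mu> * complex_of_real (max 0 t powr \<alpha>)" for t
  have "(\<lambda>n. mittag_leffler_coeff \<alpha> (Suc n) * z t ^ Suc n) sums (\<mu> * conv (RL_kernel \<alpha>) (ml_solution \<alpha> \<mu>) t)"
    using conv_RL_kernel_power_series[OF \<alpha> summable_mittag_leffler_coeff[OF \<alpha>] t, of \<mu>]
    by (simp only: mittag_leffler_coeff_step[OF \<alpha>] ml_solution_def[abs_def] mittag_leffler_def z_def)
  then have "(\<lambda>n. mittag_leffler_coeff \<alpha> n * z t ^ n) sums (\<mu> * conv (RL_kernel \<alpha>) (ml_solution \<alpha> \<mu>) t + 1)"
    by (subst (asm) sums_Suc_iff) (simp add: mittag_leffler_coeff_0)
  then show ?thesis
    by (simp add: sums_iff mittag_leffler_def z_def add.commute ml_solution_def[of \<alpha> \<mu> t])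
qed

text \<open>The derivative of \<open>ml_solution \<alpha> \<mu> t\<close> with respect to \<open>ln \<mu>\<close>, which is also \<open>t / \<alpha>\<close> times its
  derivative with respect to \<open>t\<close>.\<close>

definition ml_euler :: "real \<Rightarrow> complex \<Rightarrow> real \<Rightarrow> complex" where
  "ml_euler \<alpha> \<mu> t = \<mu> * complex_of_real (max 0 t powr \<alpha>) * mittag_leffler_deriv \<alpha> (\<mu> * complex_of_real (max 0 t powr \<alpha>))"

text \<open>Formally, mu d/dmu applied to e = 1 + mu k * e. On coefficients: with c_n those of
  E_alpha, the sum on the right has coefficients (n + 1) c_n, which fractional integration turns
  into (n + 1) c_{n+1}, the coefficients of z E_alpha'(z).\<close>

lemma ml_euler_eq:
  assumes \<alpha>: "\<alpha> > 0" and t: "t \<ge> 0"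
  shows "ml_euler \<alpha> \<mu> t = \<mu> * conv (RL_kernel \<alpha>) (\<lambda>s. ml_solution \<alpha> \<mu> s + ml_euler \<alpha> \<mu> s) t"
proof -
  define z where "z t = \<mu> * complex_of_real (max 0 t powr \<alpha>)" for t
  define c where "c = mittag_leffler_coeff \<alpha>"
  define b where "b n = of_nat (Suc n) * c n" for n
  have c: "summable (\<lambda>n. c n * z ^ n)" for z
    unfolding c_def using \<alpha> by (rule summable_mittag_leffler_coeff)
  have d: "(\<lambda>n. of_nat (Suc n) * c (Suc n) * z ^ Suc n) sums (z * mittag_leffler_deriv \<alpha> z)" for z
    using sums_mult[OF summable_sums[OF termdiff_converges_all[OF c, of z]], of z]
    by (simp add: mittag_leffler_deriv_def c_def diffs_def mult_ac)
  then have "(\<lambda>n. of_nat n * c n * z ^ n) sums (z * mittag_leffler_deriv \<alpha> z)" for z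
    using sums_Suc_iff[of "\<lambda>n. of_nat n * c n * z ^ n" "z * mittag_leffler_deriv \<alpha> z" for z] by simp
  from sums_add[OF summable_sums[OF c] this]
  have b: "(\<lambda>n. b n * z ^ n) sums (mittag_leffler \<alpha> z + z * mittag_leffler_deriv \<alpha> z)" for z
    by (simp add: b_def algebra_simps mittag_leffler_def c_def)
  have "(\<lambda>n. b n * complex_of_real (Gamma (\<alpha> * real n + 1) / Gamma (\<alpha> * real (Suc n) + 1)) * z t ^ Suc n)
     sums (\<mu> * conv (RL_kernel \<alpha>) (\<lambda>t. \<Sum>n. b n * z t ^ n) t)"
    unfolding z_def by (intro conv_RL_kernel_power_series \<alpha> t sums_summable[OF b])
  also have "(\<lambda>t. \<Sum>n. b n * z t ^ n) = (\<lambda>s. ml_solution \<alpha> \<mu> s + ml_euler \<alpha> \<mu> s)"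
    using b by (simp add: sums_iff ml_solution_def ml_euler_def z_def)
  also have "(\<lambda>n. b n * complex_of_real (Gamma (\<alpha> * real n + 1) / Gamma (\<alpha> * real (Suc n) + 1)) * z t ^ Suc n)
     = (\<lambda>n. of_nat (Suc n) * c (Suc n) * z t ^ Suc n)"
    unfolding b_def c_def mult.assoc[of "of_nat _"] mittag_leffler_coeff_step[OF \<alpha>] ..
  finally have "z t * mittag_leffler_deriv \<alpha> (z t) =
     \<mu> * conv (RL_kernel \<alpha>) (\<lambda>s. ml_solution \<alpha> \<mu> s + ml_euler \<alpha> \<mu> s) t"
    by (rule sums_unique2[OF d])
  moreover have "ml_euler \<alpha> \<mu> t = z t * mittag_leffler_deriv \<alpha> (z t)" by (simp add: ml_euler_def z_def)
  ultimately show ?thesis by simp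
qed

lemma continuous_ml_euler: "\<alpha> > 0 \<Longrightarrow> continuous_on UNIV (ml_euler \<alpha> \<mu>)"
  unfolding ml_euler_def[abs_def]
  by (intro continuous_intros continuous_max_powr continuous_mittag_leffler_deriv_powr)

text \<open>Both sides are t e'(t). This converts estimates of \<open>ml_euler\<close> into
  estimates of r.\<close>

lemma ml_euler_resolvent:
  assumes "\<alpha> > 0" "t > 0"
  shows "complex_of_real \<alpha> * ml_euler \<alpha> \<mu> t = \<mu> * complex_of_real t * ml_resolvent \<alpha> \<mu> t"
  using assms by (simp add: ml_euler_def ml_resolvent_def powr_diff)

lemma ml_solution_has_derivative:
  assumes \<alpha>: "\<alpha> > 0" and t: "t > 0"
  shows "(ml_solution \<alpha> \<mu> has_vector_derivative \<mu> * ml_resolvent \<alpha> \<mu> t) (at t)"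
proof -
  have "((\<lambda>t. t powr \<alpha>) has_real_derivative \<alpha> * t powr (\<alpha> - 1)) (at t)"
    using t by (rule has_real_derivative_powr)
  then have "((\<lambda>t. complex_of_real (t powr \<alpha>)) has_vector_derivative complex_of_real (\<alpha> * t powr (\<alpha> - 1))) (at t)"
    by (intro has_vector_derivative_of_real) (simp add: has_real_derivative_iff_has_vector_derivative)
  then have 1: "((\<lambda>t. \<mu> * complex_of_real (t powr \<alpha>)) has_vector_derivative \<mu> * complex_of_real (\<alpha> * t powr (\<alpha> - 1))) (at t)"
    by (rule has_vector_derivative_mult_right)
  have "((mittag_leffler \<alpha> \<circ> (\<lambda>t. \<mu> * complex_of_real (t powr \<alpha>))) has_vector_derivative
     (\<mu> * complex_of_real (\<alpha> * t powr (\<alpha> - 1))) * mittag_leffler_deriv \<alpha> (\<mu> * complex_of_real (t powr \<alpha>))) (at t)"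
    by (rule field_vector_diff_chain_at[OF 1 DERIV_mittag_leffler[OF \<alpha>]])
  then have "((mittag_leffler \<alpha> \<circ> (\<lambda>t. \<mu> * complex_of_real (t powr \<alpha>))) has_vector_derivative \<mu> * ml_resolvent \<alpha> \<mu> t) (at t)"
    using t by (simp add: ml_resolvent_def mult_ac)
  then show ?thesis
    by (rule has_vector_derivative_transform_within_open[where S = "{0<..}"])
       (use t in \<open>auto simp: ml_solution_def\<close>)
qed

text \<open>For alpha < 1 the derivative of e may blow up at 0, hence the form of the fundamental
  theorem that asks for the derivative only in the interior and for continuity of e on the closed
  interval.\<close>

lemma integral_ml_resolvent:
  assumes \<alpha>: "\<alpha> > 0" and t: "t \<ge> 0"
  shows "\<mu> * (LBINT u:{0..t}. ml_resolvent \<alpha> \<mu> u) = ml_solution \<alpha> \<mu> t - 1"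
proof -
  have hi: "((\<lambda>u. \<mu> * ml_resolvent \<alpha> \<mu> u) has_integral ml_solution \<alpha> \<mu> t - ml_solution \<alpha> \<mu> 0) {0..t}"
    by (rule fundamental_theorem_of_calculus_interior)
      (use \<alpha> t in \<open>auto intro!: ml_solution_has_derivative intro: continuous_on_subset[OF continuous_ml_solution]\<close>)
  have si: "set_integrable lborel {0..t} (\<lambda>u. \<mu> * ml_resolvent \<alpha> \<mu> u)"
    using locally_integrable_ml_resolvent[OF \<alpha>, of \<mu>]
    by (intro set_integrable_mult_right) (auto simp: locally_integrable_def)
  have "(LBINT u:{0..t}. \<mu> * ml_resolvent \<alpha> \<mu> u) = ml_solution \<alpha> \<mu> t - ml_solution \<alpha> \<mu> 0"
    by (simp only: set_borel_integral_eq_integral(2)[OF si] integral_unique[OF hi])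
  then show ?thesis using ml_solution_0[OF \<alpha>] by simp
qed

section \<open>Variation of constants for the scalar equation\<close>

lemma conv_commute_fun: "conv p f = conv f p"
  by (rule ext) (rule conv_commute)

lemma conv_assoc_fun:
  assumes "locally_integrable p" "continuous_on UNIV q" "continuous_on UNIV f"
  shows "conv p (conv q f) = conv (conv p q) f"
  by (rule ext) (rule conv_assoc[OF assms])

text \<open>Both sides equal (e - 1) / mu on the half-line.\<close>

lemma conv_const_1_resolvent:
  assumes \<alpha>: "\<alpha> > 0" and \<mu>: "\<mu> \<noteq> 0"
  shows "conv (ml_resolvent \<alpha> \<mu>) (\<lambda>_. 1) = conv (RL_kernel \<alpha>) (ml_solution \<alpha> \<mu>)"
proof
  fix t :: real
  show "conv (ml_resolvent \<alpha> \<mu>) (\<lambda>_. 1) t = conv (RL_kernel \<alpha>) (ml_solution \<alpha> \<mu>) t"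
  proof (cases "t \<ge> 0")
    case True
    then have "\<mu> * conv (ml_resolvent \<alpha> \<mu>) (\<lambda>_. 1) t = \<mu> * conv (RL_kernel \<alpha>) (ml_solution \<alpha> \<mu>) t"
      using ml_solution_eq[OF \<alpha> True, of \<mu>] integral_ml_resolvent[OF \<alpha> True, of \<mu>] by (simp add: conv_def)
    then show ?thesis using \<mu> by simp
  qed (simp add: conv_nonpos)
qed

text \<open>Regroups 1 * r * f = k * e * f. The detour through \<open>conv_commute_fun\<close> keeps
  the singular factor in the first slot, as \<open>conv_assoc\<close> requires.\<close>

lemma conv_const_1_conv_resolvent:
  assumes \<alpha>: "\<alpha> > 0" and \<mu>: "\<mu> \<noteq> 0" and f: "continuous_on UNIV f"
  shows "conv (\<lambda>_. 1) (conv (ml_resolvent \<alpha> \<mu>) f) = conv (ml_solution \<alpha> \<mu>) (conv (RL_kernel \<alpha>) f)"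
proof -
  note k = locally_integrable_RL_kernel[OF \<alpha>] and r = locally_integrable_ml_resolvent[OF \<alpha>, of \<mu>]
    and e = continuous_ml_solution[OF \<alpha>, of \<mu>]
  let ?k = "RL_kernel \<alpha>" and ?e = "ml_solution \<alpha> \<mu>" and ?r = "ml_resolvent \<alpha> \<mu>"
  have "conv (\<lambda>_. 1) (conv ?r f) = conv (conv ?r f) (\<lambda>_. 1)" by (rule conv_commute_fun)
  also have "\<dots> = conv ?r (conv f (\<lambda>_. 1))" by (rule conv_assoc_fun[symmetric]) (use r f in auto)
  also have "\<dots> = conv ?r (conv (\<lambda>_. 1) f)" by (simp add: conv_commute_fun)
  also have "\<dots> = conv (conv ?r (\<lambda>_. 1)) f" by (rule conv_assoc_fun) (use r f in auto)
  also have "\<dots> = conv (conv ?k ?e) f" using \<alpha> \<mu> by (simp add: conv_const_1_resolvent)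
  also have "\<dots> = conv ?k (conv ?e f)" by (rule conv_assoc_fun[symmetric]) (use k e f in auto)
  also have "\<dots> = conv ?k (conv f ?e)" by (simp add: conv_commute_fun)
  also have "\<dots> = conv (conv ?k f) ?e" by (rule conv_assoc_fun) (use k e f in auto)
  also have "\<dots> = conv ?e (conv ?k f)" by (rule conv_commute_fun)
  finally show ?thesis .
qed

text \<open>Substitutes e = 1 + mu k * e into e * x and regroups.\<close>

lemma conv_ml_solution_resolve:
  assumes \<alpha>: "\<alpha> > 0" and x: "continuous_on UNIV x" and t: "t \<ge> 0"
  shows "conv (ml_solution \<alpha> \<mu>) x t = conv (\<lambda>_. 1) x t + \<mu> * conv (ml_solution \<alpha> \<mu>) (conv (RL_kernel \<alpha>) x) t"
proof -
  note k = locally_integrable_RL_kernel[OF \<alpha>] and e = continuous_ml_solution[OF \<alpha>, of \<mu>]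
  let ?k = "RL_kernel \<alpha>" and ?e = "ml_solution \<alpha> \<mu>"
  have ke: "continuous_on UNIV (conv ?k ?e)" using k e by (rule continuous_conv)
  have "conv ?e x t = conv x (\<lambda>s. 1 + \<mu> * conv ?k ?e s) t"
    by (subst conv_commute) (intro conv_cong ml_solution_eq[OF \<alpha>] refl)
  also have "\<dots> = conv x (\<lambda>_. 1) t + \<mu> * conv x (conv ?k ?e) t"
    using ke x by (subst conv_add_right) (auto intro!: continuous_intros locally_integrable_continuous simp: conv_mult_right)
  also have "conv x (conv ?k ?e) = conv (conv ?k ?e) x" by (rule conv_commute_fun)
  also have "\<dots> = conv ?k (conv ?e x)" by (rule conv_assoc_fun[symmetric]) (use k e x in auto)
  also have "\<dots> = conv ?k (conv x ?e)" by (simp add: conv_commute_fun)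
  also have "\<dots> = conv (conv ?k x) ?e" by (rule conv_assoc_fun) (use k e x in auto)
  also have "\<dots> = conv ?e (conv ?k x)" by (rule conv_commute_fun)
  finally show ?thesis by (simp add: conv_commute)
qed

text \<open>Convolve the equation with e. By \<open>conv_ml_solution_resolve\<close> the left side
  is 1 * x + mu e * (k * x); on the right, mu e * (k * x) appears again and cancels. What remains is
  the claim convolved with 1. Uniqueness of the solution is thereby included.\<close>

theorem scalar_solution_formula:
  assumes \<alpha>: "\<alpha> > 0" and \<mu>: "\<mu> \<noteq> 0" and f: "continuous_on UNIV f" and x: "continuous_on UNIV x"
    and eq: "\<And>t. t \<ge> 0 \<Longrightarrow> x t = x0 + conv (RL_kernel \<alpha>) (\<lambda>s. \<mu> * x s + f s) t" and t: "t \<ge> 0"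
  shows "x t = x0 * ml_solution \<alpha> \<mu> t + conv (ml_resolvent \<alpha> \<mu>) f t"
proof -
  note k = locally_integrable_RL_kernel[OF \<alpha>] and r = locally_integrable_ml_resolvent[OF \<alpha>, of \<mu>]
    and e = continuous_ml_solution[OF \<alpha>, of \<mu>]
  let ?k = "RL_kernel \<alpha>" and ?e = "ml_solution \<alpha> \<mu>" and ?r = "ml_resolvent \<alpha> \<mu>"
  note C = k r e f x continuous_conv continuous_on_add continuous_on_mult continuous_on_const locally_integrable_continuous
  have eq': "x t = x0 + (\<mu> * conv ?k x t + conv ?k f t)" if "t \<ge> 0" for t
    using eq[OF that] by (subst (asm) conv_add_right) (auto intro!: C simp: conv_mult_right)
  show ?thesis
  proof (rule conv_const_1_inject[OF x _ _ t])
    fix t :: real assume t: "t \<ge> 0"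
    have "conv (\<lambda>_. 1) x t + \<mu> * conv ?e (conv ?k x) t = conv ?e (\<lambda>s. x0 + (\<mu> * conv ?k x s + conv ?k f s)) t"
      using conv_ml_solution_resolve[OF \<alpha> x t, of \<mu>] conv_cong[of t ?e ?e x, OF refl eq'] by simp
    also have "\<dots> = conv ?e (\<lambda>s. x0 * 1) t + conv ?e (\<lambda>s. \<mu> * conv ?k x s + conv ?k f s) t"
      by (subst conv_add_right; (intro C)?) simp
    also have "conv ?e (\<lambda>s. \<mu> * conv ?k x s + conv ?k f s) t = \<mu> * conv ?e (conv ?k x) t + conv ?e (conv ?k f) t"
      by (subst conv_add_right; (intro C)?) (simp add: conv_mult_right)
    also have "conv ?e (\<lambda>s. x0 * 1) t = x0 * conv ?e (\<lambda>_. 1) t" by (rule conv_mult_right)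
    also have "conv ?e (\<lambda>_. 1) t = conv (\<lambda>_. 1) ?e t" by (rule conv_commute)
    also have "conv ?e (conv ?k f) = conv (\<lambda>_. 1) (conv ?r f)"
      using conv_const_1_conv_resolvent[OF \<alpha> \<mu> f] by simp
    finally have "conv (\<lambda>_. 1) x t = x0 * conv (\<lambda>_. 1) ?e t + conv (\<lambda>_. 1) (conv ?r f) t" by simp
    then show "conv (\<lambda>_. 1) x t = conv (\<lambda>_. 1) (\<lambda>t. x0 * ?e t + conv ?r f t) t"
      by (subst conv_add_right conv_mult_right; (intro C)?)+ simp
  qed (intro C)
qed

text \<open>The part with e is \<open>ml_solution_eq\<close>. For v = r * f the equation v = mu k *
  v + k * f is checked after convolution with 1, where it becomes
  \<open>conv_ml_solution_resolve\<close> for the function k * f.\<close>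

theorem scalar_solution_exists:
  fixes x0 :: complex
  assumes \<alpha>: "\<alpha> > 0" and \<mu>: "\<mu> \<noteq> 0" and f: "continuous_on UNIV f" and t: "t \<ge> 0"
  defines "x \<equiv> \<lambda>t. x0 * ml_solution \<alpha> \<mu> t + conv (ml_resolvent \<alpha> \<mu>) f t"
  shows "x t = x0 + conv (RL_kernel \<alpha>) (\<lambda>s. \<mu> * x s + f s) t"
proof -
  note k = locally_integrable_RL_kernel[OF \<alpha>] and r = locally_integrable_ml_resolvent[OF \<alpha>, of \<mu>]
    and e = continuous_ml_solution[OF \<alpha>, of \<mu>]
  let ?k = "RL_kernel \<alpha>" and ?e = "ml_solution \<alpha> \<mu>" and ?r = "ml_resolvent \<alpha> \<mu>"
  note C = k r e f continuous_conv continuous_on_add continuous_on_mult continuous_on_const locally_integrable_continuous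
  have rf: "continuous_on UNIV (conv ?r f)" by (intro C)
  have "conv ?r f t = \<mu> * conv ?k (conv ?r f) t + conv ?k f t"
  proof (rule conv_const_1_inject[OF rf _ _ t])
    fix t :: real assume t: "t \<ge> 0"
    have "conv (\<lambda>_. 1) (conv ?k (conv ?r f)) = conv (conv ?k (conv ?r f)) (\<lambda>_. 1)" by (rule conv_commute_fun)
    also have "\<dots> = conv ?k (conv (conv ?r f) (\<lambda>_. 1))" by (rule conv_assoc_fun[symmetric]) (intro C)+
    also have "\<dots> = conv ?k (conv (\<lambda>_. 1) (conv ?r f))" by (simp add: conv_commute_fun)
    also have "\<dots> = conv ?k (conv ?e (conv ?k f))" using conv_const_1_conv_resolvent[OF \<alpha> \<mu> f] by simp
    also have "\<dots> = conv ?k (conv (conv ?k f) ?e)" by (simp add: conv_commute_fun)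
    also have "\<dots> = conv (conv ?k (conv ?k f)) ?e" by (rule conv_assoc_fun) (intro C)+
    also have "\<dots> = conv ?e (conv ?k (conv ?k f))" by (rule conv_commute_fun)
    finally have 1: "conv (\<lambda>_. 1) (conv ?k (conv ?r f)) = conv ?e (conv ?k (conv ?k f))" .
    have kf: "continuous_on UNIV (conv ?k f)" by (intro C)
    have "conv (\<lambda>_. 1) (conv ?r f) t = conv ?e (conv ?k f) t"
      using conv_const_1_conv_resolvent[OF \<alpha> \<mu> f] by simp
    also have "\<dots> = \<mu> * conv (\<lambda>_. 1) (conv ?k (conv ?r f)) t + conv (\<lambda>_. 1) (conv ?k f) t"
      by (subst conv_ml_solution_resolve[OF \<alpha> kf t]) (simp add: 1)
    also have "\<dots> = conv (\<lambda>_. 1) (\<lambda>t. \<mu> * conv ?k (conv ?r f) t + conv ?k f t) t"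
      by (subst conv_add_right conv_mult_right; (intro C)?)+ simp
    finally show "conv (\<lambda>_. 1) (conv ?r f) t = conv (\<lambda>_. 1) (\<lambda>t. \<mu> * conv ?k (conv ?r f) t + conv ?k f t) t" .
  qed (intro C)
  moreover have "conv ?k (\<lambda>s. \<mu> * x s + f s) t = \<mu> * (x0 * conv ?k ?e t + conv ?k (conv ?r f) t) + conv ?k f t"
    unfolding x_def by (subst conv_add_right conv_mult_right; (intro C)?)+ simp
  ultimately show ?thesis
    using ml_solution_eq[OF \<alpha> t, of \<mu>] by (simp add: x_def algebra_simps)
qed

section \<open>Laplace transforms\<close>

lemma
  assumes a: "a > 0" and \<sigma>: "\<sigma> > 0"
  shows set_integrable_powr_exp: "set_integrable lborel {0..} (\<lambda>u::real. u powr (a - 1) * exp (- (\<sigma> * u)))"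
    and integral_powr_exp: "(LBINT u:{0..}. u powr (a - 1) * exp (- (\<sigma> * u))) = Gamma a * \<sigma> powr (- a)"
proof -
  have G: "((\<lambda>t. t powr (a - 1) / exp t) has_integral Gamma a) {0..}"
    using a by (rule Gamma_integral_real)
  then have I: "set_integrable lborel {0..} (\<lambda>t. t powr (a - 1) / exp t)"
    by (intro set_integrable_lborel_nonneg) (auto simp: integrable_on_def)
  have V: "(LBINT t:{0..}. t powr (a - 1) / exp t) = Gamma a"
    using set_borel_integral_eq_integral(2)[OF I] integral_unique[OF G] by simp
  have eq: "indicator {0..} (0 + \<sigma> * u) *\<^sub>R ((0 + \<sigma> * u) powr (a - 1) / exp (0 + \<sigma> * u)) =
       \<sigma> powr (a - 1) * (indicator {0..} u *\<^sub>R (u powr (a - 1) * exp (- (\<sigma> * u))))" for u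
    using \<sigma> by (auto simp: indicator_def powr_mult exp_minus zero_le_mult_iff divide_simps)
  have "integrable lborel (\<lambda>u. indicator {0..} (0 + \<sigma> * u) *\<^sub>R ((0 + \<sigma> * u) powr (a - 1) / exp (0 + \<sigma> * u)))"
    using I \<sigma> unfolding set_integrable_def by (intro lborel_integrable_real_affine) auto
  then show "set_integrable lborel {0..} (\<lambda>u::real. u powr (a - 1) * exp (- (\<sigma> * u)))"
    unfolding eq set_integrable_def integrable_mult_left_iff using \<sigma> by (auto simp del: real_scaleR_def)
  have "Gamma a = \<sigma> * (\<integral>u. indicator {0..} (0 + \<sigma> * u) *\<^sub>R ((0 + \<sigma> * u) powr (a - 1) / exp (0 + \<sigma> * u)) \<partial>lborel)"
    using V \<sigma> unfolding set_lebesgue_integral_def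
    by (subst (asm) lborel_integral_real_affine[of \<sigma> _ 0]) auto
  also have "\<dots> = \<sigma> * (\<sigma> powr (a - 1) * (LBINT u:{0..}. u powr (a - 1) * exp (- (\<sigma> * u))))"
    unfolding eq integral_mult_right_zero set_lebesgue_integral_def ..
  finally have "Gamma a = \<sigma> * (\<sigma> powr (a - 1) * (LBINT u:{0..}. u powr (a - 1) * exp (- (\<sigma> * u))))" .
  then show "(LBINT u:{0..}. u powr (a - 1) * exp (- (\<sigma> * u))) = Gamma a * \<sigma> powr (- a)"
    using \<sigma> by (simp add: powr_diff powr_minus field_simps)
qed

lemma set_integrable_powr_exp_complex:
  assumes a: "a > 0" and s: "Re s > 0"
  shows "set_integrable lborel {0..} (\<lambda>u. complex_of_real (u powr (a - 1)) * exp (- (s * complex_of_real u)))"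
proof -
  have "integrable lborel (\<lambda>u. indicator {0..} u *\<^sub>R (u powr (a - 1) * exp (- (Re s * u))))"
    using set_integrable_powr_exp[OF a s] by (simp add: set_integrable_def)
  then show ?thesis
    unfolding set_integrable_def
    by (rule Bochner_Integration.integrable_bound) (auto intro!: AE_I2 simp: norm_mult indicator_def)
qed

text \<open>Write exp(-s u) = exp(-u) exp((1 - s) u) and expand the second factor. The terms
  integrate to values Gamma(a + n), and the sum is the binomial series of (1 + (s - 1))^(-a), which
  explains the disc |s - 1| < 1.\<close>

lemma integral_powr_exp_complex_aux:
  assumes a: "a > 0" and s: "norm (s - 1) < 1"
  shows "(LBINT u:{0..}. complex_of_real (u powr (a - 1)) * exp (- (s * complex_of_real u))) =
    complex_of_real (Gamma a) * s powr (- complex_of_real a)"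
proof -
  define q where "q = norm (1 - s)"
  have q: "0 \<le> q" "q < 1" using s by (auto simp: q_def norm_minus_commute)
  define f where "f n u = indicator {0..} u *\<^sub>R (complex_of_real (u powr (a - 1) * exp (- u)) * (((1 - s) * complex_of_real u) ^ n / fact n))" for n u
  have ex: "z ^ n /\<^sub>R fact n = z ^ n / fact n" for z :: complex and n
    by (simp add: scaleR_conv_of_real divide_inverse mult.commute)
  define g where "g n u = indicator {0..} u *\<^sub>R (u powr (a + real n - 1) * exp (- (1 * u)))" for n and u :: real
  have pow: "u powr (a - 1) * u ^ n = u powr (a + real n - 1)" if "u \<ge> 0" for u :: real and n
    using that by (cases "u = 0") (auto simp: powr_add powr_diff powr_realpow)
  have fg: "f n u = (1 - s) ^ n / fact n * complex_of_real (g n u)" for n u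
    by (cases "u \<ge> 0") (auto simp: f_def g_def pow[symmetric] power_mult_distrib)
  have g_int: "integrable lborel (g n)" for n
    using set_integrable_powr_exp[of "a + real n" 1] a unfolding set_integrable_def g_def by auto
  have g_val: "integral\<^sup>L lborel (g n) = Gamma (a + real n)" for n
    using integral_powr_exp[of "a + real n" 1] a unfolding set_lebesgue_integral_def g_def by auto
  have g_nonneg: "g n u \<ge> 0" for n u by (simp add: g_def indicator_def)
  have Gp: "Gamma (a + real n) = Gamma a * pochhammer a n" for n
    using a Gamma_real_pos[OF a, THEN less_imp_neq] by (subst pochhammer_Gamma) (auto elim!: nonpos_Ints_cases)
  have coeff: "((- 1) ^ n * (- a gchoose n)) = pochhammer a n / fact n" for n
    by (simp add: gbinomial_pochhammer flip: power_mult_distrib mult.assoc)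
  have f_val: "integral\<^sup>L lborel (f n) = complex_of_real (Gamma a) * ((- complex_of_real a gchoose n) * (s - 1) ^ n)" for n
  proof -
    have "integral\<^sup>L lborel (f n) = (1 - s) ^ n / fact n * complex_of_real (Gamma (a + real n))"
      unfolding fg by (subst integral_mult_right_zero) (simp only: integral_complex_of_real g_val)
    also have "\<dots> = (1 - s) ^ n * complex_of_real (Gamma a * ((- 1) ^ n * (- a gchoose n)))"
      unfolding coeff Gp by simp
    also have "complex_of_real (- a gchoose n) = (- complex_of_real a gchoose n)"
      by (simp add: gbinomial_prod_rev)
    then have "(1 - s) ^ n * complex_of_real (Gamma a * ((- 1) ^ n * (- a gchoose n))) =
        complex_of_real (Gamma a) * ((- complex_of_real a gchoose n) * ((-1) * (1 - s)) ^ n)"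
      unfolding power_mult_distrib by simp
    finally show ?thesis by (simp only: mult_minus1 minus_diff_eq)
  qed
  have "(\<lambda>n. integral\<^sup>L lborel (f n)) sums (\<integral>u. (\<Sum>n. f n u) \<partial>lborel)"
  proof (rule sums_integral)
    show "integrable lborel (f n)" for n
      unfolding fg by (intro integrable_mult_right integrable_of_real g_int)
    show "AE u in lborel. summable (\<lambda>n. norm (f n u))"
    proof (rule AE_I2)
      fix u
      have "summable (\<lambda>n. norm (((1 - s) * complex_of_real u) ^ n / fact n))"
        using summable_norm_exp[of "(1 - s) * complex_of_real u"] unfolding ex .
      then show "summable (\<lambda>n. norm (f n u))"
        unfolding f_def norm_scaleR norm_mult[of "complex_of_real _"] by (intro summable_mult)
    qed
    have "norm (f n u) = q ^ n / fact n * g n u" for n u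
      using g_nonneg[of n u] by (simp add: fg norm_mult norm_divide norm_power q_def)
    then have "(\<integral>u. norm (f n u) \<partial>lborel) = Gamma a * ((- a gchoose n) * (- q) ^ n)" for n
    proof -
      have "(\<integral>u. norm (f n u) \<partial>lborel) = q ^ n * (Gamma a * (pochhammer a n / fact n))"
        using \<open>\<And>n u. norm (f n u) = _\<close> by (simp add: g_val Gp)
      also have "\<dots> = Gamma a * ((- a gchoose n) * (- q) ^ n)"
        unfolding coeff[symmetric] by (simp add: power_minus[of q])
      finally show ?thesis .
    qed
    \<comment> \<open>The integrals of the absolute values form the same binomial series at the real
      point -q, with q < 1.\<close>
    then show "summable (\<lambda>n. \<integral>u. norm (f n u) \<partial>lborel)"
      using gen_binomial_real[of "- q" "- a"] q by (simp add: sums_iff summable_mult)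
  qed
  moreover have "(\<lambda>n. integral\<^sup>L lborel (f n)) sums (complex_of_real (Gamma a) * (1 + (s - 1)) powr (- complex_of_real a))"
    unfolding f_val using s by (intro sums_mult gen_binomial_complex)
  moreover have "(\<Sum>n. f n u) = indicator {0..} u *\<^sub>R (complex_of_real (u powr (a - 1)) * exp (- (s * complex_of_real u)))" for u
  proof (cases "u \<ge> 0")
    case True
    have "(\<lambda>n. ((1 - s) * complex_of_real u) ^ n / fact n) sums exp ((1 - s) * complex_of_real u)"
      using exp_converges[of "(1 - s) * complex_of_real u"] unfolding ex .
    from sums_mult[OF this, of "complex_of_real (u powr (a - 1) * exp (- u))"]
    have "(\<lambda>n. f n u) sums (complex_of_real (u powr (a - 1) * exp (- u)) * exp ((1 - s) * complex_of_real u))"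
      using True by (simp add: f_def)
    also have "complex_of_real (u powr (a - 1) * exp (- u)) * exp ((1 - s) * complex_of_real u) =
        complex_of_real (u powr (a - 1)) * exp (- (s * complex_of_real u))"
      by (simp add: exp_of_real exp_add[symmetric] algebra_simps flip: exp_of_real)
    finally show ?thesis using True by (simp add: sums_iff)
  qed (simp add: f_def)
  ultimately show ?thesis
    unfolding set_lebesgue_integral_def by (simp add: sums_iff)
qed

lemma integral_powr_exp_complex:
  assumes a: "a > 0" and s: "Re s > 0"
  shows "(LBINT u:{0..}. complex_of_real (u powr (a - 1)) * exp (- (s * complex_of_real u))) =
    complex_of_real (Gamma a) * s powr (- complex_of_real a)"
proof -
  \<comment> \<open>Scaling replaces analytic continuation: this c minimises |s/c - 1|, and for Re s
    > 0 the minimum is below 1, so the disc case applies to w = s/c.\<close>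
  define c where "c = (norm s)\<^sup>2 / Re s"
  have s0: "s \<noteq> 0" using s by auto
  have c: "c > 0" using s s0 by (simp add: c_def)
  define w where "w = s / complex_of_real c"
  have "(norm (w - 1))\<^sup>2 = (norm w)\<^sup>2 - 2 * Re w + 1"
    by (simp add: cmod_power2) (simp add: power2_eq_square algebra_simps)
  also have "\<dots> = (norm s)\<^sup>2 / c\<^sup>2 - 2 * Re s / c + 1"
    using c by (simp add: w_def norm_divide power_divide)
  also have "\<dots> < 1"
  proof -
    have "(norm s)\<^sup>2 / c\<^sup>2 = Re s / c" using s s0 by (simp add: c_def power2_eq_square field_simps)
    then show ?thesis using c s by simp
  qed
  finally have w: "norm (w - 1) < 1" using power2_less_imp_less[of "norm (w - 1)" 1] by simp
  have "(LBINT u:{0..}. complex_of_real (u powr (a - 1)) * exp (- (s * complex_of_real u))) =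
     complex_of_real (1 / c) * (\<integral>u. indicator {0..} (0 + (1 / c) * u) *\<^sub>R (complex_of_real ((0 + (1 / c) * u) powr (a - 1)) *
       exp (- (s * complex_of_real (0 + (1 / c) * u)))) \<partial>lborel)"
    unfolding set_lebesgue_integral_def using c
    by (subst lborel_integral_real_affine[of "1 / c" _ 0]) (auto simp: scaleR_conv_of_real)
  also have "(\<integral>u. indicator {0..} (0 + (1 / c) * u) *\<^sub>R (complex_of_real ((0 + (1 / c) * u) powr (a - 1)) *
       exp (- (s * complex_of_real (0 + (1 / c) * u)))) \<partial>lborel) =
     (\<integral>u. complex_of_real (c powr (1 - a)) * (indicator {0..} u *\<^sub>R (complex_of_real (u powr (a - 1)) * exp (- (w * complex_of_real u)))) \<partial>lborel)"
    using c by (intro Bochner_Integration.integral_cong refl)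
      (auto simp: indicator_def w_def powr_divide powr_diff zero_le_divide_iff)
  also have "\<dots> = complex_of_real (c powr (1 - a)) * (complex_of_real (Gamma a) * w powr (- complex_of_real a))"
    using integral_powr_exp_complex_aux[OF a w]
    unfolding integral_mult_right_zero set_lebesgue_integral_def by simp
  also have "w powr (- complex_of_real a) = s powr (- complex_of_real a) * complex_of_real (c powr a)"
  proof -
    have Ln_w: "Ln w = Ln s - complex_of_real (ln c)" unfolding w_def using c s0 by (simp add: Ln_divide_of_real)
    moreover have "w \<noteq> 0" using c s0 by (simp add: w_def)
    ultimately have "w powr (- complex_of_real a) = exp (- (complex_of_real a * Ln s)) * exp (complex_of_real (a * ln c))"
      by (simp add: powr_def Ln_w algebra_simps flip: exp_add)
    then show ?thesis using s0 c by (simp add: powr_def flip: exp_of_real)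
  qed
  also have "complex_of_real (1 / c) * (complex_of_real (c powr (1 - a)) * (complex_of_real (Gamma a) * (s powr (- complex_of_real a) * complex_of_real (c powr a)))) =
      complex_of_real (1 / c * c powr (1 - a) * c powr a) * (complex_of_real (Gamma a) * s powr (- complex_of_real a))"
    by simp
  also have "1 / c * c powr (1 - a) * c powr a = 1" using c by (simp add: powr_diff)
  finally show ?thesis by simp
qed

lemma integral_convolution:
  fixes A B :: "real \<Rightarrow> complex"
  assumes A: "integrable lborel A" and B: "integrable lborel B"
  shows "(\<integral>t. (\<integral>u. A u * B (t - u) \<partial>lborel) \<partial>lborel) = integral\<^sup>L lborel A * integral\<^sup>L lborel B"
    and "integrable lborel (\<lambda>t. \<integral>u. A u * B (t - u) \<partial>lborel)"
proof -
  have [measurable]: "A \<in> borel_measurable borel" "B \<in> borel_measurable borel" using A B by auto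
  have Bs: "integrable lborel (\<lambda>t. B (t - u))" for u
    using lborel_integrable_real_affine[OF B, of 1 "- u"] by simp
  have Bi: "(\<integral>t. B (t - u) \<partial>lborel) = integral\<^sup>L lborel B" for u
    using lborel_integral_real_affine[of 1 B "- u"] by simp
  have Bn: "(\<integral>t. norm (B (t - u)) \<partial>lborel) = (\<integral>t. norm (B t) \<partial>lborel)" for u
    using lborel_integral_real_affine[of 1 "\<lambda>t. norm (B t)" "- u"] by simp
  have int: "integrable (lborel \<Otimes>\<^sub>M lborel) (\<lambda>(u, t). A u * B (t - u))"
  proof (rule lborel_pair.Fubini_integrable)
    show "AE u in lborel. integrable lborel (\<lambda>t. case (u, t) of (u, t) \<Rightarrow> A u * B (t - u))"
      using Bs by (auto intro!: AE_I2)
    show "integrable lborel (\<lambda>u. \<integral>t. norm (case (u, t) of (u, t) \<Rightarrow> A u * B (t - u)) \<partial>lborel)"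
      using A by (simp add: norm_mult Bn integrable_norm)
  qed measurable
  show "(\<integral>t. (\<integral>u. A u * B (t - u) \<partial>lborel) \<partial>lborel) = integral\<^sup>L lborel A * integral\<^sup>L lborel B"
    using lborel_pair.Fubini_integral[OF int] by (simp add: Bi)
  show "integrable lborel (\<lambda>t. \<integral>u. A u * B (t - u) \<partial>lborel)"
    using lborel_pair.integrable_snd[OF int] by simp
qed

definition laplace :: "(real \<Rightarrow> complex) \<Rightarrow> complex \<Rightarrow> complex" where
  "laplace f s = (LBINT t:{0..}. exp (- (s * complex_of_real t)) * f t)"

lemma set_integrable_exp_bounded:
  assumes f: "f \<in> borel_measurable borel" and M: "\<And>t. t \<ge> 0 \<Longrightarrow> norm (f t) \<le> M" and s: "Re s > 0"
  shows "set_integrable lborel {0..} (\<lambda>t. exp (- (s * complex_of_real t)) * f t)"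
proof -
  have [measurable]: "f \<in> borel_measurable borel" by fact
  have M0: "M \<ge> 0" using M[of 0] norm_ge_zero[of "f 0"] by linarith
  \<comment> \<open>The case a = 1 of the Gamma integral. Since \<open>0 powr 0 = 0\<close>, the
    factor t^(1-1) is 1 only away from 0, so the comparison below is made almost everywhere.\<close>
  have "integrable lborel (\<lambda>t. M * (indicator {0..} t *\<^sub>R (t powr (1 - 1) * exp (- (Re s * t)))))"
    using set_integrable_powr_exp[of 1, OF _ s] unfolding set_integrable_def by (intro integrable_mult_right) auto
  then show ?thesis
    unfolding set_integrable_def
  proof (rule Bochner_Integration.integrable_bound)
    show "AE t in lborel. norm (indicator {0..} t *\<^sub>R (exp (- (s * complex_of_real t)) * f t))
        \<le> norm (M * (indicator {0..} t *\<^sub>R (t powr (1 - 1) * exp (- (Re s * t)))))"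
      using AE_lborel_singleton[of 0]
      by eventually_elim (use M M0 in \<open>auto simp: indicator_def norm_mult mult.commute[of M] intro!: mult_left_mono\<close>)
  qed auto
qed

lemma laplace_const_1: "Re s > 0 \<Longrightarrow> laplace (\<lambda>_. 1) s = 1 / s"
proof -
  assume s: "Re s > 0"
  have "laplace (\<lambda>_. 1) s = (LBINT u:{0..}. complex_of_real (u powr (1 - 1)) * exp (- (s * complex_of_real u)))"
    unfolding laplace_def set_lebesgue_integral_def
  proof (rule integral_cong_AE)
    show "AE u in lborel. indicator {0..} u *\<^sub>R (exp (- (s * complex_of_real u)) * 1) =
      indicator {0..} u *\<^sub>R (complex_of_real (u powr (1 - 1)) * exp (- (s * complex_of_real u)))"
      using AE_lborel_singleton[of 0] by eventually_elim auto
  qed auto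
  also have "\<dots> = 1 / s" using s by (subst integral_powr_exp_complex) (auto simp: powr_minus_divide Gamma_1)
  finally show ?thesis .
qed

lemma laplace_conv_RL_kernel:
  assumes \<alpha>: "\<alpha> > 0" and f: "continuous_on UNIV f" and M: "\<And>t. t \<ge> 0 \<Longrightarrow> norm (f t) \<le> M" and s: "Re s > 0"
  shows "laplace (conv (RL_kernel \<alpha>) f) s = s powr (- complex_of_real \<alpha>) * laplace f s"
    and "set_integrable lborel {0..} (\<lambda>t. exp (- (s * complex_of_real t)) * conv (RL_kernel \<alpha>) f t)"
proof -
  have G: "Gamma \<alpha> > 0" using \<alpha> by (rule Gamma_real_pos)
  \<comment> \<open>Because exp(-s t) = exp(-s u) exp(-s (t - u)), damping and extension by zero
    turn \<open>conv\<close> into a full-line convolution of integrable functions.\<close>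
  define A where "A u = indicator {0..} u *\<^sub>R (exp (- (s * complex_of_real u)) * RL_kernel \<alpha> u)" for u
  define B where "B u = indicator {0..} u *\<^sub>R (exp (- (s * complex_of_real u)) * f u)" for u
  have A_eq: "A u = 1 / complex_of_real (Gamma \<alpha>) * (indicator {0..} u *\<^sub>R (complex_of_real (u powr (\<alpha> - 1)) * exp (- (s * complex_of_real u))))" for u
    by (simp add: A_def RL_kernel_def)
  have A: "integrable lborel A"
    using set_integrable_powr_exp_complex[OF \<alpha> s] unfolding A_eq[abs_def] set_integrable_def
    by (intro integrable_mult_right) auto
  have A_val: "integral\<^sup>L lborel A = s powr (- complex_of_real \<alpha>)"
    using integral_powr_exp_complex[OF \<alpha> s] G
    unfolding A_eq[abs_def] integral_mult_right_zero set_lebesgue_integral_def by simp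
  have B: "integrable lborel B"
    using set_integrable_exp_bounded[OF borel_measurable_continuous_onI[OF f] M s]
    by (simp add: B_def[abs_def] set_integrable_def)
  have eq: "indicator {0..} t *\<^sub>R (exp (- (s * complex_of_real t)) * conv (RL_kernel \<alpha>) f t) = (\<integral>u. A u * B (t - u) \<partial>lborel)" for t
  proof -
    have "indicator {0..} t *\<^sub>R (exp (- (s * complex_of_real t)) * conv (RL_kernel \<alpha>) f t) =
      (\<integral>u. (indicator {0..} t *\<^sub>R exp (- (s * complex_of_real t))) * (indicator {0..t} u *\<^sub>R (RL_kernel \<alpha> u * f (t - u))) \<partial>lborel)"
      unfolding conv_def set_lebesgue_integral_def by (subst integral_mult_right_zero) simp
    also have "\<dots> = (\<integral>u. A u * B (t - u) \<partial>lborel)"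
    proof (intro Bochner_Integration.integral_cong refl)
      fix u
      have "exp (- (s * complex_of_real t)) = exp (- (s * complex_of_real u)) * exp (- (s * complex_of_real (t - u)))"
        by (simp add: algebra_simps flip: exp_add)
      then show "indicator {0..} t *\<^sub>R exp (- (s * complex_of_real t)) * (indicator {0..t} u *\<^sub>R (RL_kernel \<alpha> u * f (t - u))) = A u * B (t - u)"
        by (auto simp: A_def B_def indicator_def)
    qed
    finally show ?thesis .
  qed
  show "laplace (conv (RL_kernel \<alpha>) f) s = s powr (- complex_of_real \<alpha>) * laplace f s"
    using integral_convolution(1)[OF A B] A_val
    unfolding laplace_def set_lebesgue_integral_def eq B_def[symmetric] by simp
  show "set_integrable lborel {0..} (\<lambda>t. exp (- (s * complex_of_real t)) * conv (RL_kernel \<alpha>) f t)"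
    using integral_convolution(2)[OF A B] by (simp add: set_integrable_def eq)
qed

text \<open>Bound the integrand by M up to T and by \<eta> exp(-\<epsilon> t) afterwards. With
  \<eta> small and T fixed this is the quantitative form of X(s) = o(1 / Re s) for a function
  tending to 0.\<close>

lemma laplace_bound:
  assumes f: "continuous_on UNIV f" and M: "\<And>t. t \<ge> 0 \<Longrightarrow> norm (f t) \<le> M"
    and T: "T \<ge> 0" "\<And>t. t \<ge> T \<Longrightarrow> norm (f t) \<le> \<eta>" and \<epsilon>: "\<epsilon> > 0" "\<epsilon> \<le> Re s"
  shows "norm (laplace f s) \<le> M * T + \<eta> / \<epsilon>"
proof -
  have M0: "M \<ge> 0" using M[of 0] norm_ge_zero[of "f 0"] by linarith
  have \<eta>0: "\<eta> \<ge> 0" using T(2)[of T] norm_ge_zero[of "f T"] by linarith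
  have i: "integrable lborel (\<lambda>t. indicator {0..} t *\<^sub>R (t powr (1 - 1) * exp (- (\<epsilon> * t))))"
    using set_integrable_powr_exp[of 1, OF _ \<epsilon>(1)] unfolding set_integrable_def by auto
  have v: "(\<integral>t. indicator {0..} t *\<^sub>R (t powr (1 - 1) * exp (- (\<epsilon> * t))) \<partial>lborel) = 1 / \<epsilon>"
    using integral_powr_exp[of 1, OF _ \<epsilon>(1)] \<epsilon> by (simp add: set_lebesgue_integral_def powr_minus_divide Gamma_1)
  have j: "integrable lborel (\<lambda>t. M * indicator {0..T} t :: real)"
    by (intro integrable_mult_right) (auto simp: integrable_indicator_iff emeasure_lborel_Icc_eq)
  have "norm (laplace f s) \<le> (\<integral>t. M * indicator {0..T} t + \<eta> * (indicator {0..} t *\<^sub>R (t powr (1 - 1) * exp (- (\<epsilon> * t)))) \<partial>lborel)"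
    unfolding laplace_def set_lebesgue_integral_def
  proof (rule order_trans[OF integral_norm_bound], rule integral_mono_AE)
    show "integrable lborel (\<lambda>t. norm (indicator {0..} t *\<^sub>R (exp (- (s * complex_of_real t)) * f t)))"
      using set_integrable_exp_bounded[OF borel_measurable_continuous_onI[OF f] M, of s] \<epsilon>
      unfolding set_integrable_def by (intro integrable_norm) auto
    show "integrable lborel (\<lambda>t. M * indicator {0..T} t + \<eta> * (indicator {0..} t *\<^sub>R (t powr (1 - 1) * exp (- (\<epsilon> * t)))))"
      by (rule Bochner_Integration.integrable_add[OF j integrable_mult_right[OF i]])
    show "AE t in lborel. norm (indicator {0..} t *\<^sub>R (exp (- (s * complex_of_real t)) * f t)) \<le>
        M * indicator {0..T} t + \<eta> * (indicator {0..} t *\<^sub>R (t powr (1 - 1) * exp (- (\<epsilon> * t))))"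
      using AE_lborel_singleton[of 0]
    proof eventually_elim
      fix t :: real assume t0: "t \<noteq> 0"
      show "norm (indicator {0..} t *\<^sub>R (exp (- (s * complex_of_real t)) * f t)) \<le>
        M * indicator {0..T} t + \<eta> * (indicator {0..} t *\<^sub>R (t powr (1 - 1) * exp (- (\<epsilon> * t))))"
      proof (cases "t \<ge> 0")
        case True
        then have t: "t > 0" using t0 by simp
        have e: "exp (- (Re s * t)) \<le> exp (- (\<epsilon> * t))" "exp (- (Re s * t)) \<le> 1" using t \<epsilon> by auto
        show ?thesis
        proof (cases "t \<le> T")
          case True
          have "exp (- (Re s * t)) * norm (f t) \<le> 1 * M" using e M t by (intro mult_mono) auto
          moreover have "0 \<le> \<eta> * exp (- (\<epsilon> * t))" using \<eta>0 by simp
          ultimately show ?thesis using t True by (simp add: norm_mult)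
        next
          case False
          have "exp (- (Re s * t)) * norm (f t) \<le> exp (- (\<epsilon> * t)) * \<eta>" using e T False by (intro mult_mono) auto
          then show ?thesis using t False by (simp add: norm_mult mult.commute)
        qed
      qed auto
    qed
  qed
  also have "\<dots> = M * T + \<eta> / \<epsilon>"
    unfolding Bochner_Integration.integral_add[OF j integrable_mult_right[OF i]] integral_mult_right_zero v
    using T by simp
  finally show ?thesis .
qed

section \<open>Instability when |arg mu| \<le> alpha pi/2\<close>

lemma bounded_if_tendsto_0:
  fixes x :: "real \<Rightarrow> complex"
  assumes x: "continuous_on UNIV x" and lim: "(x \<longlongrightarrow> 0) at_top"
  obtains M where "\<And>t. t \<ge> 0 \<Longrightarrow> norm (x t) \<le> M"
proof -
  have "eventually (\<lambda>t. norm (x t) < 1) at_top"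
    using tendstoD[OF lim, of 1] by simp
  then obtain T where T: "\<And>t. t \<ge> T \<Longrightarrow> norm (x t) < 1" by (auto simp: eventually_at_top_linorder)
  obtain M where M: "\<And>u. u \<in> {0..T} \<Longrightarrow> norm (x u) \<le> M" using continuous_bounded_Icc[OF x] by blast
  have "norm (x t) \<le> max M 1" if "t \<ge> 0" for t
  proof (cases "t \<le> T")
    case True
    then show ?thesis using M[of t] that by simp
  next
    case False
    then show ?thesis using T[of t] by simp
  qed
  then show ?thesis by (rule that)
qed

lemma filterlim_of_real_at_right_0: "filterlim complex_of_real (at 0) (at_right 0)"
proof -
  have 1: "eventually (\<lambda>x. complex_of_real x \<in> UNIV \<and> complex_of_real x \<noteq> 0) (at_right 0)"
    using eventually_at_right_less[of "0::real"] by (rule eventually_mono) auto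
  have 2: "((\<lambda>x::real. complex_of_real x) \<longlongrightarrow> complex_of_real 0) (at_right 0)"
    by (intro tendsto_intros)
  show ?thesis using 1 2 unfolding filterlim_at by (simp only: of_real_0 simp_thms)
qed

theorem no_decay:
  assumes \<alpha>: "0 < \<alpha>" "\<alpha> \<le> 1" and \<mu>: "\<mu> \<noteq> 0" "\<bar>Arg \<mu>\<bar> \<le> \<alpha> * pi / 2"
    and x: "continuous_on UNIV x" and lim: "(x \<longlongrightarrow> 0) at_top"
    and eq: "\<And>t. t \<ge> 0 \<Longrightarrow> x t = 1 + \<mu> * conv (RL_kernel \<alpha>) x t"
  shows False
proof -
  \<comment> \<open>A root of s^alpha = mu. Its argument Arg mu / alpha lies in [-pi/2, pi/2] by
    hypothesis, so Re s0 \<ge> 0 and the principal logarithm of s0 is the exponent used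
    here.\<close>
  define s0 where "s0 = exp (Ln \<mu> / complex_of_real \<alpha>)"
  have im: "\<bar>Im (Ln \<mu> / complex_of_real \<alpha>)\<bar> \<le> pi / 2"
    using \<mu> \<alpha> by (simp add: Arg_eq_Im_Ln[symmetric] abs_divide divide_le_eq mult_ac)
  have Re_s0: "Re s0 \<ge> 0"
    unfolding s0_def Re_exp using im[unfolded abs_le_iff]
    by (intro mult_nonneg_nonneg cos_ge_zero) (simp_all only: exp_ge_zero, linarith)
  have s0_nz: "s0 \<noteq> 0" by (simp add: s0_def)
  have Ln_s0: "Ln s0 = Ln \<mu> / complex_of_real \<alpha>"
    unfolding s0_def using im pi_gt_zero by (intro Ln_exp) linarith+
  have s0_pow: "s0 powr complex_of_real \<alpha> = \<mu>"
    using \<alpha> \<mu> s0_nz by (simp add: powr_def Ln_s0)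
  have s0_dom: "s0 \<notin> \<real>\<^sub>\<le>\<^sub>0"
    using Re_s0 s0_nz by (auto simp: complex_nonpos_Reals_iff complex_eq_iff)
  obtain M where M: "\<And>t. t \<ge> 0 \<Longrightarrow> norm (x t) \<le> M" using bounded_if_tendsto_0[OF x lim] by blast
  have key: "laplace x s * (s powr complex_of_real \<alpha> - \<mu>) = s powr (complex_of_real \<alpha> - 1)" if s: "Re s > 0" for s
  proof -
    have s_nz: "s \<noteq> 0" using s by auto
    have int1: "set_integrable lborel {0..} (\<lambda>t. exp (- (s * complex_of_real t)) * 1)"
      by (rule set_integrable_exp_bounded[of _ 1]) (use s in auto)
    have "laplace x s = (LBINT t:{0..}. exp (- (s * complex_of_real t)) * 1 + \<mu> * (exp (- (s * complex_of_real t)) * conv (RL_kernel \<alpha>) x t))"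
      unfolding laplace_def by (intro set_lebesgue_integral_cong) (auto simp: eq algebra_simps)
    also have "\<dots> = laplace (\<lambda>_. 1) s + \<mu> * laplace (conv (RL_kernel \<alpha>) x) s"
      using laplace_conv_RL_kernel(2)[OF \<alpha>(1) x M s] int1
      by (subst set_integral_add) (auto simp: laplace_def)
    also have "\<dots> = 1 / s + \<mu> * (s powr (- complex_of_real \<alpha>) * laplace x s)"
      using s laplace_conv_RL_kernel(1)[OF \<alpha>(1) x M s] by (simp add: laplace_const_1)
    finally have "laplace x s * s powr complex_of_real \<alpha> = (1 / s + \<mu> * (s powr (- complex_of_real \<alpha>) * laplace x s)) * s powr complex_of_real \<alpha>"
      by simp
    also have "\<dots> = s powr complex_of_real \<alpha> / s + \<mu> * laplace x s"
      using s_nz unfolding powr_minus ring_distribs by simp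
    also have "s powr complex_of_real \<alpha> / s = s powr (complex_of_real \<alpha> - 1)"
      using s_nz by (simp add: powr_diff)
    finally show ?thesis unfolding right_diff_distrib by (simp only: mult.commute[of \<mu>] add_diff_cancel_right')
  qed
  define L where "L = norm (s0 powr (complex_of_real \<alpha> - 1))"
  have L: "L > 0" using s0_nz by (simp add: L_def)
  \<comment> \<open>At the boundary of the sector s0 lies on the imaginary axis, so s0 is approached
    through s0 + \<epsilon> with real \<epsilon> > 0. The derivative gives |s^alpha - mu| \<le> K
    \<epsilon>, which absorbs the 1/\<epsilon> of \<open>laplace_bound\<close>.\<close>
  have "((\<lambda>z. z powr complex_of_real \<alpha>) has_field_derivative complex_of_real \<alpha> * s0 powr (complex_of_real \<alpha> - 1)) (at s0)"
    using s0_dom by (rule has_field_derivative_powr)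
  then have "((\<lambda>h. ((s0 + h) powr complex_of_real \<alpha> - \<mu>) / h) \<longlongrightarrow> complex_of_real \<alpha> * s0 powr (complex_of_real \<alpha> - 1)) (at 0)"
    by (simp add: DERIV_def s0_pow)
  then have "((\<lambda>\<epsilon>. ((s0 + complex_of_real \<epsilon>) powr complex_of_real \<alpha> - \<mu>) / complex_of_real \<epsilon>) \<longlongrightarrow> complex_of_real \<alpha> * s0 powr (complex_of_real \<alpha> - 1)) (at_right 0)"
    using filterlim_of_real_at_right_0 by (rule filterlim_compose)
  from tendsto_norm[OF this]
  have lim_quot: "((\<lambda>\<epsilon>. norm (((s0 + complex_of_real \<epsilon>) powr complex_of_real \<alpha> - \<mu>) / complex_of_real \<epsilon>)) \<longlongrightarrow> \<alpha> * L) (at_right 0)"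
    using \<alpha> by (simp add: L_def norm_mult)
  define K where "K = \<alpha> * L + 1"
  have K: "K > 0" using L \<alpha> by (simp add: K_def add_nonneg_pos)
  have ev1: "eventually (\<lambda>\<epsilon>. norm (((s0 + complex_of_real \<epsilon>) powr complex_of_real \<alpha> - \<mu>) / complex_of_real \<epsilon>) < K) (at_right 0)"
    by (rule order_tendstoD(2)[OF lim_quot]) (simp add: K_def)
  have "isCont (\<lambda>z. z powr (complex_of_real \<alpha> - 1)) s0"
    using s0_dom by (intro continuous_intros) auto
  then have "((\<lambda>\<epsilon>. norm ((s0 + complex_of_real \<epsilon>) powr (complex_of_real \<alpha> - 1))) \<longlongrightarrow> L) (at_right 0)"
    unfolding L_def by (intro tendsto_norm isCont_tendsto_compose[where g = "\<lambda>z. z powr (complex_of_real \<alpha> - 1)"])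
      (auto intro!: tendsto_eq_intros)
  then have ev2: "eventually (\<lambda>\<epsilon>. norm ((s0 + complex_of_real \<epsilon>) powr (complex_of_real \<alpha> - 1)) > L / 2) (at_right 0)"
    using L by (intro order_tendstoD(1)) auto
  \<comment> \<open>Makes \<eta> K = L/4. Together with M T K \<epsilon> < L/4 the product stays
    below L/2, while the right-hand side of \<open>key\<close> exceeds L/2 near s0.\<close>
  define \<eta> where "\<eta> = L / (4 * K)"
  have \<eta>: "\<eta> > 0" using L K by (simp add: \<eta>_def)
  have "eventually (\<lambda>t. norm (x t) < \<eta>) at_top"
    using tendstoD[OF lim \<eta>] by simp
  then obtain T' where T': "\<And>t. t \<ge> T' \<Longrightarrow> norm (x t) < \<eta>" by (auto simp: eventually_at_top_linorder)
  define T where "T = max 0 T'"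
  have T: "T \<ge> 0" "\<And>t. t \<ge> T \<Longrightarrow> norm (x t) \<le> \<eta>" using T' by (auto simp: T_def less_imp_le)
  have "((\<lambda>\<epsilon>. M * T * K * \<epsilon>) \<longlongrightarrow> 0) (at_right 0)" by (auto intro!: tendsto_eq_intros)
  then have ev3: "eventually (\<lambda>\<epsilon>. M * T * K * \<epsilon> < L / 4) (at_right 0)"
    using L by (intro order_tendstoD(2)) auto
  have ev4: "eventually (\<lambda>\<epsilon>::real. \<epsilon> > 0) (at_right 0)" by (rule eventually_at_right_less)
  have "eventually (\<lambda>\<epsilon>::real. False) (at_right 0)"
    using ev1 ev2 ev3 ev4
  proof eventually_elim
    fix \<epsilon> :: real
    assume 1: "norm (((s0 + complex_of_real \<epsilon>) powr complex_of_real \<alpha> - \<mu>) / complex_of_real \<epsilon>) < K"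
      and 2: "norm ((s0 + complex_of_real \<epsilon>) powr (complex_of_real \<alpha> - 1)) > L / 2"
      and 3: "M * T * K * \<epsilon> < L / 4" and 4: "\<epsilon> > 0"
    define s where "s = s0 + complex_of_real \<epsilon>"
    have s: "Re s > 0" "\<epsilon> \<le> Re s" using Re_s0 4 by (auto simp: s_def)
    have "norm (s powr (complex_of_real \<alpha> - 1)) = norm (laplace x s) * norm (s powr complex_of_real \<alpha> - \<mu>)"
      using key[OF s(1)] by (simp flip: norm_mult)
    also have "\<dots> \<le> (M * T + \<eta> / \<epsilon>) * (K * \<epsilon>)"
      using laplace_bound[OF x M T 4 s(2)] 1 4
      by (intro mult_mono) (auto simp: s_def norm_divide divide_less_eq intro: order_trans[OF norm_ge_zero])
    also have "\<dots> = M * T * K * \<epsilon> + \<eta> * K" using 4 by (simp add: algebra_simps)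
    also have "\<dots> < L / 2" using 3 K by (simp add: \<eta>_def)
    finally show False using 2 by (simp add: s_def)
  qed
  then show False by simp
qed

section \<open>Sectoriality of the fractional integral\<close>

lemma LBINT_Icc_eq_integral:
  fixes f :: "real \<Rightarrow> complex"
  assumes "continuous_on UNIV f"
  shows "(LBINT t:{a..b}. f t) = integral {a..b} f"
proof (rule set_borel_integral_eq_integral)
  have "set_integrable lborel {a..b} f"
    unfolding set_integrable_def
    using borel_integrable_compact[of "{a..b}" f] assms by (auto intro: continuous_on_subset)
  then show "set_integrable lborel {a..b} f" .
qed

lemma continuous_exp_kernel: "continuous_on UNIV (\<lambda>u. exp (- (z * complex_of_real u)))"
  by (intro continuous_intros)

text \<open>The convolution W solves W' = y - z W with W(0) = 0. Hence the inner product of y and W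
  is half the derivative of |W|^2 plus Re z |W|^2, and its integral is nonnegative.\<close>

lemma exp_kernel_positive:
  assumes y: "continuous_on UNIV y" and z: "Re z \<ge> 0" and T: "T \<ge> 0"
  shows "0 \<le> integral {0..T} (\<lambda>t. y t \<bullet> conv (\<lambda>u. exp (- (z * complex_of_real u))) y t)"
proof -
  define W where "W = conv (\<lambda>u. exp (- (z * complex_of_real u))) y"
  have W_0: "W 0 = 0" by (simp add: W_def conv_nonpos)
  have W: "continuous_on UNIV W"
    unfolding W_def by (intro continuous_conv locally_integrable_continuous continuous_exp_kernel y)
  have ez: "continuous_on UNIV (\<lambda>s. exp (z * complex_of_real s) * y s)"
    by (intro continuous_intros y)
  have W_eq: "W t = exp (- (z * complex_of_real t)) * integral {0..t} (\<lambda>s. exp (z * complex_of_real s) * y s)" if "t \<ge> 0" for t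
  proof -
    have "W t = (LBINT u:{0..t}. exp (- (z * complex_of_real t)) * (exp (z * complex_of_real u) * y u))"
      unfolding W_def by (subst conv_commute)
        (simp add: conv_def algebra_simps flip: exp_add)
    also have "\<dots> = exp (- (z * complex_of_real t)) * integral {0..t} (\<lambda>s. exp (z * complex_of_real s) * y s)"
      by (simp add: LBINT_Icc_eq_integral[OF ez])
    finally show ?thesis .
  qed
  have dW: "(W has_vector_derivative y t - z * W t) (at t within {0..T})" if t: "t \<in> {0..T}" for t
  proof -
    have "((\<lambda>t. integral {0..t} (\<lambda>s. exp (z * complex_of_real s) * y s)) has_vector_derivative exp (z * complex_of_real t) * y t) (at t within {0..T})"
      by (intro integral_has_vector_derivative continuous_on_subset[OF ez]) (use t in auto)
    moreover have "((\<lambda>t. exp (- (z * complex_of_real t))) has_vector_derivative - z * exp (- (z * complex_of_real t))) (at t within {0..T})"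
    proof -
      have "((\<lambda>x. exp (- (z * x))) has_field_derivative - z * exp (- (z * complex_of_real t))) (at (complex_of_real t))"
        by (auto intro!: derivative_eq_intros)
      then show ?thesis
        by (rule has_vector_derivative_real_field[THEN has_vector_derivative_at_within])
    qed
    ultimately have "((\<lambda>t. exp (- (z * complex_of_real t)) * integral {0..t} (\<lambda>s. exp (z * complex_of_real s) * y s)) has_vector_derivative
      exp (- (z * complex_of_real t)) * (exp (z * complex_of_real t) * y t) + (- z * exp (- (z * complex_of_real t))) * integral {0..t} (\<lambda>s. exp (z * complex_of_real s) * y s)) (at t within {0..T})"
      by (intro has_vector_derivative_mult)
    also have "exp (- (z * complex_of_real t)) * (exp (z * complex_of_real t) * y t) + (- z * exp (- (z * complex_of_real t))) * integral {0..t} (\<lambda>s. exp (z * complex_of_real s) * y s) = y t - z * W t"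
      using t by (simp add: W_eq exp_minus)
    finally show ?thesis
      by (rule has_vector_derivative_transform[OF t, rotated]) (simp add: W_eq)
  qed
  have "((\<lambda>t. W t \<bullet> W t) has_vector_derivative 2 * ((y t - z * W t) \<bullet> W t)) (at t within {0..T})" if t: "t \<in> {0..T}" for t
    using bounded_bilinear.has_vector_derivative[OF bounded_bilinear_inner dW[OF t] dW[OF t]]
    by (simp add: inner_commute)
  then have "((\<lambda>t. 2 * ((y t - z * W t) \<bullet> W t)) has_integral (W T \<bullet> W T - W 0 \<bullet> W 0)) {0..T}"
    using T by (intro fundamental_theorem_of_calculus) auto
  then have "integral {0..T} (\<lambda>t. 2 * ((y t - z * W t) \<bullet> W t)) = W T \<bullet> W T"
    by (simp only: integral_unique W_0) simp
  then have "0 \<le> 2 * integral {0..T} (\<lambda>t. (y t - z * W t) \<bullet> W t)" by simp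
  also have "integral {0..T} (\<lambda>t. (y t - z * W t) \<bullet> W t) \<le> integral {0..T} (\<lambda>t. y t \<bullet> W t)"
  proof (rule integral_le)
    show "(\<lambda>t. (y t - z * W t) \<bullet> W t) integrable_on {0..T}" "(\<lambda>t. y t \<bullet> W t) integrable_on {0..T}"
      by (intro integrable_continuous_interval continuous_intros continuous_on_subset[OF y] continuous_on_subset[OF W]; simp)+
    have "(z * W t) \<bullet> W t = Re z * (norm (W t))\<^sup>2" for t
      by (simp add: inner_complex_def cmod_power2) (simp add: power2_eq_square algebra_simps)
    then have "(z * W t) \<bullet> W t \<ge> 0" for t using z by simp
    then show "\<And>t. t \<in> {0..T} \<Longrightarrow> (y t - z * W t) \<bullet> W t \<le> y t \<bullet> W t"
      by (simp add: inner_diff_left)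
  qed
  finally show ?thesis by (simp add: W_def)
qed

text \<open>The form becomes the value at T of p * G with G independent of p. It is thus linear in
  the kernel, and a superposition of kernels can be treated by one application of Fubini.\<close>

lemma quadratic_form_eq_conv:
  assumes p: "locally_integrable p" and y: "continuous_on UNIV y"
  shows "integral {0..T} (\<lambda>t. cnj (y t) * conv p y t) = conv p (conv y (\<lambda>s. cnj (y (T - s)))) T"
proof -
  have cy: "continuous_on UNIV (\<lambda>s. cnj (y (T - s)))"
    by (intro continuous_intros continuous_on_compose2[OF y]) auto
  have "conv p (conv y (\<lambda>s. cnj (y (T - s)))) T = conv (conv p y) (\<lambda>s. cnj (y (T - s))) T"
    by (rule conv_assoc[OF p y cy])
  also have "\<dots> = integral {0..T} (\<lambda>t. cnj (y t) * conv p y t)"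
    unfolding conv_def[of "conv p y"]
    by (subst LBINT_Icc_eq_integral) (auto intro!: continuous_intros continuous_conv p y simp: mult.commute)
  finally show ?thesis ..
qed

lemma powr_times_pos_real:
  assumes "u > 0" "w \<noteq> 0"
  shows "(w * complex_of_real u) powr c = w powr c * complex_of_real u powr c"
proof -
  have "Ln (w * complex_of_real u) = Ln w + complex_of_real (ln u)"
    using assms Ln_times_of_real[of u w] by (simp add: mult.commute add.commute Ln_of_real)
  then show ?thesis
    using assms by (simp add: powr_def algebra_simps Ln_of_real flip: exp_add)
qed

text \<open>Sectoriality of the fractional integral: rotating the ray of the representation
  \<open>u powr (\<alpha> - 1) = const * (\<integral>\<rho>. \<rho> powr (- \<alpha>) * exp (- \<rho> u))\<close> writes the kernel as a superposition
  of exponential kernels with nonnegative real part.\<close>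

lemma RL_kernel_sectorial:
  assumes \<alpha>: "0 < \<alpha>" "\<alpha> < 1" and w: "Re w > 0" and y: "continuous_on UNIV y" and T: "T \<ge> 0"
  shows "0 \<le> Re (w powr (complex_of_real \<alpha> - 1) * integral {0..T} (\<lambda>t. cnj (y t) * conv (RL_kernel \<alpha>) y t))"
proof -
  define G where "G = conv y (\<lambda>s. cnj (y (T - s)))"
  have G: "continuous_on UNIV G"
    unfolding G_def by (intro continuous_conv locally_integrable_continuous y continuous_intros continuous_on_compose2[OF y]) auto
  have w0: "w \<noteq> 0" using w by auto
  have Gam: "Gamma \<alpha> > 0" "Gamma (1 - \<alpha>) > 0" using \<alpha> by (auto intro: Gamma_real_pos)
  \<comment> \<open>The Gamma integral of order 1 - alpha at the complex point w u: integration over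
    \<rho> gives Gamma(1 - alpha) (w u)^(alpha-1), which is the kernel rotated by
    w^(alpha-1).\<close>
  define h where "h u \<rho> = indicator {0..} \<rho> *\<^sub>R (complex_of_real (\<rho> powr (1 - \<alpha> - 1)) * exp (- ((w * complex_of_real u) * complex_of_real \<rho>)))" for u \<rho>
  have [measurable]: "G \<in> borel_measurable borel" using G by (rule borel_measurable_continuous_onI)
  have h_int: "integrable lborel (h u)" if "u > 0" for u
    using set_integrable_powr_exp_complex[of "1 - \<alpha>" "w * complex_of_real u"] \<alpha> w that
    by (simp add: h_def[abs_def] set_integrable_def)
  have h_val: "integral\<^sup>L lborel (h u) = complex_of_real (Gamma (1 - \<alpha>) * Gamma \<alpha>) * (w powr (complex_of_real \<alpha> - 1) * RL_kernel \<alpha> u)" if u: "u > 0" for u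
  proof -
    have "integral\<^sup>L lborel (h u) = complex_of_real (Gamma (1 - \<alpha>)) * (w * complex_of_real u) powr (- complex_of_real (1 - \<alpha>))"
      unfolding h_def set_lebesgue_integral_def[symmetric] by (rule integral_powr_exp_complex) (use \<alpha> w u in auto)
    also have "(w * complex_of_real u) powr (- complex_of_real (1 - \<alpha>)) = w powr (complex_of_real \<alpha> - 1) * complex_of_real (u powr (\<alpha> - 1))"
      using u w0 by (subst powr_times_pos_real) (auto simp: powr_of_real[symmetric])
    finally show ?thesis using Gam by (simp add: RL_kernel_def)
  qed
  have h_norm: "(\<integral>\<rho>. norm (h u \<rho>) \<partial>lborel) = Gamma (1 - \<alpha>) * (Re w powr (\<alpha> - 1) * u powr (\<alpha> - 1))" if u: "u > 0" for u
  proof -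
    have "(\<integral>\<rho>. norm (h u \<rho>) \<partial>lborel) = (LBINT \<rho>:{0..}. \<rho> powr (1 - \<alpha> - 1) * exp (- ((Re w * u) * \<rho>)))"
      unfolding set_lebesgue_integral_def
      by (intro Bochner_Integration.integral_cong refl) (auto simp: h_def norm_mult indicator_def)
    also have "\<dots> = Gamma (1 - \<alpha>) * (Re w * u) powr (- (1 - \<alpha>))"
      by (rule integral_powr_exp) (use \<alpha> w u in auto)
    finally show ?thesis using w u by (simp add: powr_mult)
  qed
  \<comment> \<open>Integrating |h| over \<rho> leaves a multiple of u^(alpha-1), still integrable
    at 0 against the bounded G. This is where Re w > 0 is needed strictly.\<close>
  have int: "integrable (lborel \<Otimes>\<^sub>M lborel) (\<lambda>(u, \<rho>). (indicator {0..T} u *\<^sub>R G (T - u)) * h u \<rho>)"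
  proof (rule lborel_pair.Fubini_integrable)
    show "(\<lambda>(u, \<rho>). (indicator {0..T} u *\<^sub>R G (T - u)) * h u \<rho>) \<in> borel_measurable (lborel \<Otimes>\<^sub>M lborel)"
      unfolding h_def by measurable
    show "AE u in lborel. integrable lborel (\<lambda>\<rho>. case (u, \<rho>) of (u, \<rho>) \<Rightarrow> (indicator {0..T} u *\<^sub>R G (T - u)) * h u \<rho>)"
      using AE_lborel_singleton[of 0]
    proof eventually_elim
      fix u :: real assume "u \<noteq> 0"
      then show "integrable lborel (\<lambda>\<rho>. case (u, \<rho>) of (u, \<rho>) \<Rightarrow> (indicator {0..T} u *\<^sub>R G (T - u)) * h u \<rho>)"
        using h_int[of u] by (cases "u \<in> {0..T}") auto
    qed
    have "integrable lborel (\<lambda>u. (Gamma (1 - \<alpha>) * Re w powr (\<alpha> - 1)) * norm (indicator {0..T} u *\<^sub>R (complex_of_real (u powr (\<alpha> - 1)) * 1 * G (T - u))))"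
      using set_integrable_conv[OF locally_integrable_powr_mult[of \<alpha> "\<lambda>_. 1"] G, of T] \<alpha>
      unfolding set_integrable_def by (intro integrable_mult_right integrable_norm) auto
    then show "integrable lborel (\<lambda>u. \<integral>\<rho>. norm (case (u, \<rho>) of (u, \<rho>) \<Rightarrow> (indicator {0..T} u *\<^sub>R G (T - u)) * h u \<rho>) \<partial>lborel)"
    proof (rule integrable_cong_AE_imp)
      show "(\<lambda>u. \<integral>\<rho>. norm (case (u, \<rho>) of (u, \<rho>) \<Rightarrow> (indicator {0..T} u *\<^sub>R G (T - u)) * h u \<rho>) \<partial>lborel) \<in> borel_measurable lborel"
        unfolding h_def by measurable
      show "AE u in lborel. (Gamma (1 - \<alpha>) * Re w powr (\<alpha> - 1)) * norm (indicator {0..T} u *\<^sub>R (complex_of_real (u powr (\<alpha> - 1)) * 1 * G (T - u))) =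
         (\<integral>\<rho>. norm (case (u, \<rho>) of (u, \<rho>) \<Rightarrow> (indicator {0..T} u *\<^sub>R G (T - u)) * h u \<rho>) \<partial>lborel)"
        using AE_lborel_singleton[of 0]
      proof eventually_elim
        fix u :: real assume "u \<noteq> 0"
        then show "(Gamma (1 - \<alpha>) * Re w powr (\<alpha> - 1)) * norm (indicator {0..T} u *\<^sub>R (complex_of_real (u powr (\<alpha> - 1)) * 1 * G (T - u))) =
         (\<integral>\<rho>. norm (case (u, \<rho>) of (u, \<rho>) \<Rightarrow> (indicator {0..T} u *\<^sub>R G (T - u)) * h u \<rho>) \<partial>lborel)"
          by (cases "u \<in> {0..T}") (auto simp: norm_mult h_norm)
      qed
    qed
  qed
  have "complex_of_real (Gamma (1 - \<alpha>) * Gamma \<alpha>) * (w powr (complex_of_real \<alpha> - 1) * conv (RL_kernel \<alpha>) G T) =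
     (\<integral>u. complex_of_real (Gamma (1 - \<alpha>) * Gamma \<alpha>) * w powr (complex_of_real \<alpha> - 1) * (indicator {0..T} u *\<^sub>R (RL_kernel \<alpha> u * G (T - u))) \<partial>lborel)"
    unfolding conv_def set_lebesgue_integral_def by (subst integral_mult_right_zero) simp
  also have "\<dots> = (\<integral>u. \<integral>\<rho>. (indicator {0..T} u *\<^sub>R G (T - u)) * h u \<rho> \<partial>lborel \<partial>lborel)"
  proof (rule integral_cong_AE)
    show "AE u in lborel. complex_of_real (Gamma (1 - \<alpha>) * Gamma \<alpha>) * w powr (complex_of_real \<alpha> - 1) * (indicator {0..T} u *\<^sub>R (RL_kernel \<alpha> u * G (T - u))) =
       (\<integral>\<rho>. (indicator {0..T} u *\<^sub>R G (T - u)) * h u \<rho> \<partial>lborel)"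
      using AE_lborel_singleton[of 0]
    proof eventually_elim
      fix u :: real assume "u \<noteq> 0"
      then show "complex_of_real (Gamma (1 - \<alpha>) * Gamma \<alpha>) * w powr (complex_of_real \<alpha> - 1) * (indicator {0..T} u *\<^sub>R (RL_kernel \<alpha> u * G (T - u))) =
       (\<integral>\<rho>. (indicator {0..T} u *\<^sub>R G (T - u)) * h u \<rho> \<partial>lborel)"
        unfolding integral_mult_right_zero by (cases "u \<in> {0..T}") (auto simp: h_val)
    qed
  qed (auto simp: RL_kernel_def[abs_def] h_def[abs_def])
  also have "\<dots> = (\<integral>\<rho>. \<integral>u. (indicator {0..T} u *\<^sub>R G (T - u)) * h u \<rho> \<partial>lborel \<partial>lborel)"
    using lborel_pair.Fubini_integral[OF int] by simp
  finally have main: "complex_of_real (Gamma (1 - \<alpha>) * Gamma \<alpha>) * (w powr (complex_of_real \<alpha> - 1) * conv (RL_kernel \<alpha>) G T) =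
    (\<integral>\<rho>. \<integral>u. (indicator {0..T} u *\<^sub>R G (T - u)) * h u \<rho> \<partial>lborel \<partial>lborel)" .
  \<comment> \<open>For fixed \<rho> the inner integral is a nonnegative multiple of the form for
    the exponential kernel with exponent \<rho> w, so \<open>exp_kernel_positive\<close>
    applies.\<close>
  have "0 \<le> Re (\<integral>u. (indicator {0..T} u *\<^sub>R G (T - u)) * h u \<rho> \<partial>lborel)" for \<rho>
  proof (cases "\<rho> \<ge> 0")
    case True
    define q where "q u = exp (- ((complex_of_real \<rho> * w) * complex_of_real u))" for u
    have q: "continuous_on UNIV q" unfolding q_def by (rule continuous_exp_kernel)
    have "(indicator {0..T} u *\<^sub>R G (T - u)) * h u \<rho> = complex_of_real (\<rho> powr - \<alpha>) * (indicator {0..T} u *\<^sub>R (q u * G (T - u)))" for u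
    proof -
      have "h u \<rho> = complex_of_real (\<rho> powr - \<alpha>) * q u"
        using True by (simp add: h_def q_def mult.commute mult.left_commute)
      then show ?thesis by simp
    qed
    then have "(\<integral>u. (indicator {0..T} u *\<^sub>R G (T - u)) * h u \<rho> \<partial>lborel) = complex_of_real (\<rho> powr - \<alpha>) * conv q G T"
      unfolding conv_def set_lebesgue_integral_def by (simp only: integral_mult_right_zero)
    also have "conv q G T = integral {0..T} (\<lambda>t. cnj (y t) * conv q y t)"
      unfolding G_def by (rule quadratic_form_eq_conv[OF locally_integrable_continuous[OF q] y, symmetric])
    finally have eq: "(\<integral>u. (indicator {0..T} u *\<^sub>R G (T - u)) * h u \<rho> \<partial>lborel) =
       complex_of_real (\<rho> powr - \<alpha>) * integral {0..T} (\<lambda>t. cnj (y t) * conv q y t)" .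
    have "continuous_on UNIV (\<lambda>t. cnj (y t) * conv q y t)"
      by (intro continuous_intros y continuous_conv locally_integrable_continuous q)
    then have "(\<lambda>t. cnj (y t) * conv q y t) integrable_on {0..T}"
      using continuous_on_subset by (blast intro: integrable_continuous_interval)
    from integral_linear[OF this bounded_linear_Re]
    have "Re (integral {0..T} (\<lambda>t. cnj (y t) * conv q y t)) = integral {0..T} (\<lambda>t. y t \<bullet> conv q y t)"
      by (simp add: o_def inner_complex_def)
    moreover have "0 \<le> integral {0..T} (\<lambda>t. y t \<bullet> conv q y t)"
      unfolding q_def by (rule exp_kernel_positive[OF y _ T]) (use True w in simp)
    ultimately have "0 \<le> Re (integral {0..T} (\<lambda>t. cnj (y t) * conv q y t))" by simp
    then show ?thesis unfolding eq by simp
  qed (simp add: h_def)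
  then have "0 \<le> (\<integral>\<rho>. Re (\<integral>u. (indicator {0..T} u *\<^sub>R G (T - u)) * h u \<rho> \<partial>lborel) \<partial>lborel)"
    by (intro integral_nonneg_AE) auto
  also have "\<dots> = Re (complex_of_real (Gamma (1 - \<alpha>) * Gamma \<alpha>) * (w powr (complex_of_real \<alpha> - 1) * conv (RL_kernel \<alpha>) G T))"
    unfolding main using lborel_pair.integrable_snd[OF int] by (intro integral_Re) simp
  also have "\<dots> = (Gamma (1 - \<alpha>) * Gamma \<alpha>) * Re (w powr (complex_of_real \<alpha> - 1) * conv (RL_kernel \<alpha>) G T)"
    by simp
  finally have "0 \<le> Re (w powr (complex_of_real \<alpha> - 1) * conv (RL_kernel \<alpha>) G T)"
    using mult_le_cancel_left_pos[OF mult_pos_pos[OF Gam(2,1)], of 0] by (simp only: mult_zero_right)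
  then show ?thesis
    unfolding G_def by (simp only: quadratic_form_eq_conv[OF locally_integrable_RL_kernel[OF \<alpha>(1)] y])
qed

text \<open>Chooses the rotation that makes the sectoriality estimate coercive for this mu. Let w
  have argument \<psi>, of the same sign as \<beta> = Arg mu. Then w^(alpha-1)/mu has phase of
  absolute value (1 - alpha) |\<psi>| + |\<beta>|. As |\<psi>| tends to pi/2 the limit exceeds pi/2
  exactly when |\<beta>| > alpha pi/2.\<close>

lemma rotation_exists:
  assumes \<alpha>: "0 < \<alpha>" "\<alpha> < 1" and \<mu>: "\<mu> \<noteq> 0" "\<bar>Arg \<mu>\<bar> > \<alpha> * pi / 2"
  obtains w where "Re w > 0" "Re (- (w powr (complex_of_real \<alpha> - 1)) / \<mu>) > 0"
proof -
  define \<beta> where "\<beta> = Arg \<mu>"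
  \<comment> \<open>Half of the excess of |\<beta>| over alpha pi/2. Staying \<delta> short of pi/2
    keeps Re w > 0, and still \<theta> = pi/2 + (1 + alpha) \<delta>.\<close>
  define \<delta> where "\<delta> = (\<bar>\<beta>\<bar> - \<alpha> * pi / 2) / 2"
  define \<psi> where "\<psi> = sgn \<beta> * (pi / 2 - \<delta>)"
  define \<theta> where "\<theta> = (1 - \<alpha>) * (pi / 2 - \<delta>) + \<bar>\<beta>\<bar>"
  have \<beta>: "\<bar>\<beta>\<bar> \<le> pi" using Arg_bounded[of \<mu>] by (auto simp: \<beta>_def abs_le_iff)
  have ap: "0 < \<alpha> * pi / 2" using \<alpha> by simp
  have \<delta>: "0 < \<delta>" "\<delta> < pi / 2" using \<mu> \<beta> ap by (auto simp: \<delta>_def \<beta>_def)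
  have \<beta>0: "\<beta> \<noteq> 0" using \<mu> ap by (auto simp: \<beta>_def)
  have \<psi>: "\<bar>\<psi>\<bar> < pi / 2" using \<delta> \<beta>0 by (auto simp: \<psi>_def abs_mult)
  have "\<theta> = pi / 2 + (1 + \<alpha>) * \<delta>" by (simp add: \<theta>_def \<delta>_def field_simps)
  then have "\<theta> > pi / 2" using \<delta> \<alpha> by simp
  moreover have "(1 - \<alpha>) * (pi / 2 - \<delta>) < 1 * (pi / 2)" using \<alpha> \<delta> by (intro mult_strict_mono) auto
  then have "\<theta> < pi / 2 + pi" using \<beta> by (simp add: \<theta>_def)
  ultimately have "sin (\<theta> - pi / 2) > 0" by (intro sin_gt_zero) auto
  then have cos_neg: "cos \<theta> < 0" by (simp add: sin_diff)
  have "cos ((\<alpha> - 1) * \<psi> - \<beta>) = cos \<theta>"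
  proof (cases "\<beta> > 0")
    case True
    then have "(\<alpha> - 1) * \<psi> - \<beta> = - \<theta>" by (simp add: \<psi>_def \<theta>_def field_simps)
    then show ?thesis by simp
  next
    case False
    then have "(\<alpha> - 1) * \<psi> - \<beta> = \<theta>" using \<beta>0 by (simp add: \<psi>_def \<theta>_def field_simps)
    then show ?thesis by simp
  qed
  define w where "w = exp (\<i> * complex_of_real \<psi>)"
  have "Ln w = \<i> * complex_of_real \<psi>"
    unfolding w_def using \<psi> by (intro Ln_exp) (auto simp: abs_less_iff)
  then have w_pow: "w powr (complex_of_real \<alpha> - 1) = exp (\<i> * complex_of_real ((\<alpha> - 1) * \<psi>))"
    by (simp add: powr_def w_def algebra_simps)
  have "\<mu> = complex_of_real (norm \<mu>) * exp (\<i> * complex_of_real \<beta>)"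
    using Arg_eq[OF \<mu>(1)] by (simp add: \<beta>_def)
  then have "- (w powr (complex_of_real \<alpha> - 1)) / \<mu> = - (exp (\<i> * complex_of_real ((\<alpha> - 1) * \<psi>)) / exp (\<i> * complex_of_real \<beta>)) / complex_of_real (norm \<mu>)"
    by (metis w_pow divide_divide_eq_left minus_divide_left mult.commute)
  also have "exp (\<i> * complex_of_real ((\<alpha> - 1) * \<psi>)) / exp (\<i> * complex_of_real \<beta>) = exp (\<i> * complex_of_real ((\<alpha> - 1) * \<psi> - \<beta>))"
    by (simp add: algebra_simps flip: exp_diff)
  also have "Re (- exp (\<i> * complex_of_real ((\<alpha> - 1) * \<psi> - \<beta>)) / complex_of_real (norm \<mu>)) = - cos \<theta> / norm \<mu>"
    using \<open>cos ((\<alpha> - 1) * \<psi> - \<beta>) = cos \<theta>\<close> by (simp add: Re_exp)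
  finally have "Re (- (w powr (complex_of_real \<alpha> - 1)) / \<mu>) = - cos \<theta> / norm \<mu>" .
  moreover have "Re w > 0" using \<psi> by (auto simp: w_def Re_exp abs_less_iff intro!: cos_gt_zero_pi)
  ultimately show ?thesis using cos_neg \<mu>(1) by (intro that[of w]) (auto intro: divide_neg_pos)
qed

text \<open>Multiply F = y - mu k * y by m cnj(y), where m = - w^(alpha-1) / mu, and integrate. The
  term with k * y acquires the factor w^(alpha-1) and has nonnegative real part by
  \<open>RL_kernel_sectorial\<close>. Dropping it leaves Re m times the squared norm of y on the
  left. The resulting constant (|m| / Re m)^2 does not depend on T.\<close>

theorem volterra_L2_bound:
  assumes \<alpha>: "0 < \<alpha>" "\<alpha> < 1" and \<mu>: "\<mu> \<noteq> 0" "\<bar>Arg \<mu>\<bar> > \<alpha> * pi / 2"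
  obtains K where "K \<ge> 0" "\<And>y F T. continuous_on UNIV y \<Longrightarrow> continuous_on UNIV F \<Longrightarrow>
      (\<And>t. t \<ge> 0 \<Longrightarrow> y t = F t + \<mu> * conv (RL_kernel \<alpha>) y t) \<Longrightarrow> T \<ge> 0 \<Longrightarrow>
      integral {0..T} (\<lambda>t. (norm (y t))\<^sup>2) \<le> K * integral {0..T} (\<lambda>t. (norm (F t))\<^sup>2)"
proof -
  obtain w where w: "Re w > 0" and Re_m: "Re (- (w powr (complex_of_real \<alpha> - 1)) / \<mu>) > 0"
    using rotation_exists[OF assms] by blast
  define m where "m = - (w powr (complex_of_real \<alpha> - 1)) / \<mu>"
  define c where "c = Re m"
  have c: "c > 0" using Re_m by (simp add: c_def m_def)
  have "integral {0..T} (\<lambda>t. (norm (y t))\<^sup>2) \<le> (norm m / c)\<^sup>2 * integral {0..T} (\<lambda>t. (norm (F t))\<^sup>2)"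
    if y: "continuous_on UNIV y" and F: "continuous_on UNIV F"
      and eq: "\<And>t. t \<ge> 0 \<Longrightarrow> y t = F t + \<mu> * conv (RL_kernel \<alpha>) y t" and T: "T \<ge> 0" for y F T
  proof -
    let ?v = "conv (RL_kernel \<alpha>) y"
    have v: "continuous_on UNIV ?v" by (intro continuous_conv locally_integrable_RL_kernel \<alpha> y)
    have int: "f integrable_on {0..T}" if "continuous_on UNIV f" for f :: "real \<Rightarrow> 'b::banach"
      using that continuous_on_subset by (blast intro: integrable_continuous_interval)
    have i1: "(\<lambda>t. m * (cnj (y t) * y t)) integrable_on {0..T}" and i2: "(\<lambda>t. w powr (complex_of_real \<alpha> - 1) * (cnj (y t) * ?v t)) integrable_on {0..T}"
      by (intro int continuous_intros y v)+
    have 1: "0 \<le> Re (integral {0..T} (\<lambda>t. w powr (complex_of_real \<alpha> - 1) * (cnj (y t) * ?v t)))"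
      using RL_kernel_sectorial[OF \<alpha> w y T] by simp
    have "c * integral {0..T} (\<lambda>t. (norm (y t))\<^sup>2) = Re (integral {0..T} (\<lambda>t. m * (cnj (y t) * y t)))"
    proof -
      have "(\<lambda>t. m * (cnj (y t) * y t)) = (\<lambda>t. m * complex_of_real ((norm (y t))\<^sup>2))"
        by (simp only: complex_norm_square mult.commute)
      then have "Re (integral {0..T} (\<lambda>t. m * (cnj (y t) * y t))) = integral {0..T} (\<lambda>t. Re (m * complex_of_real ((norm (y t))\<^sup>2)))"
        using integral_linear[OF i1 bounded_linear_Re] by (simp add: o_def)
      then show ?thesis by (simp add: c_def)
    qed
    also have "\<dots> \<le> Re (integral {0..T} (\<lambda>t. m * (cnj (y t) * y t)) + integral {0..T} (\<lambda>t. w powr (complex_of_real \<alpha> - 1) * (cnj (y t) * ?v t)))"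
      using 1 by simp
    also have "\<dots> = Re (integral {0..T} (\<lambda>t. m * (cnj (y t) * y t) + w powr (complex_of_real \<alpha> - 1) * (cnj (y t) * ?v t)))"
      using i1 i2 by (simp only: integral_add)
    also have "integral {0..T} (\<lambda>t. m * (cnj (y t) * y t) + w powr (complex_of_real \<alpha> - 1) * (cnj (y t) * ?v t)) = integral {0..T} (\<lambda>t. m * (cnj (y t) * F t))"
    proof (intro integral_cong)
      fix t assume "t \<in> {0..T}"
      then have F_eq: "F t = y t - \<mu> * ?v t" using eq[of t] by simp
      show "m * (cnj (y t) * y t) + w powr (complex_of_real \<alpha> - 1) * (cnj (y t) * ?v t) = m * (cnj (y t) * F t)"
        unfolding F_eq using \<mu>(1) by (simp add: m_def field_simps)
    qed
    also have "Re (integral {0..T} (\<lambda>t. m * (cnj (y t) * F t))) = integral {0..T} (\<lambda>t. Re (m * (cnj (y t) * F t)))"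
    proof -
      have "(\<lambda>t. m * (cnj (y t) * F t)) integrable_on {0..T}" by (intro int continuous_intros y F)
      from integral_linear[OF this bounded_linear_Re] show ?thesis by (simp only: o_def)
    qed
    \<comment> \<open>Young's inequality, weighted so that half of c |y|^2 can be absorbed on the
      left.\<close>
    also have "\<dots> \<le> integral {0..T} (\<lambda>t. c / 2 * (norm (y t))\<^sup>2 + (norm m)\<^sup>2 / (2 * c) * (norm (F t))\<^sup>2)"
    proof (rule integral_le)
      show "(\<lambda>t. Re (m * (cnj (y t) * F t))) integrable_on {0..T}"
        "(\<lambda>t. c / 2 * (norm (y t))\<^sup>2 + (norm m)\<^sup>2 / (2 * c) * (norm (F t))\<^sup>2) integrable_on {0..T}"
        by (intro int continuous_intros y F)+
      fix t
      have "Re (m * (cnj (y t) * F t)) \<le> norm (m * (cnj (y t) * F t))" by (rule complex_Re_le_cmod)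
      also have "\<dots> = norm (y t) * (norm m * norm (F t))" by (simp add: norm_mult)
      also have "\<dots> \<le> c / 2 * (norm (y t))\<^sup>2 + (norm m)\<^sup>2 / (2 * c) * (norm (F t))\<^sup>2"
      proof -
        have "0 \<le> (c * norm (y t) - norm m * norm (F t))\<^sup>2 / (2 * c)" using c by simp
        also have "\<dots> = c / 2 * (norm (y t))\<^sup>2 + (norm m)\<^sup>2 / (2 * c) * (norm (F t))\<^sup>2 - norm (y t) * (norm m * norm (F t))"
          using c by (simp add: power2_eq_square field_simps)
        finally show ?thesis by simp
      qed
      finally show "Re (m * (cnj (y t) * F t)) \<le> c / 2 * (norm (y t))\<^sup>2 + (norm m)\<^sup>2 / (2 * c) * (norm (F t))\<^sup>2" .
    qed
    also have "\<dots> = c / 2 * integral {0..T} (\<lambda>t. (norm (y t))\<^sup>2) + (norm m)\<^sup>2 / (2 * c) * integral {0..T} (\<lambda>t. (norm (F t))\<^sup>2)"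
      by (subst integral_add; (intro int continuous_intros y F)?) simp
    finally have "c / 2 * integral {0..T} (\<lambda>t. (norm (y t))\<^sup>2) \<le> (norm m)\<^sup>2 / (2 * c) * integral {0..T} (\<lambda>t. (norm (F t))\<^sup>2)"
      by linarith
    then have "2 / c * (c / 2 * integral {0..T} (\<lambda>t. (norm (y t))\<^sup>2)) \<le> 2 / c * ((norm m)\<^sup>2 / (2 * c) * integral {0..T} (\<lambda>t. (norm (F t))\<^sup>2))"
      using c by (intro mult_left_mono) auto
    then show ?thesis using c by (simp add: power_divide power2_eq_square)
  qed
  then show ?thesis by (intro that[of "(norm m / c)\<^sup>2"]) auto
qed

section \<open>Decay of the resolvent\<close>

text \<open>The average over \<open>[t - 1, t]\<close> of \<open>s powr (- \<alpha>) / Gamma (1 - \<alpha>)\<close>, whose fractional integral of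
  order \<open>\<alpha>\<close> is \<open>1\<close>. Averaging makes it continuous, and its fractional integral equals \<open>1\<close> from
  \<open>t = 1\<close> on.\<close>

definition ramp_average :: "real \<Rightarrow> real \<Rightarrow> complex" where
  "ramp_average \<alpha> t = complex_of_real ((max 0 t powr (1 - \<alpha>) - max 0 (t - 1) powr (1 - \<alpha>)) / Gamma (2 - \<alpha>))"

lemma continuous_ramp_average:
  assumes "\<alpha> < 1" shows "continuous_on UNIV (ramp_average \<alpha>)"
proof -
  have 1: "continuous_on UNIV (\<lambda>t::real. max 0 t powr (1 - \<alpha>))"
    using assms by (intro continuous_max_powr) auto
  have 2: "continuous_on UNIV (\<lambda>t::real. max 0 (t - 1) powr (1 - \<alpha>))"
    by (rule continuous_on_compose2[OF 1]) (auto intro!: continuous_intros)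
  have "Gamma (2 - \<alpha>) \<noteq> 0" using assms Gamma_real_pos[of "2 - \<alpha>"] less_irrefl by fastforce
  then show ?thesis
    unfolding ramp_average_def[abs_def] by (intro continuous_intros 1 2) auto
qed

lemma conv_RL_kernel_ramp:
  assumes \<alpha>: "0 < \<alpha>" "\<alpha> < 1"
  shows "conv (RL_kernel \<alpha>) (\<lambda>s. complex_of_real (max 0 s powr (1 - \<alpha>))) t = complex_of_real (Gamma (2 - \<alpha>) * max 0 t)"
proof (cases "t > 0")
  case True
  have "conv (RL_kernel \<alpha>) (\<lambda>s. complex_of_real (max 0 s powr (1 - \<alpha>))) t = conv (RL_kernel \<alpha>) (\<lambda>s. complex_of_real (s powr (1 - \<alpha>))) t"
    by (rule conv_cong) auto
  also have "\<dots> = complex_of_real (Gamma (2 - \<alpha>) * max 0 t)"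
    using \<alpha> True by (subst conv_RL_kernel_powr) (auto simp: Gamma_eq_zero_iff fact_numeral Gamma_numeral)
  finally show ?thesis .
qed (simp add: conv_nonpos)

lemma conv_RL_kernel_ramp_shift:
  assumes \<alpha>: "0 < \<alpha>" "\<alpha> < 1"
  shows "conv (RL_kernel \<alpha>) (\<lambda>s. complex_of_real (max 0 (s - 1) powr (1 - \<alpha>))) t = complex_of_real (Gamma (2 - \<alpha>) * max 0 (t - 1))"
proof -
  have "conv (RL_kernel \<alpha>) (\<lambda>s. complex_of_real (max 0 (s - 1) powr (1 - \<alpha>))) t =
    conv (RL_kernel \<alpha>) (\<lambda>s. complex_of_real (max 0 s powr (1 - \<alpha>))) (t - 1)"
    unfolding conv_def set_lebesgue_integral_def
    by (intro Bochner_Integration.integral_cong refl) (auto simp: indicator_def max_def algebra_simps)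
  then show ?thesis by (simp only: conv_RL_kernel_ramp[OF \<alpha>])
qed

lemma conv_RL_kernel_ramp_average:
  assumes \<alpha>: "0 < \<alpha>" "\<alpha> < 1"
  shows "conv (RL_kernel \<alpha>) (ramp_average \<alpha>) t = complex_of_real (max 0 t - max 0 (t - 1))"
proof -
  have G: "Gamma (2 - \<alpha>) \<noteq> 0" using assms Gamma_real_pos[of "2 - \<alpha>"] less_irrefl by fastforce
  have 1: "continuous_on UNIV (\<lambda>t::real. max 0 t powr (1 - \<alpha>))"
    using assms by (intro continuous_max_powr) auto
  have 2: "continuous_on UNIV (\<lambda>t::real. max 0 (t - 1) powr (1 - \<alpha>))"
    by (rule continuous_on_compose2[OF 1]) (auto intro!: continuous_intros)
  have "conv (RL_kernel \<alpha>) (ramp_average \<alpha>) t = conv (RL_kernel \<alpha>) (\<lambda>t. complex_of_real (1 / Gamma (2 - \<alpha>)) * complex_of_real (max 0 t powr (1 - \<alpha>)) +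
      complex_of_real (- 1 / Gamma (2 - \<alpha>)) * complex_of_real (max 0 (t - 1) powr (1 - \<alpha>))) t"
    by (rule conv_cong) (simp_all add: ramp_average_def diff_divide_distrib)
  also have "\<dots> = complex_of_real (1 / Gamma (2 - \<alpha>)) * complex_of_real (Gamma (2 - \<alpha>) * max 0 t) +
      complex_of_real (- 1 / Gamma (2 - \<alpha>)) * complex_of_real (Gamma (2 - \<alpha>) * max 0 (t - 1))"
    by (subst conv_add_right; (intro locally_integrable_RL_kernel continuous_intros 1 2 \<alpha>)?)
       (simp only: conv_mult_right conv_RL_kernel_ramp[OF \<alpha>] conv_RL_kernel_ramp_shift[OF \<alpha>])
  also have "\<dots> = complex_of_real (max 0 t - max 0 (t - 1))"
    using G by simp
  finally show ?thesis .
qed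

text \<open>For t \<le> 1 the difference is t^(1-alpha) \<le> 1 \<le> t^(-alpha). For t > 1 factor
  out t^(1-alpha) and use (1 - 1/t)^(1-alpha) \<ge> 1 - 1/t.\<close>

lemma norm_ramp_average_le:
  assumes \<alpha>: "0 < \<alpha>" "\<alpha> < 1" and t: "t > 0"
  shows "norm (ramp_average \<alpha> t) \<le> 1 / Gamma (2 - \<alpha>) * min 1 (t powr (- \<alpha>))"
proof -
  have G: "Gamma (2 - \<alpha>) > 0" using assms by (intro Gamma_real_pos) auto
  have "0 \<le> max 0 t powr (1 - \<alpha>) - max 0 (t - 1) powr (1 - \<alpha>) \<and>
     max 0 t powr (1 - \<alpha>) - max 0 (t - 1) powr (1 - \<alpha>) \<le> min 1 (t powr (- \<alpha>))"
  proof (cases "t \<le> 1")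
    case True
    have "t powr (1 - \<alpha>) \<le> 1" using True t \<alpha> by (intro powr_le1) auto
    moreover have "1 \<le> t powr (- \<alpha>)"
      using powr_mono_both'[of "\<alpha>" \<alpha> t 1] powr_le1[of \<alpha> t] True t \<alpha> by (simp add: powr_minus one_le_inverse_iff)
    ultimately show ?thesis using True t by auto
  next
    case False
    then have t1: "t > 1" by simp
    have "(t - 1) powr (1 - \<alpha>) \<le> t powr (1 - \<alpha>)" using t1 \<alpha> by (intro powr_mono2) auto
    moreover have "t powr (1 - \<alpha>) - t powr (- \<alpha>) \<le> (t - 1) powr (1 - \<alpha>)"
    proof -
      have p: "0 < 1 - 1 / t" "1 - 1 / t < 1" using t1 by auto
      have "(1 - 1 / t) powr 1 \<le> (1 - 1 / t) powr (1 - \<alpha>)" using p \<alpha> by (intro powr_mono') auto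
      then have "t powr (1 - \<alpha>) * (1 - 1 / t) \<le> t powr (1 - \<alpha>) * (1 - 1 / t) powr (1 - \<alpha>)"
        using p by (intro mult_left_mono) auto
      also have "\<dots> = (t * (1 - 1 / t)) powr (1 - \<alpha>)" using p t1 by (subst powr_mult) auto
      also have "t * (1 - 1 / t) = t - 1" using t1 by (simp add: field_simps)
      also have "t powr (1 - \<alpha>) * (1 - 1 / t) = t powr (1 - \<alpha>) - t powr (- \<alpha>)"
        using t1 by (simp add: powr_diff powr_minus field_simps)
      finally show ?thesis .
    qed
    moreover have "t powr (- \<alpha>) \<le> 1" using t1 \<alpha> by (simp add: powr_minus ge_one_powr_ge_zero inverse_le_1_iff)
    ultimately show ?thesis using t1 by auto
  qed
  then show ?thesis
    using G by (simp add: ramp_average_def divide_right_mono del: of_real_diff of_real_divide)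
qed

text \<open>One factor of the square is bounded by B, the other by B t^(-alpha). Since t^(-alpha) is
  integrable at 0 for every alpha < 1, unlike t^(-2 alpha), no distinction at alpha = 1/2
  arises.\<close>

lemma integral_norm_sq_bound:
  assumes F: "continuous_on UNIV F" and B: "B \<ge> 0" "\<And>t. t > 0 \<Longrightarrow> norm (F t) \<le> B * min 1 (t powr (- \<alpha>))"
    and \<alpha>: "0 < \<alpha>" "\<alpha> < 1" and T: "T \<ge> 0"
  shows "integral {0..T} (\<lambda>t. (norm (F t :: complex))\<^sup>2) \<le> B\<^sup>2 / (1 - \<alpha>) * T powr (1 - \<alpha>)"
proof -
  have hi: "((\<lambda>x. B\<^sup>2 * x powr (- \<alpha>)) has_integral B\<^sup>2 * (T powr (- \<alpha> + 1) / (- \<alpha> + 1))) {0..T}"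
    using \<alpha> T by (intro has_integral_mult_right has_integral_powr_from_0) auto
  have le: "(norm (F t))\<^sup>2 \<le> B\<^sup>2 * t powr (- \<alpha>)" if "t > 0" for t
  proof -
    have "norm (F t) * norm (F t) \<le> (B * 1) * (B * t powr (- \<alpha>))"
      using B that by (intro mult_mono order_trans[OF B(2)] mult_left_mono) auto
    then show ?thesis by (simp add: power2_eq_square)
  qed
  have Fi: "((\<lambda>t. (norm (F t))\<^sup>2) has_integral integral {0..T} (\<lambda>t. (norm (F t))\<^sup>2)) {0..T}"
    by (intro integrable_integral integrable_continuous_interval continuous_intros continuous_on_subset[OF F]) auto
  \<comment> \<open>The majorant vanishes at 0 because \<open>0 powr (- \<alpha>) = 0\<close>, so
    the integrand is changed to 0 at that point.\<close>
  have "integral {0..T} (\<lambda>t. (norm (F t))\<^sup>2) \<le> B\<^sup>2 * (T powr (- \<alpha> + 1) / (- \<alpha> + 1))"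
    by (rule has_integral_le[OF has_integral_spike_finite[of "{0}" _ "\<lambda>t. if t = 0 then 0 else (norm (F t))\<^sup>2", OF _ _ Fi, rotated] hi])
       (use le in auto)
  then show ?thesis by simp
qed

lemma integral_norm_sq_add_le:
  fixes T :: real
  assumes "continuous_on UNIV u" "continuous_on UNIV v"
  shows "integral {0..T} (\<lambda>t. (norm (u t + v t :: complex))\<^sup>2) \<le>
    2 * integral {0..T} (\<lambda>t. (norm (u t))\<^sup>2) + 2 * integral {0..T} (\<lambda>t. (norm (v t))\<^sup>2)"
proof -
  have int: "f integrable_on {0..T}" if "continuous_on UNIV f" for f :: "real \<Rightarrow> real"
    using that continuous_on_subset by (blast intro: integrable_continuous_interval)
  have "integral {0..T} (\<lambda>t. (norm (u t + v t))\<^sup>2) \<le> integral {0..T} (\<lambda>t. 2 * (norm (u t))\<^sup>2 + 2 * (norm (v t))\<^sup>2)"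
  proof (rule integral_le)
    fix t
    have "(norm (u t + v t))\<^sup>2 \<le> (norm (u t) + norm (v t))\<^sup>2" by (intro power_mono norm_triangle_ineq) auto
    also have "\<dots> \<le> 2 * (norm (u t))\<^sup>2 + 2 * (norm (v t))\<^sup>2"
      using sum_squares_bound[of "norm (u t)" "norm (v t)"] by (simp add: power2_sum)
    finally show "(norm (u t + v t))\<^sup>2 \<le> 2 * (norm (u t))\<^sup>2 + 2 * (norm (v t))\<^sup>2" .
  qed (intro int continuous_intros assms)+
  also have "\<dots> = 2 * integral {0..T} (\<lambda>t. (norm (u t))\<^sup>2) + 2 * integral {0..T} (\<lambda>t. (norm (v t))\<^sup>2)"
    by (subst integral_add; (intro int continuous_intros assms)?) simp
  finally show ?thesis .
qed

lemma L2_growth: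
  assumes \<alpha>: "0 < \<alpha>" "\<alpha> < 1" and \<mu>: "\<mu> \<noteq> 0" "\<bar>Arg \<mu>\<bar> > \<alpha> * pi / 2"
  obtains C where "C \<ge> 0"
    "\<And>T. T \<ge> 0 \<Longrightarrow> integral {0..T} (\<lambda>t. (norm (ml_solution \<alpha> \<mu> t))\<^sup>2) \<le> C * T powr (1 - \<alpha>)"
    "\<And>T. T \<ge> 0 \<Longrightarrow> integral {0..T} (\<lambda>t. (norm (ml_euler \<alpha> \<mu> t))\<^sup>2) \<le> C * T powr (1 - \<alpha>)"
proof -
  let ?k = "RL_kernel \<alpha>" and ?e = "ml_solution \<alpha> \<mu>" and ?n = "ml_euler \<alpha> \<mu>" and ?h = "ramp_average \<alpha>"
  note e = continuous_ml_solution[OF \<alpha>(1), of \<mu>] and n = continuous_ml_euler[OF \<alpha>(1), of \<mu>]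
    and h = continuous_ramp_average[OF \<alpha>(2)] and k = locally_integrable_RL_kernel[OF \<alpha>(1)]
  obtain K where K: "K \<ge> 0" and bound: "\<And>y F T. continuous_on UNIV y \<Longrightarrow> continuous_on UNIV F \<Longrightarrow>
      (\<And>t. t \<ge> 0 \<Longrightarrow> y t = F t + \<mu> * conv ?k y t) \<Longrightarrow> T \<ge> 0 \<Longrightarrow>
      integral {0..T} (\<lambda>t. (norm (y t))\<^sup>2) \<le> K * integral {0..T} (\<lambda>t. (norm (F t))\<^sup>2)"
    using volterra_L2_bound[OF \<alpha> \<mu>] by metis
  have G: "Gamma (2 - \<alpha>) > 0" using \<alpha> by (intro Gamma_real_pos) auto
  \<comment> \<open>From e = 1 + mu k * e one gets y - mu k * y = 1 - k * h + h/mu, which is F. The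
    part 1 - k * h vanishes for t \<ge> 1, so F inherits the decay of h.\<close>
  define y where "y t = ?e t + ?h t / \<mu>" for t
  define F where "F t = complex_of_real (1 - (max 0 t - max 0 (t - 1))) + ?h t / \<mu>" for t
  have y: "continuous_on UNIV y" unfolding y_def by (intro continuous_intros e h) (use \<mu> in auto)
  have F: "continuous_on UNIV F" unfolding F_def by (intro continuous_intros h) (use \<mu> in auto)
  have y_eq: "y t = F t + \<mu> * conv ?k y t" if "t \<ge> 0" for t
  proof -
    have "conv ?k y t = conv ?k ?e t + (1 / \<mu>) * conv ?k ?h t"
    proof -
      have "conv ?k y t = conv ?k (\<lambda>t. ?e t + (1 / \<mu>) * ?h t) t" by (simp add: y_def[abs_def])
      also have "\<dots> = conv ?k ?e t + (1 / \<mu>) * conv ?k ?h t"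
        by (subst conv_add_right; (intro k e h continuous_intros)?) (simp only: conv_mult_right)
      finally show ?thesis .
    qed
    then show ?thesis
      using ml_solution_eq[OF \<alpha>(1) that, of \<mu>] \<mu>(1)
      by (simp add: y_def F_def conv_RL_kernel_ramp_average[OF \<alpha>] ring_distribs)
  qed
  define b where "b = 1 / Gamma (2 - \<alpha>) / norm \<mu>"
  have b: "b \<ge> 0" using G by (simp add: b_def)
  have h_le: "norm (?h t / \<mu>) \<le> b * min 1 (t powr (- \<alpha>))" if "t > 0" for t
    using divide_right_mono[OF norm_ramp_average_le[OF \<alpha> that], of "norm \<mu>"] by (simp add: b_def norm_divide)
  have F_le: "norm (F t) \<le> (1 + b) * min 1 (t powr (- \<alpha>))" if t: "t > 0" for t
  proof -
    have "norm (complex_of_real (1 - (max 0 t - max 0 (t - 1)))) \<le> min 1 (t powr (- \<alpha>))"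
    proof (cases "t \<le> 1")
      case True
      then have "1 \<le> t powr (- \<alpha>)"
        using powr_le1[of \<alpha> t] t \<alpha> by (simp add: powr_minus one_le_inverse_iff)
      then show ?thesis using True t by (simp del: of_real_diff)
    qed (simp del: of_real_diff)
    then have "norm (F t) \<le> min 1 (t powr (- \<alpha>)) + b * min 1 (t powr (- \<alpha>))"
      unfolding F_def using h_le[OF t] by (intro norm_triangle_le add_mono)
    then show ?thesis by (simp add: ring_distribs)
  qed
  define D where "D = 1 / (1 - \<alpha>)"
  define A where "A = 2 * (K * ((1 + b)\<^sup>2 * D)) + 2 * (b\<^sup>2 * D)"
  have D: "D \<ge> 0" using \<alpha> by (simp add: D_def)
  have A: "A \<ge> 0" using K D by (auto simp: A_def intro!: add_nonneg_nonneg mult_nonneg_nonneg)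
  have e_bound: "integral {0..T} (\<lambda>t. (norm (?e t))\<^sup>2) \<le> A * T powr (1 - \<alpha>)" if T: "T \<ge> 0" for T
  proof -
    have mh: "continuous_on UNIV (\<lambda>t. - (?h t / \<mu>))" by (intro continuous_intros h) (use \<mu> in auto)
    have "integral {0..T} (\<lambda>t. (norm (?e t))\<^sup>2) = integral {0..T} (\<lambda>t. (norm (y t + - (?h t / \<mu>)))\<^sup>2)"
      by (simp add: y_def)
    also have "\<dots> \<le> 2 * integral {0..T} (\<lambda>t. (norm (y t))\<^sup>2) + 2 * integral {0..T} (\<lambda>t. (norm (- (?h t / \<mu>)))\<^sup>2)"
      by (rule integral_norm_sq_add_le[OF y mh])
    also have "integral {0..T} (\<lambda>t. (norm (y t))\<^sup>2) \<le> K * integral {0..T} (\<lambda>t. (norm (F t))\<^sup>2)"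
      by (rule bound[OF y F y_eq T])
    also have "K * integral {0..T} (\<lambda>t. (norm (F t))\<^sup>2) \<le> K * ((1 + b)\<^sup>2 / (1 - \<alpha>) * T powr (1 - \<alpha>))"
      using b F_le K by (intro mult_left_mono integral_norm_sq_bound[OF F _ _ \<alpha> T]) auto
    also have "integral {0..T} (\<lambda>t. (norm (- (?h t / \<mu>)))\<^sup>2) \<le> b\<^sup>2 / (1 - \<alpha>) * T powr (1 - \<alpha>)"
      using b h_le by (intro integral_norm_sq_bound[OF mh _ _ \<alpha> T]) auto
    finally show ?thesis by (simp add: A_def D_def algebra_simps)
  qed
  \<comment> \<open>\<open>ml_euler_eq\<close> says that e + n = e + mu k * (e + n) for n =
    \<open>ml_euler\<close>, so \<open>bound\<close> applies once more, now with F = e.\<close>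
  have n_bound: "integral {0..T} (\<lambda>t. (norm (?n t))\<^sup>2) \<le> (2 * (K * A) + 2 * A) * T powr (1 - \<alpha>)" if T: "T \<ge> 0" for T
  proof -
    have X: "continuous_on UNIV (\<lambda>t. ?e t + ?n t)" and me: "continuous_on UNIV (\<lambda>t. - ?e t)"
      by (intro continuous_intros e n)+
    have "integral {0..T} (\<lambda>t. (norm (?n t))\<^sup>2) = integral {0..T} (\<lambda>t. (norm ((?e t + ?n t) + - ?e t))\<^sup>2)" by simp
    also have "\<dots> \<le> 2 * integral {0..T} (\<lambda>t. (norm (?e t + ?n t))\<^sup>2) + 2 * integral {0..T} (\<lambda>t. (norm (- ?e t))\<^sup>2)"
      by (rule integral_norm_sq_add_le[OF X me])
    also have "integral {0..T} (\<lambda>t. (norm (?e t + ?n t))\<^sup>2) \<le> K * integral {0..T} (\<lambda>t. (norm (?e t))\<^sup>2)"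
      by (rule bound[OF X e _ T]) (simp add: ml_euler_eq[OF \<alpha>(1), symmetric])
    also have "K * integral {0..T} (\<lambda>t. (norm (?e t))\<^sup>2) \<le> K * (A * T powr (1 - \<alpha>))"
      using e_bound[OF T] K by (rule mult_left_mono)
    also have "integral {0..T} (\<lambda>t. (norm (- ?e t))\<^sup>2) \<le> A * T powr (1 - \<alpha>)"
      using e_bound[OF T] by simp
    finally show ?thesis by (simp add: algebra_simps)
  qed
  have "A * T powr (1 - \<alpha>) \<le> (2 * (K * A) + 2 * A) * T powr (1 - \<alpha>)" for T
    using K A by (intro mult_right_mono) auto
  then show ?thesis
    using K A e_bound n_bound by (intro that[of "2 * (K * A) + 2 * A"]) (auto intro: order_trans)
qed

section \<open>The case alpha = 1\<close>

lemma Re_neg_if_Arg_gt: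
  assumes "\<bar>Arg \<mu>\<bar> > pi / 2" shows "Re \<mu> < 0"
proof -
  have nz: "\<mu> \<noteq> 0" using assms by (auto simp: Arg_zero)
  have "\<bar>Arg \<mu>\<bar> \<le> pi" using Arg_bounded[of \<mu>] by (auto simp: abs_le_iff)
  then have "sin (\<bar>Arg \<mu>\<bar> - pi / 2) > 0" using assms by (intro sin_gt_zero) auto
  then have "cos (Arg \<mu>) < 0" by (simp add: sin_diff)
  moreover have "Re \<mu> = norm \<mu> * cos (Arg \<mu>)"
    using arg_cong[OF Arg_eq[OF nz], of Re] by (simp add: Re_exp)
  ultimately show ?thesis using nz by (simp add: mult_pos_neg)
qed

lemma mittag_leffler_1: "mittag_leffler 1 = exp" "mittag_leffler_deriv 1 = exp"
proof -
  have "mittag_leffler_coeff 1 n = inverse (fact n)" for n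
    using Gamma_fact[of n, where 'a = real] by (simp add: mittag_leffler_coeff_def divide_inverse add.commute)
  then show 1: "mittag_leffler 1 = exp"
    by (auto simp: mittag_leffler_def exp_def scaleR_conv_of_real fun_eq_iff)
  show "mittag_leffler_deriv 1 = exp"
  proof
    fix z
    show "mittag_leffler_deriv 1 z = exp z"
      using DERIV_mittag_leffler[of 1 z] unfolding 1 by (intro DERIV_unique[OF _ DERIV_exp]) auto
  qed
qed

lemma ml_resolvent_L1_ode:
  assumes "Re \<mu> < 0"
  shows "set_integrable lborel {0..} (ml_resolvent 1 \<mu>)" "(ml_solution 1 \<mu> \<longlongrightarrow> 0) at_top"
proof -
  have "set_integrable lborel {0..} (\<lambda>u. complex_of_real (u powr (1 - 1)) * exp (- (- \<mu> * complex_of_real u)))"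
    using assms by (intro set_integrable_powr_exp_complex) auto
  then show "set_integrable lborel {0..} (ml_resolvent 1 \<mu>)"
    by (rule set_integrable_cong[THEN iffD1, rotated -1]) (auto simp: ml_resolvent_def mittag_leffler_1)
  have "((\<lambda>t. exp (Re \<mu> * t)) \<longlongrightarrow> 0) at_top"
    using assms by real_asymp
  moreover have "eventually (\<lambda>t. norm (ml_solution 1 \<mu> t) = exp (Re \<mu> * t)) at_top"
    using eventually_ge_at_top[of 0] by eventually_elim (simp add: ml_solution_def mittag_leffler_1)
  ultimately have "((\<lambda>t. norm (ml_solution 1 \<mu> t)) \<longlongrightarrow> 0) at_top"
    by (simp cong: filterlim_cong)
  then show "(ml_solution 1 \<mu> \<longlongrightarrow> 0) at_top" by (rule tendsto_norm_zero_cancel)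
qed

section \<open>Integrability of the resolvent and decay of e\<close>

lemma ml_resolvent_L1_fractional:
  assumes \<alpha>: "0 < \<alpha>" "\<alpha> < 1" and \<mu>: "\<mu> \<noteq> 0" "\<bar>Arg \<mu>\<bar> > \<alpha> * pi / 2"
  shows "set_integrable lborel {0..} (ml_resolvent \<alpha> \<mu>)"
proof -
  let ?r = "ml_resolvent \<alpha> \<mu>" and ?n = "ml_euler \<alpha> \<mu>"
  obtain C where C: "C \<ge> 0" and n_bound: "\<And>T. T \<ge> 0 \<Longrightarrow> integral {0..T} (\<lambda>t. (norm (?n t))\<^sup>2) \<le> C * T powr (1 - \<alpha>)"
    using L2_growth[OF assms] by metis
  have n: "continuous_on UNIV ?n" using \<alpha>(1) by (rule continuous_ml_euler)
  have r: "locally_integrable ?r" using \<alpha>(1) by (rule locally_integrable_ml_resolvent)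
  then have [measurable]: "?r \<in> borel_measurable borel" by (simp add: locally_integrable_def)
  have si: "set_integrable lborel {0..T} (\<lambda>t. norm (?r t))" for T
    using r set_integrable_norm by (auto simp: locally_integrable_def)
  have io: "(\<lambda>t. norm (?r t)) integrable_on {0..T}" for T
    by (rule set_borel_integral_eq_integral(1)[OF si])
  define J where "J m = integral {0..2 ^ m} (\<lambda>t. norm (?r t))" for m :: nat
  \<comment> \<open>Chosen so that q^m is (2^m)^(-alpha/2), the decay rate of the integral of |r|
    over the m-th dyadic interval.\<close>
  define q where "q = 2 powr (- (\<alpha> / 2))"
  have q: "0 < q" "q < 1" using \<alpha> by (auto simp: q_def powr_less_one)
  define D where "D = \<alpha> / norm \<mu> * (1 + C * 2 powr (1 - \<alpha>)) / 2"
  have D: "D \<ge> 0" using \<alpha> C by (simp add: D_def)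
  have r_eq: "norm (?r t) = \<alpha> / norm \<mu> * (norm (?n t) / t)" if "t > 0" for t
  proof -
    have "norm (complex_of_real \<alpha> * ?n t) = norm (\<mu> * complex_of_real t * ?r t)"
      using ml_euler_resolvent[OF \<alpha>(1) that, of \<mu>] by simp
    then show ?thesis using that \<alpha> \<mu>(1) by (simp add: norm_mult field_simps)
  qed
  have step: "J (Suc m) \<le> J m + D * q ^ m" for m
  proof -
    define a :: real where "a = 2 ^ m"
    have a: "a > 0" by (simp add: a_def)
    \<comment> \<open>Since \<kappa>^2 = a^(-alpha) is the order of the bound for the mean of |n|^2
      on [a, 2a], the inequality |n| \<le> (\<kappa> + |n|^2 / \<kappa>) / 2 replaces
      Cauchy-Schwarz: both terms integrate to at most a multiple of a \<kappa>, and the factor 1/t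
      \<le> 1/a cancels a.\<close>
    define \<kappa> where "\<kappa> = q ^ m"
    have \<kappa>: "\<kappa> > 0" using q by (simp add: \<kappa>_def)
    have \<kappa>_a: "a powr (- \<alpha>) = \<kappa> * \<kappa>"
      by (simp add: \<kappa>_def a_def q_def powr_powr mult.commute flip: powr_realpow powr_add)
    have nI: "(\<lambda>t. (norm (?n t))\<^sup>2) integrable_on {u..v}" for u v
      by (intro integrable_continuous_interval continuous_intros continuous_on_subset[OF n]) auto
    have "J (Suc m) = J m + integral {a..2 * a} (\<lambda>t. norm (?r t))"
      unfolding J_def a_def using io by (subst Henstock_Kurzweil_Integration.integral_combine) auto
    also have "integral {a..2 * a} (\<lambda>t. norm (?r t)) \<le> integral {a..2 * a} (\<lambda>t. \<alpha> / norm \<mu> / a / 2 * (\<kappa> + (norm (?n t))\<^sup>2 / \<kappa>))"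
    proof (rule integral_le)
      show "(\<lambda>t. norm (?r t)) integrable_on {a..2 * a}"
        using integrable_on_subinterval[OF io[of "2 * a"]] a by auto
      show "(\<lambda>t. \<alpha> / norm \<mu> / a / 2 * (\<kappa> + (norm (?n t))\<^sup>2 / \<kappa>)) integrable_on {a..2 * a}"
        using \<kappa> by (intro integrable_continuous_interval continuous_intros continuous_on_subset[OF n]) auto
      fix t assume t: "t \<in> {a..2 * a}"
      have "0 \<le> (\<kappa> - norm (?n t))\<^sup>2 / (2 * \<kappa>)" using \<kappa> by simp
      also have "\<dots> = (\<kappa> + (norm (?n t))\<^sup>2 / \<kappa>) / 2 - norm (?n t)"
        using \<kappa> by (simp add: power2_eq_square field_simps)
      finally have 1: "norm (?n t) \<le> (\<kappa> + (norm (?n t))\<^sup>2 / \<kappa>) / 2" by simp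
      have "norm (?n t) / t \<le> norm (?n t) / a" using t a by (intro divide_left_mono) auto
      also have "\<dots> \<le> (\<kappa> + (norm (?n t))\<^sup>2 / \<kappa>) / 2 / a" using 1 a by (intro divide_right_mono) auto
      finally have "\<alpha> / norm \<mu> * (norm (?n t) / t) \<le> \<alpha> / norm \<mu> * ((\<kappa> + (norm (?n t))\<^sup>2 / \<kappa>) / 2 / a)"
        using \<alpha> by (intro mult_left_mono) auto
      then show "norm (?r t) \<le> \<alpha> / norm \<mu> / a / 2 * (\<kappa> + (norm (?n t))\<^sup>2 / \<kappa>)"
        using r_eq[of t] t a by (simp add: mult.assoc mult.commute[of 2])
    qed
    also have "\<dots> = \<alpha> / norm \<mu> / a / 2 * (a * \<kappa> + integral {a..2 * a} (\<lambda>t. (norm (?n t))\<^sup>2) / \<kappa>)"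
    proof -
      have "integral {a..2 * a} (\<lambda>t. \<kappa> + (norm (?n t))\<^sup>2 / \<kappa>) = integral {a..2 * a} (\<lambda>t. \<kappa>) + integral {a..2 * a} (\<lambda>t. (norm (?n t))\<^sup>2 / \<kappa>)"
        using \<kappa> by (intro integral_add integrable_continuous_interval continuous_intros continuous_on_subset[OF n]) auto
      then show ?thesis using a by simp
    qed
    also have "\<dots> \<le> \<alpha> / norm \<mu> / a / 2 * (a * \<kappa> + C * (2 * a) powr (1 - \<alpha>) / \<kappa>)"
    proof -
      have "integral {a..2 * a} (\<lambda>t. (norm (?n t))\<^sup>2) \<le> integral {0..2 * a} (\<lambda>t. (norm (?n t))\<^sup>2)"
        using a by (intro integral_subset_le nI) auto
      also have "\<dots> \<le> C * (2 * a) powr (1 - \<alpha>)" using n_bound[of "2 * a"] a by simp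
      finally show ?thesis using a \<alpha> \<kappa> by (intro mult_left_mono add_left_mono divide_right_mono) auto
    qed
    also have "(2 * a) powr (1 - \<alpha>) = 2 powr (1 - \<alpha>) * (a * (\<kappa> * \<kappa>))"
      using a by (simp add: powr_mult \<kappa>_a[symmetric] powr_diff powr_minus field_simps)
    also have "\<alpha> / norm \<mu> / a / 2 * (a * \<kappa> + C * (2 powr (1 - \<alpha>) * (a * (\<kappa> * \<kappa>))) / \<kappa>) = D * \<kappa>"
    proof -
      have "a * \<kappa> + C * (2 powr (1 - \<alpha>) * (a * (\<kappa> * \<kappa>))) / \<kappa> = a * (\<kappa> * (1 + C * 2 powr (1 - \<alpha>)))"
        using \<kappa> by (simp add: algebra_simps)
      then show ?thesis using a by (simp add: D_def)
    qed
    finally show ?thesis by (simp add: \<kappa>_def)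
  qed
  have J_le: "J m \<le> J 0 + D / (1 - q)" for m
  proof -
    have "J m \<le> J 0 + D * (\<Sum>i<m. q ^ i)"
    proof (induction m)
      case (Suc m)
      then show ?case using step[of m] by (simp add: ring_distribs)
    qed simp
    also have "(\<Sum>i<m. q ^ i) \<le> 1 / (1 - q)"
      using q sum_le_suminf[of "\<lambda>i. q ^ i" "{..<m}"] by (simp add: suminf_geometric summable_geometric)
    finally show ?thesis using D by (simp add: mult_left_mono)
  qed
  have J_eq: "J m = (\<integral>t. norm (?r t) * indicator {0..2 ^ m} t \<partial>lborel)" for m
    using set_borel_integral_eq_integral(2)[OF si[of "2 ^ m"]] by (simp add: J_def set_lebesgue_integral_def mult.commute)
  \<comment> \<open>Bounded increasing integrals over [0, 2^m] give integrability on the half-line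
    by monotone convergence.\<close>
  have "incseq J"
    unfolding J_def incseq_def by (intro allI impI integral_subset_le io) simp_all
  then obtain L where L: "J \<longlonglongrightarrow> L" using J_le by (auto elim!: incseq_convergent)
  have "integrable lborel (\<lambda>t. norm (indicator {0..} t *\<^sub>R ?r t))"
  proof (rule integrable_monotone_convergence[where f = "\<lambda>m t. norm (?r t) * indicator {0..2 ^ m} t"])
    show "integrable lborel (\<lambda>t. norm (?r t) * indicator {0..2 ^ m} t)" for m
      using si[of "2 ^ m"] by (simp add: set_integrable_def mult.commute)
    show "AE t in lborel. mono (\<lambda>m. norm (?r t) * indicator {0..2 ^ m} t)"
    proof (intro AE_I2 monoI mult_left_mono)
      fix t :: real and m m' :: nat assume "m \<le> m'"
      then show "indicator {0..2 ^ m} t \<le> (indicator {0..2 ^ m'} t :: real)"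
        by (auto simp: indicator_def intro: order_trans[OF _ power_increasing])
    qed auto
    show "AE t in lborel. (\<lambda>m. norm (?r t) * indicator {0..2 ^ m} t) \<longlonglongrightarrow> norm (indicator {0..} t *\<^sub>R ?r t)"
    proof (intro AE_I2 tendsto_eventually)
      fix t :: real
      obtain m0 where m0: "t < 2 ^ m0" using real_arch_pow[of 2 t] by auto
      show "eventually (\<lambda>m. norm (?r t) * indicator {0..2 ^ m} t = norm (indicator {0..} t *\<^sub>R ?r t)) sequentially"
        using eventually_ge_at_top[of m0]
      proof eventually_elim
        fix m assume "m0 \<le> m"
        then have "(2::real) ^ m0 \<le> 2 ^ m" by simp
        then have "t \<le> 2 ^ m" using m0 by linarith
        then show "norm (?r t) * indicator {0..2 ^ m} t = norm (indicator {0..} t *\<^sub>R ?r t)"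
          by (auto simp: indicator_def)
      qed
    qed
    show "(\<lambda>m. \<integral>t. norm (?r t) * indicator {0..2 ^ m} t \<partial>lborel) \<longlonglongrightarrow> L"
      using L by (simp add: J_eq[abs_def])
  qed auto
  then show ?thesis
    unfolding set_integrable_def by (subst (asm) integrable_norm_iff) auto
qed

text \<open>Integrability of r gives e = 1 + mu \<integral> r a limit l. If l were nonzero, the
  integral of |e|^2 over [0, T] would grow linearly, against the bound T^(1-alpha) up to a constant
  from \<open>L2_growth\<close>.\<close>

lemma ml_solution_decay_fractional:
  assumes \<alpha>: "0 < \<alpha>" "\<alpha> < 1" and \<mu>: "\<mu> \<noteq> 0" "\<bar>Arg \<mu>\<bar> > \<alpha> * pi / 2"
  shows "(ml_solution \<alpha> \<mu> \<longlongrightarrow> 0) at_top"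
proof -
  let ?r = "ml_resolvent \<alpha> \<mu>" and ?e = "ml_solution \<alpha> \<mu>"
  have e: "continuous_on UNIV ?e" using \<alpha>(1) by (rule continuous_ml_solution)
  define l where "l = 1 + \<mu> * (LBINT u:{0..}. ?r u)"
  have "((\<lambda>t. 1 + \<mu> * (LBINT u:{0..t}. ?r u)) \<longlongrightarrow> l) at_top"
    unfolding l_def
    by (intro tendsto_intros tendsto_set_lebesgue_integral_at_top ml_resolvent_L1_fractional assms) auto
  moreover have "eventually (\<lambda>t. 1 + \<mu> * (LBINT u:{0..t}. ?r u) = ?e t) at_top"
    using eventually_ge_at_top[of 0] by eventually_elim (simp add: integral_ml_resolvent[OF \<alpha>(1)])
  ultimately have lim: "(?e \<longlongrightarrow> l) at_top"
    by (simp cong: filterlim_cong)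
  have "l = 0"
  proof (rule ccontr)
    assume "l \<noteq> 0"
    define c where "c = (norm l / 2)\<^sup>2"
    have c: "c > 0" using \<open>l \<noteq> 0\<close> by (simp add: c_def)
    obtain C where C: "\<And>T. T \<ge> 0 \<Longrightarrow> integral {0..T} (\<lambda>t. (norm (?e t))\<^sup>2) \<le> C * T powr (1 - \<alpha>)"
      using L2_growth[OF assms] by metis
    have "eventually (\<lambda>t. norm (?e t) > norm l / 2) at_top"
      using order_tendstoD(1)[OF tendsto_norm[OF lim], of "norm l / 2"] \<open>l \<noteq> 0\<close> by simp
    then obtain T' where T': "\<And>t. t \<ge> T' \<Longrightarrow> norm (?e t) > norm l / 2" by (auto simp: eventually_at_top_linorder)
    define T0 where "T0 = max 0 T'"
    have T0: "T0 \<ge> 0" "\<And>t. t \<ge> T0 \<Longrightarrow> norm (?e t) > norm l / 2" using T' by (auto simp: T0_def)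
    have key: "c * (T - T0) \<le> C * T powr (1 - \<alpha>)" if T: "T \<ge> T0" for T
    proof -
      have eI: "(\<lambda>t. (norm (?e t))\<^sup>2) integrable_on {u..v}" for u v
        by (intro integrable_continuous_interval continuous_intros continuous_on_subset[OF e]) auto
      have "c * (T - T0) = integral {T0..T} (\<lambda>_. c)" using T by simp
      also have "\<dots> \<le> integral {T0..T} (\<lambda>t. (norm (?e t))\<^sup>2)"
      proof (rule integral_le)
        fix t assume "t \<in> {T0..T}"
        then show "c \<le> (norm (?e t))\<^sup>2" unfolding c_def using T0(2)[of t] by (intro power_mono) auto
      qed (auto intro: eI)
      also have "\<dots> \<le> integral {0..T} (\<lambda>t. (norm (?e t))\<^sup>2)" using T0(1) by (intro integral_subset_le eI) auto
      also have "\<dots> \<le> C * T powr (1 - \<alpha>)" using C[of T] T T0 by simp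
      finally show ?thesis .
    qed
    have "((\<lambda>T. c * (1 - T0 / T)) \<longlongrightarrow> c) at_top" by real_asymp
    moreover have "((\<lambda>T. C * T powr (- \<alpha>)) \<longlongrightarrow> 0) at_top" using \<alpha> by real_asymp
    moreover have "eventually (\<lambda>T. c * (1 - T0 / T) \<le> C * T powr (- \<alpha>)) at_top"
      using eventually_ge_at_top[of T0] eventually_gt_at_top[of 0]
    proof eventually_elim
      fix T assume T: "T \<ge> T0" "T > 0"
      have "c * (T - T0) / T \<le> C * T powr (1 - \<alpha>) / T" using key[OF T(1)] T by (intro divide_right_mono) auto
      then show "c * (1 - T0 / T) \<le> C * T powr (- \<alpha>)"
        using T by (simp add: powr_diff powr_minus field_simps)
    qed
    ultimately have "c \<le> 0"
      by (intro tendsto_le[of at_top "\<lambda>T. C * T powr (- \<alpha>)" 0 "\<lambda>T. c * (1 - T0 / T)" c]) auto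
    then show False using c by simp
  qed
  then show ?thesis using lim by simp
qed

lemma
  assumes \<alpha>: "0 < \<alpha>" "\<alpha> \<le> 1" and \<mu>: "\<mu> \<noteq> 0" "\<bar>Arg \<mu>\<bar> > \<alpha> * pi / 2"
  shows ml_resolvent_L1: "set_integrable lborel {0..} (ml_resolvent \<alpha> \<mu>)"
    and ml_solution_decay: "(ml_solution \<alpha> \<mu> \<longlongrightarrow> 0) at_top"
proof -
  show "set_integrable lborel {0..} (ml_resolvent \<alpha> \<mu>)"
    using assms ml_resolvent_L1_fractional ml_resolvent_L1_ode(1) Re_neg_if_Arg_gt
    by (cases "\<alpha> = 1") auto
  show "(ml_solution \<alpha> \<mu> \<longlongrightarrow> 0) at_top"
    using assms ml_solution_decay_fractional ml_resolvent_L1_ode(2) Re_neg_if_Arg_gt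
    by (cases "\<alpha> = 1") auto
qed

text \<open>Dominated convergence with majorant M |r|: for fixed u the factor f(t - u) tends to
  0.\<close>

lemma conv_tendsto_0:
  assumes r: "locally_integrable r" "set_integrable lborel {0..} r"
    and f: "continuous_on UNIV f" and lim: "(f \<longlongrightarrow> 0) at_top"
  shows "(conv r f \<longlongrightarrow> 0) at_top"
proof -
  obtain M where M: "\<And>t. t \<ge> 0 \<Longrightarrow> norm (f t) \<le> M" using bounded_if_tendsto_0[OF f lim] by blast
  have M0: "M \<ge> 0" using M[of 0] norm_ge_zero[of "f 0"] by linarith
  have [measurable]: "r \<in> borel_measurable borel" "f \<in> borel_measurable borel"
    using r f by (auto simp: locally_integrable_def intro: borel_measurable_continuous_onI)
  have "((\<lambda>t. \<integral>u. indicator {0..t} u *\<^sub>R (r u * f (t - u)) \<partial>lborel) \<longlongrightarrow> (\<integral>u. 0 \<partial>(lborel :: real measure))) at_top"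
  proof (rule integral_dominated_convergence_at_top[where w = "\<lambda>u. M * norm (indicator {0..} u *\<^sub>R r u)"])
    show "integrable lborel (\<lambda>u. M * norm (indicator {0..} u *\<^sub>R r u))"
      using r(2) unfolding set_integrable_def by (intro integrable_mult_right integrable_norm)
    show "AE u in lborel. ((\<lambda>t. indicator {0..t} u *\<^sub>R (r u * f (t - u))) \<longlongrightarrow> 0) at_top"
    proof (rule AE_I2)
      fix u :: real
      have "filterlim (\<lambda>t. t - u) at_top at_top" by real_asymp
      from filterlim_compose[OF lim this]
      have "((\<lambda>t. norm (r u) * norm (f (t - u))) \<longlongrightarrow> 0) at_top" by (auto intro!: tendsto_eq_intros tendsto_norm_zero)
      then show "((\<lambda>t. indicator {0..t} u *\<^sub>R (r u * f (t - u))) \<longlongrightarrow> 0) at_top"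
        by (rule Lim_null_comparison[rotated]) (auto simp: norm_mult indicator_def)
    qed
    show "eventually (\<lambda>t. AE u in lborel. norm (indicator {0..t} u *\<^sub>R (r u * f (t - u))) \<le> M * norm (indicator {0..} u *\<^sub>R r u)) at_top"
      using M M0 by (auto intro!: always_eventually AE_I2 simp: indicator_def norm_mult mult.commute[of M] intro!: mult_left_mono)
  qed auto
  then show ?thesis by (simp add: conv_def[abs_def] set_lebesgue_integral_def)
qed

section \<open>The triangular system\<close>

text \<open>Reflection u to t - u, plus the passage from the gauge to the Lebesgue integral.
  Agreement of f and F is asked only on [0, t], so solutions may be arbitrary at negative
  times.\<close>

lemma RL_integral_eq_conv:
  assumes \<alpha>: "\<alpha> > 0" and F: "continuous_on UNIV F" and eq: "\<And>s. 0 \<le> s \<Longrightarrow> s \<le> t \<Longrightarrow> f s = F s"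
  shows "RL_integral \<alpha> f t = conv (RL_kernel \<alpha>) F t"
proof -
  let ?k = "RL_kernel \<alpha>"
  have "integrable lborel (\<lambda>u. indicator {0..t} u *\<^sub>R (?k u * F (t - u)))"
    using set_integrable_conv[OF locally_integrable_RL_kernel[OF \<alpha>] F, of t] by (simp add: set_integrable_def)
  then have "integrable lborel (\<lambda>u. indicator {0..t} (t + (- 1) * u) *\<^sub>R (?k (t + (- 1) * u) * F (t - (t + (- 1) * u))))"
    by (rule lborel_integrable_real_affine) simp
  then have si: "set_integrable lborel {0..t} (\<lambda>u. ?k (t - u) * F u)"
    unfolding set_integrable_def
    by (rule Bochner_Integration.integrable_cong[THEN iffD1, OF refl, rotated]) (auto simp: indicator_def)
  have "conv ?k F t = (LBINT u:{0..t}. ?k (t - u) * F u)"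
    by (subst conv_commute) (simp add: conv_def mult.commute)
  also have "\<dots> = integral {0..t} (\<lambda>u. ?k (t - u) * F u)"
    by (rule set_borel_integral_eq_integral(2)[OF si])
  also have "\<dots> = integral {0..t} (\<lambda>s. 1 / complex_of_real (Gamma \<alpha>) * (complex_of_real ((t - s) powr (\<alpha> - 1)) * f s))"
    by (intro integral_cong) (simp add: RL_kernel_def eq)
  also have "\<dots> = RL_integral \<alpha> f t"
    unfolding RL_integral_def by (rule integral_mult_right)
  finally show ?thesis ..
qed

lemma continuous_on_max_0:
  fixes f :: "real \<Rightarrow> 'b::topological_space"
  assumes "continuous_on {0..} f" shows "continuous_on UNIV (\<lambda>s. f (max 0 s))"
  by (rule continuous_on_compose2[OF assms]) (auto intro!: continuous_intros)

text \<open>Solutions and \<open>g\<close> are only specified on \<open>{0..}\<close>; composing with \<open>max 0\<close> extends them to functions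
  that are continuous on \<open>UNIV\<close>.\<close>

definition forcing ::
  "complex ^ ('n::{finite,linorder}) ^ ('n::{finite,linorder}) \<Rightarrow> (real \<Rightarrow> complex ^ ('n::{finite,linorder})) \<Rightarrow>
   ('n \<Rightarrow> real \<Rightarrow> complex) \<Rightarrow> 'n \<Rightarrow> real \<Rightarrow> complex" where
  "forcing a g X i s = (\<Sum>j\<in>{i<..}. a $ i $ j * X j s) + g (max 0 s) $ i"

lemma continuous_forcing:
  assumes "continuous_on {0..} g" "\<And>j. continuous_on UNIV (X j)"
  shows "continuous_on UNIV (forcing a g X i)"
  unfolding forcing_def[abs_def] using continuous_on_max_0[OF assms(1)] assms(2)
  by (intro continuous_intros) auto

text \<open>Splits off the diagonal term, so that each component satisfies the scalar equation with
  \<open>forcing\<close> as inhomogeneity.\<close>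

lemma caputo_solution_iff:
  fixes x :: "real \<Rightarrow> complex ^ ('n::{finite,linorder})"
  assumes \<alpha>: "\<And>i. \<alpha> $ i > 0" and g: "continuous_on {0..} g"
  defines "X \<equiv> \<lambda>i s. x (max 0 s) $ i"
  shows "caputo_solution \<alpha> a g x0 x \<longleftrightarrow> continuous_on {0..} x \<and>
    (\<forall>t\<ge>0. \<forall>i. X i t = x0 $ i + conv (RL_kernel (\<alpha> $ i)) (\<lambda>s. a $ i $ i * X i s + forcing a g X i s) t)"
proof (cases "continuous_on {0..} x")
  case True
  have X: "continuous_on UNIV (X i)" for i
    unfolding X_def using continuous_on_max_0[OF True] by (intro continuous_intros)
  have "RL_integral (\<alpha> $ i) (\<lambda>s. (\<Sum>j\<in>{i..}. a $ i $ j * x s $ j) + g s $ i) t =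
    conv (RL_kernel (\<alpha> $ i)) (\<lambda>s. a $ i $ i * X i s + forcing a g X i s) t" for i t
  proof (rule RL_integral_eq_conv[OF \<alpha>])
    show "continuous_on UNIV (\<lambda>s. a $ i $ i * X i s + forcing a g X i s)"
      by (intro continuous_intros X continuous_forcing g)
    have "{i..} = insert i {i<..}" by auto
    then show "(\<Sum>j\<in>{i..}. a $ i $ j * x s $ j) + g s $ i = a $ i $ i * X i s + forcing a g X i s" if "0 \<le> s" for s
      using that by (simp add: X_def forcing_def)
  qed
  moreover have "x t $ i = X i t" if "t \<ge> 0" for i t using that by (simp add: X_def)
  ultimately show ?thesis
    unfolding caputo_solution_def by (intro conj_cong all_cong arg_cong[of _ _ All] ext refl) (simp only:)
qed (simp add: caputo_solution_def)

text \<open>Each inserted index b lies below all indices treated before. As \<open>forcing\<close>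
  at i reads only components above i, redefining component b leaves the equations already solved
  intact. Components outside A are placeholders, continuous but otherwise arbitrary.\<close>

lemma caputo_solution_exists:
  fixes \<alpha> :: "real ^ ('n::{finite,linorder})"
  assumes \<alpha>: "\<And>i. \<alpha> $ i > 0" and a: "\<And>i. a $ i $ i \<noteq> 0" and g: "continuous_on {0..} g"
  obtains x where "caputo_solution \<alpha> a g x0 x"
proof -
  have "\<exists>X. (\<forall>i. continuous_on UNIV (X i)) \<and> (\<forall>i\<in>A. \<forall>t\<ge>0. X i t =
      x0 $ i + conv (RL_kernel (\<alpha> $ i)) (\<lambda>s. a $ i $ i * X i s + forcing a g X i s) t)"
    if "finite A" for A :: "'n set"
    using that
  proof (induction rule: finite_linorder_min_induct)
    case empty
    then show ?case by (intro exI[of _ "\<lambda>_ _. 0"]) auto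
  next
    case (insert b A)
    then obtain X where X: "\<And>i. continuous_on UNIV (X i)"
      and X_eq: "\<And>i t. i \<in> A \<Longrightarrow> t \<ge> 0 \<Longrightarrow> X i t =
        x0 $ i + conv (RL_kernel (\<alpha> $ i)) (\<lambda>s. a $ i $ i * X i s + forcing a g X i s) t" by blast
    define z where "z t = x0 $ b * ml_solution (\<alpha> $ b) (a $ b $ b) t +
      conv (ml_resolvent (\<alpha> $ b) (a $ b $ b)) (forcing a g X b) t" for t
    have f: "continuous_on UNIV (forcing a g X b)" by (rule continuous_forcing[OF g X])
    have z: "continuous_on UNIV z"
      unfolding z_def by (intro continuous_intros continuous_ml_solution continuous_conv locally_integrable_ml_resolvent \<alpha> f)
    have z_eq: "z t = x0 $ b + conv (RL_kernel (\<alpha> $ b)) (\<lambda>s. a $ b $ b * z s + forcing a g X b s) t" if "t \<ge> 0" for t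
      using scalar_solution_exists[OF \<alpha> a f that, of "x0 $ b"] by (simp only: z_def)
    define Y where "Y = X(b := z)"
    have "forcing a g Y i = forcing a g X i" if "b \<le> i" for i
      using that by (auto simp: forcing_def fun_eq_iff Y_def intro!: sum.cong)
    then have f_Y: "forcing a g Y i = forcing a g X i" if "i \<in> insert b A" for i
      using that insert.hyps by (auto simp: less_imp_le)
    have "\<forall>i\<in>insert b A. \<forall>t\<ge>0. Y i t =
        x0 $ i + conv (RL_kernel (\<alpha> $ i)) (\<lambda>s. a $ i $ i * Y i s + forcing a g Y i s) t"
    proof (intro ballI allI impI)
      fix i and t :: real assume i: "i \<in> insert b A" and t: "t \<ge> 0"
      show "Y i t = x0 $ i + conv (RL_kernel (\<alpha> $ i)) (\<lambda>s. a $ i $ i * Y i s + forcing a g Y i s) t"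
      proof (cases "i = b")
        case True
        then have "Y i = z" by (simp add: Y_def)
        then show ?thesis unfolding f_Y[OF i] using z_eq[OF t] True by (simp only:)
      next
        case False
        then have "Y i = X i" by (simp add: Y_def)
        then show ?thesis unfolding f_Y[OF i] using X_eq[OF _ t, of i] False i by simp
      qed
    qed
    moreover have "\<forall>i. continuous_on UNIV (Y i)" using X z by (simp add: Y_def)
    ultimately show ?case by blast
  qed
  from this[of UNIV] obtain X where X: "\<And>i. continuous_on UNIV (X i)"
    and X_eq: "\<And>i t. t \<ge> 0 \<Longrightarrow> X i t =
        x0 $ i + conv (RL_kernel (\<alpha> $ i)) (\<lambda>s. a $ i $ i * X i s + forcing a g X i s) t" by auto
  define x where "x t = (\<chi> i. X i t)" for t
  have "continuous_on {0..} x"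
    unfolding x_def by (intro continuous_on_vec_lambda continuous_on_subset[OF X]) auto
  moreover have "X i (max 0 t) = x0 $ i + conv (RL_kernel (\<alpha> $ i)) (\<lambda>s. a $ i $ i * X i (max 0 s) + forcing a g (\<lambda>i s. X i (max 0 s)) i s) t"
    if "t \<ge> 0" for i t
  proof -
    have "conv (RL_kernel (\<alpha> $ i)) (\<lambda>s. a $ i $ i * X i (max 0 s) + forcing a g (\<lambda>i s. X i (max 0 s)) i s) t =
      conv (RL_kernel (\<alpha> $ i)) (\<lambda>s. a $ i $ i * X i s + forcing a g X i s) t"
      by (rule conv_cong) (auto simp: forcing_def)
    then show ?thesis using X_eq[OF that, of i] that by simp
  qed
  ultimately have "caputo_solution \<alpha> a g x0 x"
    unfolding caputo_solution_iff[OF \<alpha> g] x_def vec_lambda_beta by blast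
  then show ?thesis by (rule that)
qed

text \<open>Back substitution as an induction from the last index downwards, with the number of
  larger indices as measure.\<close>

lemma greater_induct_finite:
  fixes P :: "'n::{finite,linorder} \<Rightarrow> bool"
  assumes "\<And>i. (\<And>j. i < j \<Longrightarrow> P j) \<Longrightarrow> P i"
  shows "P i"
proof (induction "card {i<..}" arbitrary: i rule: less_induct)
  case less
  show ?case
  proof (rule assms)
    fix j assume "i < j"
    then have "{j<..} \<subset> {i<..}" by auto
    then have "card {j<..} < card {i<..}" by (intro psubset_card_mono) auto
    then show "P j" by (rule less)
  qed
qed

section \<open>Stability and instability of the system\<close>

lemma caputo_solution_stable:
  fixes \<alpha> :: "real ^ ('n::{finite,linorder})"
  assumes \<alpha>: "\<And>i. 0 < \<alpha> $ i \<and> \<alpha> $ i \<le> 1" and a: "\<And>i. a $ i $ i \<noteq> 0"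
    and g: "continuous_on {0..} g" "(g \<longlongrightarrow> 0) at_top"
    and sector: "\<And>k. \<bar>Arg (a $ k $ k)\<bar> > \<alpha> $ k * pi / 2"
    and x: "caputo_solution \<alpha> a g x0 x"
  shows "(x \<longlongrightarrow> 0) at_top"
proof -
  define X where "X i s = x (max 0 s) $ i" for i s
  have \<alpha>_pos: "\<alpha> $ i > 0" for i using \<alpha> by simp
  have "continuous_on {0..} x \<and> (\<forall>t\<ge>0. \<forall>i. X i t = x0 $ i + conv (RL_kernel (\<alpha> $ i)) (\<lambda>s. a $ i $ i * X i s + forcing a g X i s) t)"
    using x unfolding caputo_solution_iff[OF \<alpha>_pos g(1)] X_def .
  then have x_cont: "continuous_on {0..} x"
    and X_eq: "\<And>i t. t \<ge> 0 \<Longrightarrow> X i t = x0 $ i + conv (RL_kernel (\<alpha> $ i)) (\<lambda>s. a $ i $ i * X i s + forcing a g X i s) t"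
    by blast+
  have X: "continuous_on UNIV (X i)" for i
    unfolding X_def using continuous_on_max_0[OF x_cont] by (intro continuous_intros)
  have f: "continuous_on UNIV (forcing a g X i)" for i by (intro continuous_forcing g X)
  have ev: "eventually (\<lambda>t::real. max 0 t = t) at_top"
    using eventually_ge_at_top[of 0] by eventually_elim simp
  have g_lim: "((\<lambda>t. g (max 0 t) $ i) \<longlongrightarrow> 0) at_top" for i
  proof -
    have "((\<lambda>t. g t $ i) \<longlongrightarrow> 0) at_top" using tendsto_vec_nth[OF g(2), of i] by simp
    then show ?thesis
      by (rule Lim_transform_eventually) (use ev in eventually_elim, simp)
  qed
  have X_lim: "(X i \<longlongrightarrow> 0) at_top" for i
  proof (induction i rule: greater_induct_finite)
    case (1 i)
    have "(forcing a g X i \<longlongrightarrow> 0) at_top"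
    proof -
      have "((\<lambda>s. (\<Sum>j\<in>{i<..}. a $ i $ j * X j s) + g (max 0 s) $ i) \<longlongrightarrow> 0 + 0) at_top"
        by (intro tendsto_add tendsto_null_sum tendsto_mult_right_zero g_lim) (use 1 in auto)
      then show ?thesis by (simp add: forcing_def[abs_def])
    qed
    then have "(conv (ml_resolvent (\<alpha> $ i) (a $ i $ i)) (forcing a g X i) \<longlongrightarrow> 0) at_top"
      by (intro conv_tendsto_0 locally_integrable_ml_resolvent \<alpha>_pos ml_resolvent_L1 a f sector) (use \<alpha> in auto)
    moreover have "(ml_solution (\<alpha> $ i) (a $ i $ i) \<longlongrightarrow> 0) at_top"
      by (intro ml_solution_decay a sector) (use \<alpha> in auto)
    ultimately have "((\<lambda>t. x0 $ i * ml_solution (\<alpha> $ i) (a $ i $ i) t + conv (ml_resolvent (\<alpha> $ i) (a $ i $ i)) (forcing a g X i) t) \<longlongrightarrow> 0) at_top"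
      by (auto intro!: tendsto_eq_intros)
    moreover have "eventually (\<lambda>t. x0 $ i * ml_solution (\<alpha> $ i) (a $ i $ i) t + conv (ml_resolvent (\<alpha> $ i) (a $ i $ i)) (forcing a g X i) t = X i t) at_top"
      using eventually_ge_at_top[of 0]
      by eventually_elim (rule scalar_solution_formula[OF \<alpha>_pos a f X X_eq, symmetric])
    ultimately show ?case by (rule Lim_transform_eventually)
  qed
  have "((\<lambda>t. x t $ i) \<longlongrightarrow> 0) at_top" for i
    by (rule Lim_transform_eventually[OF X_lim[of i]]) (use ev in eventually_elim, simp add: X_def)
  then show ?thesis by (intro vec_tendstoI) simp
qed

text \<open>Components after k have zero initial value and, by induction from the top, zero forcing,
  so they vanish. Component k then solves x = 1 + a_kk k * x with the kernel k of order alpha_k, and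
  \<open>no_decay\<close> applies to it.\<close>

lemma caputo_solution_unstable:
  fixes \<alpha> :: "real ^ ('n::{finite,linorder})"
  assumes \<alpha>: "\<And>i. 0 < \<alpha> $ i \<and> \<alpha> $ i \<le> 1" and a: "\<And>i. a $ i $ i \<noteq> 0"
    and sector: "\<bar>Arg (a $ k $ k)\<bar> \<le> \<alpha> $ k * pi / 2"
    and x: "caputo_solution \<alpha> a (\<lambda>_. 0) (axis k 1) x"
  shows "\<not> (x \<longlongrightarrow> 0) at_top"
proof
  assume lim: "(x \<longlongrightarrow> 0) at_top"
  define X where "X i s = x (max 0 s) $ i" for i s
  have \<alpha>_pos: "\<alpha> $ i > 0" for i using \<alpha> by simp
  have g: "continuous_on {0..} (\<lambda>_. 0 :: complex ^ ('n::{finite,linorder}))" by simp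
  have "continuous_on {0..} x \<and> (\<forall>t\<ge>0. \<forall>i. X i t = axis k 1 $ i + conv (RL_kernel (\<alpha> $ i)) (\<lambda>s. a $ i $ i * X i s + forcing a (\<lambda>_. 0) X i s) t)"
    using x unfolding caputo_solution_iff[OF \<alpha>_pos g] X_def .
  then have x_cont: "continuous_on {0..} x"
    and X_eq: "\<And>i t. t \<ge> 0 \<Longrightarrow> X i t = axis k 1 $ i + conv (RL_kernel (\<alpha> $ i)) (\<lambda>s. a $ i $ i * X i s + forcing a (\<lambda>_. 0) X i s) t"
    by blast+
  have X: "continuous_on UNIV (X i)" for i
    unfolding X_def using continuous_on_max_0[OF x_cont] by (intro continuous_intros)
  have f: "continuous_on UNIV (forcing a (\<lambda>_. 0) X i)" for i by (intro continuous_forcing g X)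
  have zero: "k < i \<longrightarrow> (\<forall>t\<ge>0. X i t = 0)" for i
  proof (induction i rule: greater_induct_finite)
    case (1 i)
    show ?case
    proof (intro impI allI)
      fix t :: real assume k: "k < i" and t: "t \<ge> 0"
      have "X i t = axis k 1 $ i * ml_solution (\<alpha> $ i) (a $ i $ i) t + conv (ml_resolvent (\<alpha> $ i) (a $ i $ i)) (forcing a (\<lambda>_. 0) X i) t"
        by (rule scalar_solution_formula[OF \<alpha>_pos a f X X_eq t])
      also have "conv (ml_resolvent (\<alpha> $ i) (a $ i $ i)) (forcing a (\<lambda>_. 0) X i) t = conv (ml_resolvent (\<alpha> $ i) (a $ i $ i)) (\<lambda>_. 0) t"
        using 1 k by (intro conv_cong) (auto simp: forcing_def intro!: sum.neutral)
      finally show "X i t = 0" using k by (simp add: axis_def conv_def)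
    qed
  qed
  have "X k t = 1 + a $ k $ k * conv (RL_kernel (\<alpha> $ k)) (X k) t" if t: "t \<ge> 0" for t
  proof -
    have "X k t = 1 + conv (RL_kernel (\<alpha> $ k)) (\<lambda>s. a $ k $ k * X k s + forcing a (\<lambda>_. 0) X k s) t"
      using X_eq[OF t, of k] by (simp add: axis_def)
    also have "conv (RL_kernel (\<alpha> $ k)) (\<lambda>s. a $ k $ k * X k s + forcing a (\<lambda>_. 0) X k s) t = conv (RL_kernel (\<alpha> $ k)) (\<lambda>s. a $ k $ k * X k s) t"
      using zero by (intro conv_cong) (auto simp: forcing_def intro!: sum.neutral)
    finally show ?thesis by (simp only: conv_mult_right)
  qed
  moreover have "(X k \<longlongrightarrow> 0) at_top"
  proof -
    have "((\<lambda>t. x t $ k) \<longlongrightarrow> 0) at_top" using tendsto_vec_nth[OF lim, of k] by simp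
    then show ?thesis
      by (rule Lim_transform_eventually)
         (use eventually_ge_at_top[of 0] in eventually_elim, simp add: X_def)
  qed
  ultimately show False
    using no_decay[OF _ _ a sector X] \<alpha> by blast
qed

lemma caputo_solution_add:
  fixes \<alpha> :: "real ^ ('n::{finite,linorder})"
  assumes \<alpha>: "\<And>i. \<alpha> $ i > 0" and g: "continuous_on {0..} g"
    and x: "caputo_solution \<alpha> a g x0 x" and y: "caputo_solution \<alpha> a (\<lambda>_. 0) y0 y"
  shows "caputo_solution \<alpha> a g (x0 + y0) (\<lambda>t. x t + y t)"
proof -
  have g0: "continuous_on {0..} (\<lambda>_. 0 :: complex ^ ('n::{finite,linorder}))" by simp
  define X where "X i s = x (max 0 s) $ i" for i s
  define Y where "Y i s = y (max 0 s) $ i" for i s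
  have "continuous_on {0..} x \<and> (\<forall>t\<ge>0. \<forall>i. X i t = x0 $ i + conv (RL_kernel (\<alpha> $ i)) (\<lambda>s. a $ i $ i * X i s + forcing a g X i s) t)"
    using x unfolding caputo_solution_iff[OF \<alpha> g] X_def .
  then have x_cont: "continuous_on {0..} x"
    and X_eq: "\<And>i t. t \<ge> 0 \<Longrightarrow> X i t = x0 $ i + conv (RL_kernel (\<alpha> $ i)) (\<lambda>s. a $ i $ i * X i s + forcing a g X i s) t"
    by blast+
  have "continuous_on {0..} y \<and> (\<forall>t\<ge>0. \<forall>i. Y i t = y0 $ i + conv (RL_kernel (\<alpha> $ i)) (\<lambda>s. a $ i $ i * Y i s + forcing a (\<lambda>_. 0) Y i s) t)"
    using y unfolding caputo_solution_iff[OF \<alpha> g0] Y_def .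
  then have y_cont: "continuous_on {0..} y"
    and Y_eq: "\<And>i t. t \<ge> 0 \<Longrightarrow> Y i t = y0 $ i + conv (RL_kernel (\<alpha> $ i)) (\<lambda>s. a $ i $ i * Y i s + forcing a (\<lambda>_. 0) Y i s) t"
    by blast+
  have X: "continuous_on UNIV (X i)" for i
    unfolding X_def using continuous_on_max_0[OF x_cont] by (intro continuous_intros)
  have Y: "continuous_on UNIV (Y i)" for i
    unfolding Y_def using continuous_on_max_0[OF y_cont] by (intro continuous_intros)
  have cX: "continuous_on UNIV (\<lambda>s. a $ i $ i * X i s + forcing a g X i s)" for i
    by (intro continuous_intros X continuous_forcing g)
  have cY: "continuous_on UNIV (\<lambda>s. a $ i $ i * Y i s + forcing a (\<lambda>_. 0) Y i s)" for i
    by (intro continuous_intros Y continuous_forcing g0)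
  have split: "a $ i $ i * (X i s + Y i s) + forcing a g (\<lambda>i s. X i s + Y i s) i s =
     (a $ i $ i * X i s + forcing a g X i s) + (a $ i $ i * Y i s + forcing a (\<lambda>_. 0) Y i s)" for i s
    by (simp add: forcing_def ring_distribs sum.distrib)
  have "X i t + Y i t = (x0 + y0) $ i + conv (RL_kernel (\<alpha> $ i)) (\<lambda>s. a $ i $ i * (X i s + Y i s) + forcing a g (\<lambda>i s. X i s + Y i s) i s) t"
    if "t \<ge> 0" for i t
    unfolding split conv_add_right[OF locally_integrable_RL_kernel[OF \<alpha>] cX cY]
    using X_eq[OF that, of i] Y_eq[OF that, of i] by simp
  moreover have "continuous_on {0..} (\<lambda>t. x t + y t)" using x_cont y_cont by (rule continuous_on_add)
  ultimately show ?thesis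
    unfolding caputo_solution_iff[OF \<alpha> g] vector_add_component X_def Y_def by blast
qed

theorem corollary3p3:
  fixes \<alpha> :: "real ^ ('n::{finite,linorder})"
    and a :: "complex ^ ('n::{finite,linorder}) ^ ('n::{finite,linorder})"
    and g :: "real \<Rightarrow> complex ^ ('n::{finite,linorder})"
  assumes "\<And>i. 0 < \<alpha> $ i \<and> \<alpha> $ i \<le> 1"
    and "\<And>i. a $ i $ i \<noteq> 0"
    and "continuous_on {0..} g"
    and "(g \<longlongrightarrow> 0) at_top"
  shows "((\<forall>x0 x. caputo_solution \<alpha> a g x0 x \<longrightarrow> (x \<longlongrightarrow> 0) at_top) \<longleftrightarrow>
          (\<forall>x0 x. caputo_solution \<alpha> a (\<lambda>_. 0) x0 x \<longrightarrow> (x \<longlongrightarrow> 0) at_top)) \<and>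
         ((\<forall>x0 x. caputo_solution \<alpha> a (\<lambda>_. 0) x0 x \<longrightarrow> (x \<longlongrightarrow> 0) at_top) \<longleftrightarrow>
          (\<forall>k. \<bar>Arg (a $ k $ k)\<bar> > \<alpha> $ k * pi / 2))"
proof -
  let ?stable = "\<lambda>g. \<forall>x0 x. caputo_solution \<alpha> a g x0 x \<longrightarrow> (x \<longlongrightarrow> 0) at_top"
  let ?sector = "\<forall>k. \<bar>Arg (a $ k $ k)\<bar> > \<alpha> $ k * pi / 2"
  have \<alpha>_pos: "\<alpha> $ i > 0" for i using assms(1) by simp
  have g0: "continuous_on {0..} (\<lambda>_. 0 :: complex ^ ('n::{finite,linorder}))" "((\<lambda>_. 0 :: complex ^ ('n::{finite,linorder})) \<longlongrightarrow> 0) at_top" by auto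
  have 1: "?stable g" if "?sector"
    using caputo_solution_stable[OF assms(1,2,3,4)] that by blast
  have 2: "?stable (\<lambda>_. 0)" if "?sector"
    using caputo_solution_stable[OF assms(1,2) g0] that by blast
  have 3: "?sector" if "?stable (\<lambda>_. 0)"
  proof (rule ccontr)
    assume "\<not> ?sector"
    then obtain k where k: "\<bar>Arg (a $ k $ k)\<bar> \<le> \<alpha> $ k * pi / 2" by (auto simp: not_less)
    obtain x where x: "caputo_solution \<alpha> a (\<lambda>_. 0) (axis k 1) x"
      using caputo_solution_exists[OF \<alpha>_pos assms(2) g0(1)] by blast
    then show False using caputo_solution_unstable[OF assms(1,2) k x] that by blast
  qed
  \<comment> \<open>A homogeneous solution y is the difference of the inhomogeneous solutions x + y
    and x. The existence of one inhomogeneous x is essential here, since otherwise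
    \<open>?stable g\<close> could hold vacuously.\<close>
  have 4: "?stable (\<lambda>_. 0)" if st: "?stable g"
  proof (intro allI impI)
    fix y0 y assume y: "caputo_solution \<alpha> a (\<lambda>_. 0) y0 y"
    obtain x where x: "caputo_solution \<alpha> a g 0 x"
      using caputo_solution_exists[OF \<alpha>_pos assms(2,3)] by blast
    have "((\<lambda>t. x t + y t) \<longlongrightarrow> 0) at_top" "(x \<longlongrightarrow> 0) at_top"
      using st caputo_solution_add[OF \<alpha>_pos assms(3) x y] x by blast+
    then have "((\<lambda>t. (x t + y t) - x t) \<longlongrightarrow> 0 - 0) at_top" by (rule tendsto_diff)
    then show "(y \<longlongrightarrow> 0) at_top" by simp
  qed
  from 1 2 3 4 show ?thesis by blast
qed

end
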